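(* Let $C$ be the modular tensor category of a $2+1$D TQFT. For every $q\in\mathrm{Gal}(K_C)$, $C$ and its Galois conjugate $q(C)$ have the same (isomorphic) unitary 2-group symmetry $(G,\mathcal{A},\rho,[\beta])$, where $G$ is the group of unitary 0-form symmetries.
   Context: A modular tensor category (MTC) $C$ (simple objects $a,b,\dots$ called anyons, unit $1$, fusion rules $a\otimes b=\sum_c N_{ab}^c c$, modular matrix $S$) is described, after choosing bases $|a,b,c;\mu\rangle$ of the fusion spaces $V_{ab}^c$ (such a choice is called a gauge), by its $F$ symbols $(F_{abc}^d)_{(e,\alpha,\beta)}^{(f,\mu,\nu)}$ ($e\in a\otimes b$, $f\in b\otimes c$), $R$ symbols $(R_{ab}^c)_{\mu\nu}$ and pivotal coefficients $\epsilon_a\in\{\pm1\}$. There is always a gauge in which all entries of $F$ and $R$ lie in a number field; fix such a gauge; $K_C$ is the normal closure over $\mathbb{Q}$ of $\mathbb{Q}(F,R)$. For $q\in\mathrm{Gal}(K_C):=\mathrm{Gal}(K_C/\mathbb{Q})$, $q(C)$ is the MTC with the same anyons, fusion rules and $\epsilon_a$, and with data $q(F),q(R)$. Unitary 0-form symmetry: a unitary symmetry $g$ consists of a permutation $a\mapsto g(a)$ of the anyons preserving fusion rules together with unitary matrices $U_g(a,b,c)$ acting by $g|a,b,c;\mu\rangle=\sum_{\mu'}U_g(g(a),g(b),g(c))_{\mu\mu'}|g(a),g(b),g(c);\mu'\rangle$ such that $$\sum_{\mu',\nu'}[U_g(g(b),g(a),g(c))]_{\mu\mu'}(R^{g(c)}_{g(a)g(b)})_{\mu'\nu'}[U_g(g(a),g(b),g(c))^{-1}]_{\nu'\nu}=(R_{ab}^c)_{\mu\nu},$$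 $$\sum_{\alpha',\beta',\mu',\nu'}[U_g(g(a),g(b),g(e))]_{\alpha\alpha'}[U_g(g(e),g(c),g(d))]_{\beta\beta'}(F^{g(d)}_{g(a)g(b)g(c)})^{(g(f),\mu',\nu')}_{(g(e),\alpha',\beta')}[U_g(g(b),g(c),g(f))^{-1}]_{\mu'\mu}[U_g(g(a),g(f),g(d))^{-1}]_{\nu'\nu}=(F^d_{abc})^{(f,\mu,\nu)}_{(e,\alpha,\beta)}.$$ $G$ is the group of such maps modulo natural isomorphisms, i.e. modulo maps fixing all anyons and acting as $|a,b,c;\mu\rangle\mapsto\frac{\gamma_a\gamma_b}{\gamma_c}|a,b,c;\mu\rangle$ for phases $\gamma_a$. 1-form symmetry: $\mathcal{A}$ is the abelian group (under fusion) of invertible (abelian) anyons; $\rho:G\to\mathrm{Aut}(\mathcal{A})$ is the restriction of the permutation action. Postnikov class: choose representatives with $U_e=1$, $U_g(1,b,c)=U_g(a,1,c)=1$. There are phases $\gamma_a(g,h)$, with $\gamma_1(g,h)=\gamma_a(e,h)=\gamma_a(g,e)=1$, such that whenever $N_{ab}^c\neq0$ $$\frac{\gamma_a(g,h)\gamma_b(g,h)}{\gamma_c(g,h)}\delta_{\mu\nu}=\sum_{\alpha,\beta}[U_g(a,b,c)^{-1}]_{\mu\alpha}[U_h(g^{-1}(a),g^{-1}(b),g^{-1}(c))^{-1}]_{\alpha\beta}[U_{gh}(a,b,c)]_{\beta\nu}.$$ Set $\Omega_a(g,h,k)=\dfrac{\gamma_{g^{-1}(a)}(h,k)\,\gamma_a(g,hk)}{\gamma_a(gh,k)\gamma_a(g,h)}$.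 Then there is a unique $\beta(g,h,k)\in\mathcal{A}$ with $\Omega_a(g,h,k)=\frac{S_{a\beta(g,h,k)}S_{11}}{S_{1\beta(g,h,k)}S_{1a}}$ for all $a$; $\beta$ is a twisted 3-cocycle with well-defined class $[\beta]\in H^3_{[\rho]}(G,\mathcal{A})$, the Postnikov class. The unitary 2-group symmetry is the quadruple $(G,\mathcal{A},\rho,[\beta])$; two such are isomorphic if there are group isomorphisms of the $G$'s and of the $\mathcal{A}$'s compatible with $\rho$ and matching the classes $[\beta]$.
   Formalization: Unitarity of U_g depends on the gauge, so the literal claim fails: proved for all q with U_g invertible and γ_a nonzero (linear symmetries), and with U_g unitary and γ_a phases if in the gauges of C and q(C) every linear symmetry is unitary up to natural isomorphism; unit F symbols taken trivial. *)

theory Defs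
  imports
    "HOL-Algebra.Algebra"
    "HOL-Algebra.Algebraic_Closure_Type"
    "Jordan_Normal_Form.Schur_Decomposition"
begin

section \<open>Number fields and Galois groups inside the complex numbers\<close>

abbreviation CC :: "complex ring" where
  "CC \<equiv> ring_of_type_algebra"

definition number_field :: "complex set \<Rightarrow> bool" where
  "number_field K \<longleftrightarrow> subfield K CC \<and> ring.finite_dimension CC \<rat> K"

definition normal_field :: "complex set \<Rightarrow> bool" where
  "normal_field L \<longleftrightarrow> subfield L CC \<and> (\<forall>x\<in>L. algebraic x) \<and>
     (\<forall>p :: rat poly. Factorial_Ring.irreducible p \<longrightarrow>
        (\<exists>x\<in>L. poly (map_poly of_rat p) x = 0) \<longrightarrow>
        (\<forall>x :: complex. poly (map_poly of_rat p) x = 0 \<longrightarrow> x \<in> L))"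

definition normal_closure_Q :: "complex set \<Rightarrow> complex set" where
  "normal_closure_Q K = \<Inter>{L. normal_field L \<and> K \<subseteq> L}"

text \<open>Only the values of \<^term>\<open>q\<close> on \<^term>\<open>K\<close> are constrained; elements of the group that agree on
  \<^term>\<open>K\<close> are not identified.\<close>

definition galois_Q :: "complex set \<Rightarrow> (complex \<Rightarrow> complex) set" where
  "galois_Q K = {q \<in> ring_iso (CC\<lparr>carrier := K\<rparr>) (CC\<lparr>carrier := K\<rparr>). \<forall>x\<in>\<rat>. q x = x}"


section \<open>Modular tensor categories in terms of F and R symbols\<close>

text \<open>The skeletal data of a category whose simple objects form the finite type \<^typ>\<open>'a\<close>, in a gauge.
  Basis vectors of \<open>V\<^sub>a\<^sub>b\<^sup>c\<close> are numbered by \<open>0, \<dots>, N a b c - 1\<close>.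

  \<^item> \<open>Fsym D a b c d (e, \<alpha>, \<beta>) (f, \<mu>, \<nu>)\<close> is the entry of \<open>F\<close> expressing the basis vector
    \<open>\<alpha> \<in> V\<^sub>a\<^sub>b\<^sup>e, \<beta> \<in> V\<^sub>e\<^sub>c\<^sup>d\<close> through \<open>\<mu> \<in> V\<^sub>b\<^sub>c\<^sup>f, \<nu> \<in> V\<^sub>a\<^sub>f\<^sup>d\<close>. Values at other indices are irrelevant
    throughout.
  \<^item> \<open>Rsym D a b c\<close> has its rows indexed by \<open>V\<^sub>b\<^sub>a\<^sup>c\<close> and its columns by \<open>V\<^sub>a\<^sub>b\<^sup>c\<close>.
  \<^item> \<open>piv D a\<close> is the pivotal coefficient of \<open>a\<close>.\<close>

record 'a mtc_data =
  vac :: 'a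
  Nfus :: "'a \<Rightarrow> 'a \<Rightarrow> 'a \<Rightarrow> nat"
  Fsym :: "'a \<Rightarrow> 'a \<Rightarrow> 'a \<Rightarrow> 'a \<Rightarrow> 'a \<times> nat \<times> nat \<Rightarrow> 'a \<times> nat \<times> nat \<Rightarrow> complex"
  Rsym :: "'a \<Rightarrow> 'a \<Rightarrow> 'a \<Rightarrow> complex mat"
  piv :: "'a \<Rightarrow> complex"

definition minv :: "complex mat \<Rightarrow> complex mat" where
  "minv A = (THE B. B \<in> carrier_mat (dim_col A) (dim_row A) \<and> inverts_mat A B \<and> inverts_mat B A)"

definition left_trees :: "'a mtc_data \<Rightarrow> 'a \<Rightarrow> 'a \<Rightarrow> 'a \<Rightarrow> 'a \<Rightarrow> ('a \<times> nat \<times> nat) set" where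
  "left_trees D a b c d = {(e, \<alpha>, \<beta>). \<alpha> < Nfus D a b e \<and> \<beta> < Nfus D e c d}"

definition right_trees :: "'a mtc_data \<Rightarrow> 'a \<Rightarrow> 'a \<Rightarrow> 'a \<Rightarrow> 'a \<Rightarrow> ('a \<times> nat \<times> nat) set" where
  "right_trees D a b c d = {(f, \<mu>, \<nu>). \<mu> < Nfus D b c f \<and> \<nu> < Nfus D a f d}"

definition dual :: "'a mtc_data \<Rightarrow> 'a \<Rightarrow> 'a" where
  "dual D a = (THE b. Nfus D a b (vac D) \<noteq> 0)"

definition fusion_rules :: "'a::finite mtc_data \<Rightarrow> bool" where
  "fusion_rules D \<longleftrightarrow>
     (\<forall>a b. Nfus D (vac D) a b = (if a = b then 1 else 0)) \<and>
     (\<forall>a b. Nfus D a (vac D) b = (if a = b then 1 else 0)) \<and>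
     (\<forall>a b c. Nfus D a b c = Nfus D b a c) \<and>
     (\<forall>a b c d. (\<Sum>e\<in>UNIV. Nfus D a b e * Nfus D e c d) = (\<Sum>f\<in>UNIV. Nfus D b c f * Nfus D a f d)) \<and>
     (\<forall>a. \<exists>b. \<forall>c. Nfus D a c (vac D) = (if c = b then 1 else 0))"

definition F_invertible :: "'a::finite mtc_data \<Rightarrow> bool" where
  "F_invertible D \<longleftrightarrow> (\<forall>a b c d. \<exists>G.
     (\<forall>x\<in>left_trees D a b c d. \<forall>x'\<in>left_trees D a b c d.
        (\<Sum>y\<in>right_trees D a b c d. Fsym D a b c d x y * G y x') = (if x = x' then 1 else 0)) \<and>
     (\<forall>y\<in>right_trees D a b c d. \<forall>y'\<in>right_trees D a b c d.
        (\<Sum>x\<in>left_trees D a b c d. G y x * Fsym D a b c d x y') = (if y = y' then 1 else 0)))"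

text \<open>The bases of \<open>V\<^sub>1\<^sub>a\<^sup>a\<close> and \<open>V\<^sub>a\<^sub>1\<^sup>a\<close> are the unit isomorphisms, so that the triangle axiom reads as
  follows. Together with the pentagon this makes every F symbol with a unit argument trivial.\<close>

definition triangle :: "'a::finite mtc_data \<Rightarrow> bool" where
  "triangle D \<longleftrightarrow> (\<forall>a c d. \<forall>\<beta><Nfus D a c d. \<forall>\<nu><Nfus D a c d.
     Fsym D a (vac D) c d (a, 0, \<beta>) (c, 0, \<nu>) = (if \<beta> = \<nu> then 1 else 0))"

definition pentagon :: "'a::finite mtc_data \<Rightarrow> bool" where
  "pentagon D \<longleftrightarrow> (\<forall>a b c d e f g k l.
     \<forall>\<alpha><Nfus D a b f. \<forall>\<beta><Nfus D f c g. \<forall>\<gamma><Nfus D g d e.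
     \<forall>\<delta><Nfus D c d l. \<forall>\<kappa><Nfus D b l k. \<forall>\<mu><Nfus D a k e.
       (\<Sum>\<nu><Nfus D f l e.
          Fsym D f c d e (g, \<beta>, \<gamma>) (l, \<delta>, \<nu>) * Fsym D a b l e (f, \<alpha>, \<nu>) (k, \<kappa>, \<mu>)) =
       (\<Sum>h\<in>UNIV. \<Sum>\<sigma><Nfus D b c h. \<Sum>\<psi><Nfus D a h g. \<Sum>\<rho><Nfus D h d k.
          Fsym D a b c g (f, \<alpha>, \<beta>) (h, \<sigma>, \<psi>) * Fsym D a h d e (g, \<psi>, \<gamma>) (k, \<rho>, \<mu>) *
          Fsym D b c d k (h, \<sigma>, \<rho>) (l, \<delta>, \<kappa>)))"

definition hexagon :: "'a::finite mtc_data \<Rightarrow> ('a \<Rightarrow> 'a \<Rightarrow> 'a \<Rightarrow> complex mat) \<Rightarrow> bool" where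
  "hexagon D B \<longleftrightarrow> (\<forall>a b c d e g.
     \<forall>\<alpha><Nfus D c a e. \<forall>\<beta><Nfus D e b d. \<forall>\<mu><Nfus D b c g. \<forall>\<nu><Nfus D a g d.
       (\<Sum>\<kappa><Nfus D a c e. \<Sum>\<gamma><Nfus D c b g.
          B a c e $$ (\<alpha>, \<kappa>) * Fsym D a c b d (e, \<kappa>, \<beta>) (g, \<gamma>, \<nu>) * B b c g $$ (\<gamma>, \<mu>)) =
       (\<Sum>f\<in>UNIV. \<Sum>\<sigma><Nfus D a b f. \<Sum>\<delta><Nfus D c f d. \<Sum>\<psi><Nfus D f c d.
          Fsym D c a b d (e, \<alpha>, \<beta>) (f, \<sigma>, \<delta>) * B f c d $$ (\<delta>, \<psi>) *
          Fsym D a b c d (f, \<sigma>, \<psi>) (g, \<mu>, \<nu>)))"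

text \<open>The second hexagon is the first one for the reversed braiding.\<close>

definition braided :: "'a::finite mtc_data \<Rightarrow> bool" where
  "braided D \<longleftrightarrow>
     (\<forall>a b c. Rsym D a b c \<in> carrier_mat (Nfus D b a c) (Nfus D a b c) \<and> invertible_mat (Rsym D a b c)) \<and>
     hexagon D (Rsym D) \<and> hexagon D (\<lambda>a b c. minv (Rsym D b a c))"

definition rigid :: "'a::finite mtc_data \<Rightarrow> bool" where
  "rigid D \<longleftrightarrow> (\<forall>a. Fsym D a (dual D a) a a (vac D, 0, 0) (vac D, 0, 0) \<noteq> 0)"

text \<open>The product of the three F matrices rotates \<open>V\<^sub>a\<^sub>b\<^sup>c \<rightarrow> V\<^sub>b\<^sub>c\<^sub>*\<^sup>a\<^sup>* \<rightarrow> V\<^sub>c\<^sub>*\<^sub>a\<^sup>b\<^sup>* \<rightarrow> V\<^sub>a\<^sub>b\<^sup>c\<close> and is the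
  tensor structure of the double dual functor, which the pivotal coefficients trivialise.\<close>

definition pivotal :: "'a::finite mtc_data \<Rightarrow> bool" where
  "pivotal D \<longleftrightarrow>
     (\<forall>a. piv D a \<in> {1, -1}) \<and> piv D (vac D) = 1 \<and>
     (\<forall>a b c. \<forall>\<alpha><Nfus D a b c. \<forall>\<alpha>'<Nfus D a b c.
        (\<Sum>\<mu><Nfus D b (dual D c) (dual D a). \<Sum>\<nu><Nfus D (dual D c) a (dual D b).
           Fsym D a b (dual D c) (vac D) (c, \<alpha>, 0) (dual D a, \<mu>, 0) *
           Fsym D b (dual D c) a (vac D) (dual D a, \<mu>, 0) (dual D b, \<nu>, 0) *
           Fsym D (dual D c) a b (vac D) (dual D b, \<nu>, 0) (c, \<alpha>', 0)) =
        (if \<alpha> = \<alpha>' then piv D a * piv D b / piv D c else 0))"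

definition qdim :: "'a mtc_data \<Rightarrow> 'a \<Rightarrow> complex" where
  "qdim D a = piv D a / Fsym D a (dual D a) a a (vac D, 0, 0) (vac D, 0, 0)"

definition spherical :: "'a::finite mtc_data \<Rightarrow> bool" where
  "spherical D \<longleftrightarrow> pivotal D \<and> (\<forall>a. qdim D (dual D a) = qdim D a)"

text \<open>The unnormalised S matrix (quantum trace of the double braiding). The formulas below that involve
  \<open>S\<close> are insensitive to its overall normalisation, so no square root of the global dimension is
  chosen.\<close>

definition Smat :: "'a::finite mtc_data \<Rightarrow> 'a \<Rightarrow> 'a \<Rightarrow> complex" where
  "Smat D a b = (\<Sum>c\<in>UNIV. qdim D c *
     (\<Sum>\<mu><Nfus D b a c. \<Sum>\<nu><Nfus D a b c. Rsym D a b c $$ (\<mu>, \<nu>) * Rsym D b a c $$ (\<nu>, \<mu>)))"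

definition modular :: "'a::finite mtc_data \<Rightarrow> bool" where
  "modular D \<longleftrightarrow> (\<exists>T. \<forall>a c. (\<Sum>b\<in>UNIV. Smat D a b * T b c) = (if a = c then 1 else 0))"

definition modular_tensor_category :: "'a::finite mtc_data \<Rightarrow> bool" where
  "modular_tensor_category D \<longleftrightarrow> fusion_rules D \<and> F_invertible D \<and> triangle D \<and> pentagon D \<and>
     braided D \<and> rigid D \<and> spherical D \<and> modular D"


section \<open>Galois conjugation\<close>

definition data_entries :: "'a mtc_data \<Rightarrow> complex set" where
  "data_entries D =
     {Fsym D a b c d x y | a b c d x y. x \<in> left_trees D a b c d \<and> y \<in> right_trees D a b c d} \<union>
     {Rsym D a b c $$ (\<mu>, \<nu>) | a b c \<mu> \<nu>. \<mu> < Nfus D b a c \<and> \<nu> < Nfus D a b c}"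

definition data_field :: "'a mtc_data \<Rightarrow> complex set" where
  "data_field D = generate_field CC (data_entries D)"

definition K_field :: "'a mtc_data \<Rightarrow> complex set" where
  "K_field D = normal_closure_Q (data_field D)"

definition galois_conjugate :: "(complex \<Rightarrow> complex) \<Rightarrow> 'a mtc_data \<Rightarrow> 'a mtc_data" where
  "galois_conjugate q D = D\<lparr>
     Fsym := \<lambda>a b c d x y. q (Fsym D a b c d x y),
     Rsym := \<lambda>a b c. map_mat q (Rsym D a b c)\<rparr>"


section \<open>0-form and 1-form symmetries\<close>

definition unitary_mat :: "complex mat \<Rightarrow> bool" where
  "unitary_mat A \<longleftrightarrow> inverts_mat A (mat_adjoint A) \<and> inverts_mat (mat_adjoint A) A"

text \<open>The matrices \<open>U\<^sub>g(a,b,c)\<close> and scalars \<open>\<gamma>\<^sub>a\<close> are either unitary matrices and phases, or arbitrary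
  invertible matrices and nonzero scalars. In the latter case a symmetry is just a complex linear
  (as opposed to antilinear) autoequivalence; this notion does not depend on the gauge, whereas
  unitarity of a matrix does.\<close>

datatype kind = Linear | Unitary

fun adm_mat :: "kind \<Rightarrow> complex mat \<Rightarrow> bool" where
  "adm_mat Linear A = invertible_mat A"
| "adm_mat Unitary A = unitary_mat A"

fun adm_scalar :: "kind \<Rightarrow> complex \<Rightarrow> bool" where
  "adm_scalar Linear z = (z \<noteq> 0)"
| "adm_scalar Unitary z = (cmod z = 1)"

type_synonym 'a sym = "('a \<Rightarrow> 'a) \<times> ('a \<Rightarrow> 'a \<Rightarrow> 'a \<Rightarrow> complex mat)"

definition preserves_R :: "'a mtc_data \<Rightarrow> 'a sym \<Rightarrow> bool" where
  "preserves_R D = (\<lambda>(g, U). \<forall>a b c.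
     U (g b) (g a) (g c) * Rsym D (g a) (g b) (g c) * minv (U (g a) (g b) (g c)) = Rsym D a b c)"

definition preserves_F :: "'a mtc_data \<Rightarrow> 'a sym \<Rightarrow> bool" where
  "preserves_F D = (\<lambda>(g, U). \<forall>a b c d e f.
     \<forall>\<alpha><Nfus D a b e. \<forall>\<beta><Nfus D e c d. \<forall>\<mu><Nfus D b c f. \<forall>\<nu><Nfus D a f d.
       (\<Sum>\<alpha>'<Nfus D a b e. \<Sum>\<beta>'<Nfus D e c d. \<Sum>\<mu>'<Nfus D b c f. \<Sum>\<nu>'<Nfus D a f d.
          U (g a) (g b) (g e) $$ (\<alpha>, \<alpha>') * U (g e) (g c) (g d) $$ (\<beta>, \<beta>') *
          Fsym D (g a) (g b) (g c) (g d) (g e, \<alpha>', \<beta>') (g f, \<mu>', \<nu>') *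
          minv (U (g b) (g c) (g f)) $$ (\<mu>', \<mu>) * minv (U (g a) (g f) (g d)) $$ (\<nu>', \<nu>)) =
       Fsym D a b c d (e, \<alpha>, \<beta>) (f, \<mu>, \<nu>))"

definition sym_maps :: "kind \<Rightarrow> 'a mtc_data \<Rightarrow> 'a sym set" where
  "sym_maps k D = {(g, U). bij g \<and>
     (\<forall>a b c. Nfus D (g a) (g b) (g c) = Nfus D a b c) \<and>
     (\<forall>a b c. U a b c \<in> carrier_mat (Nfus D a b c) (Nfus D a b c) \<and> adm_mat k (U a b c)) \<and>
     preserves_R D (g, U) \<and> preserves_F D (g, U)}"

text \<open>Composition of the maps \<open>|a,b,c;\<mu>\<rangle> \<mapsto> \<Sum>\<^sub>\<mu>\<^sub>' U\<^sub>g(ga,gb,gc)\<^sub>\<mu>\<^sub>\<mu>\<^sub>' |ga,gb,gc;\<mu>'\<rangle>\<close> gives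
  \<open>U\<^sub>g\<^sub>h(a,b,c) = U\<^sub>h(g\<^sup>-\<^sup>1a, g\<^sup>-\<^sup>1b, g\<^sup>-\<^sup>1c) U\<^sub>g(a,b,c)\<close>.\<close>

definition sym_monoid :: "kind \<Rightarrow> 'a mtc_data \<Rightarrow> 'a sym monoid" where
  "sym_monoid k D = \<lparr>
     carrier = sym_maps k D,
     monoid.mult = (\<lambda>(g, U) (h, V). (g \<circ> h, \<lambda>a b c.
        V (inv_into UNIV g a) (inv_into UNIV g b) (inv_into UNIV g c) * U a b c)),
     one = (id, \<lambda>a b c. 1\<^sub>m (Nfus D a b c))\<rparr>"

definition nat_isos :: "kind \<Rightarrow> 'a mtc_data \<Rightarrow> 'a sym set" where
  "nat_isos k D = {(id, \<lambda>a b c. (\<gamma> a * \<gamma> b / \<gamma> c) \<cdot>\<^sub>m 1\<^sub>m (Nfus D a b c)) | \<gamma>. \<forall>a. adm_scalar k (\<gamma> a)}"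

definition zero_form :: "kind \<Rightarrow> 'a mtc_data \<Rightarrow> 'a sym set monoid" where
  "zero_form k D = sym_monoid k D Mod nat_isos k D"

definition one_form :: "'a mtc_data \<Rightarrow> 'a monoid" where
  "one_form D = \<lparr>
     carrier = {a. \<exists>b. \<forall>c. Nfus D a b c = (if c = vac D then 1 else 0)},
     monoid.mult = (\<lambda>a b. THE c. Nfus D a b c \<noteq> 0),
     one = vac D\<rparr>"

definition perm_of :: "'a sym set \<Rightarrow> 'a \<Rightarrow> 'a" where
  "perm_of x = (THE g. \<exists>U. (g, U) \<in> x)"

definition sym_action :: "'a mtc_data \<Rightarrow> 'a sym set \<Rightarrow> 'a \<Rightarrow> 'a" where
  "sym_action D x = restrict (perm_of x) (carrier (one_form D))"


section \<open>Twisted group cohomology in degree three\<close>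

definition cochains3 :: "('g, 'm) monoid_scheme \<Rightarrow> ('b, 'n) monoid_scheme \<Rightarrow> ('g \<times> 'g \<times> 'g \<Rightarrow> 'b) monoid" where
  "cochains3 G A = product_group (carrier G \<times> carrier G \<times> carrier G) (\<lambda>_. A)"

definition cocycles3 :: "('g, 'm) monoid_scheme \<Rightarrow> ('b, 'n) monoid_scheme \<Rightarrow> ('g \<Rightarrow> 'b \<Rightarrow> 'b) \<Rightarrow>
    ('g \<times> 'g \<times> 'g \<Rightarrow> 'b) set" where
  "cocycles3 G A r = {\<beta> \<in> carrier (cochains3 G A).
     \<forall>g\<in>carrier G. \<forall>h\<in>carrier G. \<forall>k\<in>carrier G. \<forall>l\<in>carrier G.
       r g (\<beta> (h, k, l)) \<otimes>\<^bsub>A\<^esub> inv\<^bsub>A\<^esub> \<beta> (g \<otimes>\<^bsub>G\<^esub> h, k, l) \<otimes>\<^bsub>A\<^esub> \<beta> (g, h \<otimes>\<^bsub>G\<^esub> k, l) \<otimes>\<^bsub>A\<^esub>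
       inv\<^bsub>A\<^esub> \<beta> (g, h, k \<otimes>\<^bsub>G\<^esub> l) \<otimes>\<^bsub>A\<^esub> \<beta> (g, h, k) = \<one>\<^bsub>A\<^esub>}"

definition coboundaries3 :: "('g, 'm) monoid_scheme \<Rightarrow> ('b, 'n) monoid_scheme \<Rightarrow> ('g \<Rightarrow> 'b \<Rightarrow> 'b) \<Rightarrow>
    ('g \<times> 'g \<times> 'g \<Rightarrow> 'b) set" where
  "coboundaries3 G A r =
     (\<lambda>\<eta>. \<lambda>(g, h, k) \<in> carrier G \<times> carrier G \<times> carrier G.
        r g (\<eta> (h, k)) \<otimes>\<^bsub>A\<^esub> inv\<^bsub>A\<^esub> \<eta> (g \<otimes>\<^bsub>G\<^esub> h, k) \<otimes>\<^bsub>A\<^esub> \<eta> (g, h \<otimes>\<^bsub>G\<^esub> k) \<otimes>\<^bsub>A\<^esub> inv\<^bsub>A\<^esub> \<eta> (g, h))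
     ` (carrier G \<times> carrier G \<rightarrow>\<^sub>E carrier A)"

definition cohomology3 :: "('g, 'm) monoid_scheme \<Rightarrow> ('b, 'n) monoid_scheme \<Rightarrow> ('g \<Rightarrow> 'b \<Rightarrow> 'b) \<Rightarrow>
    ('g \<times> 'g \<times> 'g \<Rightarrow> 'b) set monoid" where
  "cohomology3 G A r = (cochains3 G A)\<lparr>carrier := cocycles3 G A r\<rparr> Mod coboundaries3 G A r"


section \<open>The Postnikov class and the 2-group symmetry\<close>

definition normalised_sym :: "'a mtc_data \<Rightarrow> 'a sym \<Rightarrow> bool" where
  "normalised_sym D = (\<lambda>(g, U).
     (\<forall>b c. U (vac D) b c = 1\<^sub>m (Nfus D (vac D) b c)) \<and>
     (\<forall>a c. U a (vac D) c = 1\<^sub>m (Nfus D a (vac D) c)))"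

definition symmetry_choice ::
  "kind \<Rightarrow> 'a mtc_data \<Rightarrow> ('a sym set \<Rightarrow> 'a sym) \<Rightarrow> ('a \<Rightarrow> 'a sym set \<Rightarrow> 'a sym set \<Rightarrow> complex) \<Rightarrow> bool" where
  "symmetry_choice k D s \<gamma> \<longleftrightarrow> (let G = zero_form k D in
     (\<forall>g\<in>carrier G. s g \<in> g \<and> normalised_sym D (s g)) \<and>
     s \<one>\<^bsub>G\<^esub> = \<one>\<^bsub>sym_monoid k D\<^esub> \<and>
     (\<forall>g\<in>carrier G. \<forall>h\<in>carrier G. (\<forall>a. adm_scalar k (\<gamma> a g h)) \<and> \<gamma> (vac D) g h = 1) \<and>
     (\<forall>g\<in>carrier G. \<forall>a. \<gamma> a \<one>\<^bsub>G\<^esub> g = 1 \<and> \<gamma> a g \<one>\<^bsub>G\<^esub> = 1) \<and>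
     (\<forall>g\<in>carrier G. \<forall>h\<in>carrier G. \<forall>a b c. Nfus D a b c \<noteq> 0 \<longrightarrow>
        (\<gamma> a g h * \<gamma> b g h / \<gamma> c g h) \<cdot>\<^sub>m 1\<^sub>m (Nfus D a b c) =
        minv (snd (s g) a b c) *
        minv (snd (s h) (inv_into UNIV (perm_of g) a) (inv_into UNIV (perm_of g) b)
                        (inv_into UNIV (perm_of g) c)) *
        snd (s (g \<otimes>\<^bsub>G\<^esub> h)) a b c))"

definition Omega ::
  "kind \<Rightarrow> 'a mtc_data \<Rightarrow> ('a \<Rightarrow> 'a sym set \<Rightarrow> 'a sym set \<Rightarrow> complex) \<Rightarrow>
     'a \<Rightarrow> 'a sym set \<Rightarrow> 'a sym set \<Rightarrow> 'a sym set \<Rightarrow> complex" where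
  "Omega k D \<gamma> a g h l = (let G = zero_form k D in
     \<gamma> (inv_into UNIV (perm_of g) a) h l * \<gamma> a g (h \<otimes>\<^bsub>G\<^esub> l) / (\<gamma> a (g \<otimes>\<^bsub>G\<^esub> h) l * \<gamma> a g h))"

definition postnikov_cocycle ::
  "kind \<Rightarrow> 'a::finite mtc_data \<Rightarrow> ('a sym set \<times> 'a sym set \<times> 'a sym set \<Rightarrow> 'a) \<Rightarrow> bool" where
  "postnikov_cocycle k D \<beta> \<longleftrightarrow> (let G = zero_form k D; A = one_form D in
     \<beta> \<in> cocycles3 G A (sym_action D) \<and>
     (\<exists>s \<gamma>. symmetry_choice k D s \<gamma> \<and>
        (\<forall>g\<in>carrier G. \<forall>h\<in>carrier G. \<forall>l\<in>carrier G. \<forall>a.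
           Omega k D \<gamma> a g h l =
           Smat D a (\<beta> (g, h, l)) * Smat D (vac D) (vac D) /
           (Smat D (vac D) (\<beta> (g, h, l)) * Smat D (vac D) a))))"

text \<open>An element of \<open>H\<^sup>3\<close> is a set of cocycles (a coset of the coboundaries). All cocycles arising from
  the various choices lie in one class, so the following union is over a single class.\<close>

definition postnikov_class ::
  "kind \<Rightarrow> 'a::finite mtc_data \<Rightarrow> ('a sym set \<times> 'a sym set \<times> 'a sym set \<Rightarrow> 'a) set" where
  "postnikov_class k D =
     \<Union>{x \<in> carrier (cohomology3 (zero_form k D) (one_form D) (sym_action D)).
        \<exists>\<beta>\<in>x. postnikov_cocycle k D \<beta>}"

record ('g, 'b) two_group =
  tg_group :: "'g monoid"
  tg_abelian :: "'b monoid"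
  tg_action :: "'g \<Rightarrow> 'b \<Rightarrow> 'b"
  tg_class :: "('g \<times> 'g \<times> 'g \<Rightarrow> 'b) set"

definition two_group_symmetry :: "kind \<Rightarrow> 'a::finite mtc_data \<Rightarrow> ('a sym set, 'a) two_group" where
  "two_group_symmetry k D = \<lparr>
     tg_group = zero_form k D,
     tg_abelian = one_form D,
     tg_action = sym_action D,
     tg_class = postnikov_class k D\<rparr>"

definition two_group_iso :: "('g, 'b) two_group \<Rightarrow> ('h, 'c) two_group \<Rightarrow> bool" where
  "two_group_iso T T' \<longleftrightarrow> (\<exists>\<phi> \<psi>.
     \<phi> \<in> iso (tg_group T) (tg_group T') \<and>
     \<psi> \<in> iso (tg_abelian T) (tg_abelian T') \<and>
     (\<forall>g\<in>carrier (tg_group T). \<forall>a\<in>carrier (tg_abelian T).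
        \<psi> (tg_action T g a) = tg_action T' (\<phi> g) (\<psi> a)) \<and>
     tg_class T' =
       (\<lambda>\<beta>. \<lambda>(g, h, k) \<in> carrier (tg_group T') \<times> carrier (tg_group T') \<times> carrier (tg_group T').
          \<psi> (\<beta> (inv_into (carrier (tg_group T)) \<phi> g, inv_into (carrier (tg_group T)) \<phi> h,
                inv_into (carrier (tg_group T)) \<phi> k))) ` tg_class T)"

text \<open>The gauge is adapted to unitary symmetries: modulo natural isomorphism every symmetry is given
  by matrices that are unitary in the chosen bases.\<close>

definition unitary_gauge :: "'a mtc_data \<Rightarrow> bool" where
  "unitary_gauge D \<longleftrightarrow> (\<forall>x\<in>carrier (zero_form Linear D). x \<inter> sym_maps Unitary D \<noteq> {})"

end

(* The field automorphism q of K_C extends to an automorphism \<sigma> of the complex numbers. Applying \<sigma> to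
   the matrices U_g carries linear symmetries, their representatives, the scalars \<gamma> and the S matrix
   of C to those of q(C), so that the same Postnikov cocycles occur, with values in the same anyons.

   \<sigma> does not respect complex conjugation, so unitarity is treated separately: in a unitary gauge
   every linear class contains a unitary map, unique up to phases because a positive real grading of
   the fusion rules of a finite set of anyons is trivial. The unitary and linear 2-groups of C then
   coincide, and likewise for q(C). *)

theory Submission
  imports Defs
begin

text \<open>A symmetry of C is given by arbitrary complex matrices, whose entries need not lie in
  K_C, so q cannot be applied to them; this is the reason for enlarging q to all complex numbers.
  The enlarged map need not preserve absolute values, whence the detour through
  \<open>Linear\<close> symmetries: invertibility of a matrix and nonvanishing of a scalar survive
  every field automorphism. The remaining conditions on the 2-group are algebraic identities between
  U, its inverse, F, R, \<gamma> and the unnormalised S, while the anyons in which \<beta> takes its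
  values are mere labels.

  The obstacle in the extension is surjectivity: a maximal partial isomorphism of the complex
  numbers can have a proper subfield as its range. Two successive maximality arguments avoid this
  without a transcendence basis.

  The unitary case runs through the chain unitary C, linear C, linear q(C), unitary q(C). Its outer
  links compare two kinds of symmetry of one category and involve no field automorphism except the
  identity.\<close>

section \<open>Extension of automorphisms to an algebraically closed field\<close>

text \<open>A partial isomorphism between subrings, given by its graph. As subrings of a product these are
  closed under unions of chains, and injectivity and functionality together say that a pair vanishes
  in both components or in none.\<close>

definition ring_graph :: "('a::field \<times> 'a) set \<Rightarrow> bool" where
  "ring_graph \<Gamma> \<longleftrightarrow> (1, 1) \<in> \<Gamma> \<and>
     (\<forall>(x, y)\<in>\<Gamma>. \<forall>(x', y')\<in>\<Gamma>. (x - x', y - y') \<in> \<Gamma> \<and> (x * x', y * y') \<in> \<Gamma>) \<and>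
     (\<forall>(x, y)\<in>\<Gamma>. x = 0 \<longleftrightarrow> y = 0)"

lemma ring_graphD:
  assumes "ring_graph \<Gamma>"
  shows "(1, 1) \<in> \<Gamma>" "(0, 0) \<in> \<Gamma>"
    and "(x, y) \<in> \<Gamma> \<Longrightarrow> (x', y') \<in> \<Gamma> \<Longrightarrow> (x - x', y - y') \<in> \<Gamma>"
    and "(x, y) \<in> \<Gamma> \<Longrightarrow> (x', y') \<in> \<Gamma> \<Longrightarrow> (x * x', y * y') \<in> \<Gamma>"
    and "(x, y) \<in> \<Gamma> \<Longrightarrow> (x', y') \<in> \<Gamma> \<Longrightarrow> (x + x', y + y') \<in> \<Gamma>"
    and "(x, y) \<in> \<Gamma> \<Longrightarrow> x = 0 \<longleftrightarrow> y = 0"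
    and "(x, y) \<in> \<Gamma> \<Longrightarrow> (x, y') \<in> \<Gamma> \<Longrightarrow> y = y'"
proof -
  show 1: "(1, 1) \<in> \<Gamma>" using assms by (auto simp: ring_graph_def)
  show diff: "(x - x', y - y') \<in> \<Gamma>" if "(x, y) \<in> \<Gamma>" "(x', y') \<in> \<Gamma>" for x y x' y'
    using assms that by (fastforce simp: ring_graph_def)
  show "(x * x', y * y') \<in> \<Gamma>" if "(x, y) \<in> \<Gamma>" "(x', y') \<in> \<Gamma>"
    using assms that by (fastforce simp: ring_graph_def)
  show 0: "(0, 0) \<in> \<Gamma>" using diff[OF 1 1] by simp
  show "(x + x', y + y') \<in> \<Gamma>" if "(x, y) \<in> \<Gamma>" "(x', y') \<in> \<Gamma>"
    using diff[OF that(1) diff[OF 0 that(2)]] by simp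
  show zero: "x = 0 \<longleftrightarrow> y = 0" if "(x, y) \<in> \<Gamma>" for x y
    using assms that by (fastforce simp: ring_graph_def)
  show "y = y'" if "(x, y) \<in> \<Gamma>" "(x, y') \<in> \<Gamma>"
    using zero[OF diff[OF that]] by simp
qed

lemma ring_graph_converse:
  assumes "ring_graph \<Gamma>"
  shows "ring_graph (\<Gamma>\<inverse>)"
  using ring_graphD(1,3,4,6)[OF assms] unfolding ring_graph_def by (auto; metis)

lemma ring_graph_sum:
  assumes "ring_graph \<Gamma>" "\<And>i. i \<in> I \<Longrightarrow> (f i, g i) \<in> \<Gamma>"
  shows "(sum f I, sum g I) \<in> \<Gamma>"
  using assms(2)
  by (induction I rule: infinite_finite_induct) (auto intro: ring_graphD[OF assms(1)])

lemma ring_graph_Union_chain: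
  assumes "\<C> \<noteq> {}" "\<And>\<Gamma>. \<Gamma> \<in> \<C> \<Longrightarrow> ring_graph \<Gamma>"
    and "\<And>\<Gamma> \<Delta>. \<Gamma> \<in> \<C> \<Longrightarrow> \<Delta> \<in> \<C> \<Longrightarrow> \<Gamma> \<subseteq> \<Delta> \<or> \<Delta> \<subseteq> \<Gamma>"
  shows "ring_graph (\<Union>\<C>)"
  unfolding ring_graph_def
proof (intro conjI)
  show "(1, 1) \<in> \<Union>\<C>" using assms(1,2) ring_graphD(1) by blast
  show "\<forall>(x, y)\<in>\<Union>\<C>. x = 0 \<longleftrightarrow> y = 0" using assms(2) ring_graphD(6) by blast
  have "\<exists>\<Gamma>\<in>\<C>. u \<in> \<Gamma> \<and> v \<in> \<Gamma>" if "u \<in> \<Union>\<C>" "v \<in> \<Union>\<C>" for u v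
    using that assms(3) by blast
  then show "\<forall>(x, y)\<in>\<Union>\<C>. \<forall>(x', y')\<in>\<Union>\<C>. (x - x', y - y') \<in> \<Union>\<C> \<and> (x * x', y * y') \<in> \<Union>\<C>"
    using assms(2) ring_graphD(3,4) by (smt (verit) UnionI case_prodI2)
qed

section \<open>Polynomials with corresponding coefficients, simple extensions and fractions\<close>

definition polys_over :: "('a::field \<times> 'a) set \<Rightarrow> 'a poly \<Rightarrow> 'a poly \<Rightarrow> bool" where
  "polys_over \<Gamma> p p' \<longleftrightarrow> (\<forall>i. (coeff p i, coeff p' i) \<in> \<Gamma>)"

lemma polys_over_converse: "polys_over (\<Gamma>\<inverse>) p p' \<longleftrightarrow> polys_over \<Gamma> p' p"
  by (simp add: polys_over_def)

lemma polys_over_degree: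
  assumes "ring_graph \<Gamma>" "polys_over \<Gamma> p p'"
  shows "degree p = degree p'" "p = 0 \<longleftrightarrow> p' = 0"
proof -
  have "coeff p i = 0 \<longleftrightarrow> coeff p' i = 0" for i
    using assms ring_graphD(6) unfolding polys_over_def by blast
  then show "degree p = degree p'" "p = 0 \<longleftrightarrow> p' = 0"
    by (simp_all add: degree_def poly_eq_iff)
qed

lemma polys_over_intros:
  assumes "ring_graph \<Gamma>"
  shows "polys_over \<Gamma> p p' \<Longrightarrow> polys_over \<Gamma> r r' \<Longrightarrow> polys_over \<Gamma> (p - r) (p' - r')"
    and "polys_over \<Gamma> p p' \<Longrightarrow> polys_over \<Gamma> r r' \<Longrightarrow> polys_over \<Gamma> (p + r) (p' + r')"
    and "polys_over \<Gamma> p p' \<Longrightarrow> polys_over \<Gamma> r r' \<Longrightarrow> polys_over \<Gamma> (p * r) (p' * r')"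
    and "(a, b) \<in> \<Gamma> \<Longrightarrow> polys_over \<Gamma> (monom a n) (monom b n)"
    and "polys_over \<Gamma> 0 0"
  using ring_graphD[OF assms]
  by (auto simp: polys_over_def coeff_mult intro!: ring_graph_sum[OF assms])

definition adjoin :: "('a::field \<times> 'a) set \<Rightarrow> 'a \<Rightarrow> 'a \<Rightarrow> ('a \<times> 'a) set" where
  "adjoin \<Gamma> x y = {(poly p x, poly p' y) | p p'. polys_over \<Gamma> p p'}"

lemma adjoinI: "polys_over \<Gamma> p p' \<Longrightarrow> a = poly p x \<Longrightarrow> b = poly p' y \<Longrightarrow> (a, b) \<in> adjoin \<Gamma> x y"
  by (auto simp: adjoin_def)

text \<open>The hypothesis says that evaluation at x and at y kills corresponding polynomials. This
  is the vanishing condition of \<open>ring_graph\<close>, hence both functionality and injectivity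
  of the extended graph.\<close>

lemma ring_graph_adjoin:
  assumes "ring_graph \<Gamma>" "\<And>p p'. polys_over \<Gamma> p p' \<Longrightarrow> poly p x = 0 \<longleftrightarrow> poly p' y = 0"
  shows "ring_graph (adjoin \<Gamma> x y)" "\<Gamma> \<subseteq> adjoin \<Gamma> x y" "(x, y) \<in> adjoin \<Gamma> x y"
proof -
  note I = polys_over_intros[OF assms(1)]
  show sub: "\<Gamma> \<subseteq> adjoin \<Gamma> x y"
    using I(4)[where n = 0] by (auto intro!: adjoinI simp: poly_monom)
  show "(x, y) \<in> adjoin \<Gamma> x y"
    using I(4)[OF ring_graphD(1)[OF assms(1)], where n = 1] by (auto intro!: adjoinI simp: poly_monom)
  show "ring_graph (adjoin \<Gamma> x y)"
    unfolding ring_graph_def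
  proof (intro conjI)
    show "(1, 1) \<in> adjoin \<Gamma> x y" using sub ring_graphD(1)[OF assms(1)] by blast
    show "\<forall>(a, b)\<in>adjoin \<Gamma> x y. a = 0 \<longleftrightarrow> b = 0" using assms(2) by (auto simp: adjoin_def)
    show "\<forall>(a, b)\<in>adjoin \<Gamma> x y. \<forall>(a', b')\<in>adjoin \<Gamma> x y.
            (a - a', b - b') \<in> adjoin \<Gamma> x y \<and> (a * a', b * b') \<in> adjoin \<Gamma> x y"
    proof clarify
      fix a b a' b' assume "(a, b) \<in> adjoin \<Gamma> x y" "(a', b') \<in> adjoin \<Gamma> x y"
      then obtain p p' r r' where *: "polys_over \<Gamma> p p'" "polys_over \<Gamma> r r'"
          "a = poly p x" "b = poly p' y" "a' = poly r x" "b' = poly r' y"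
        by (auto simp: adjoin_def)
      then show "(a - a', b - b') \<in> adjoin \<Gamma> x y \<and> (a * a', b * b') \<in> adjoin \<Gamma> x y"
        using adjoinI[OF I(1)[OF *(1,2)]] adjoinI[OF I(3)[OF *(1,2)]] by simp
    qed
  qed
qed

definition fractions :: "('a::field \<times> 'a) set \<Rightarrow> ('a \<times> 'a) set" where
  "fractions \<Gamma> = {(a / c, b / d) | a b c d. (a, b) \<in> \<Gamma> \<and> (c, d) \<in> \<Gamma> \<and> c \<noteq> 0}"

text \<open>Applied to a maximal graph, this shows that the graph is closed under inverses, so that
  polynomial division becomes available.\<close>

lemma ring_graph_fractions:
  assumes "ring_graph \<Gamma>"
  shows "ring_graph (fractions \<Gamma>)" "\<Gamma> \<subseteq> fractions \<Gamma>"
    and "(x, y) \<in> \<Gamma> \<Longrightarrow> (inverse x, inverse y) \<in> fractions \<Gamma>"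
proof -
  note D = ring_graphD[OF assms]
  show sub: "\<Gamma> \<subseteq> fractions \<Gamma>"
    using D(1) by (force simp: fractions_def)
  show "(inverse x, inverse y) \<in> fractions \<Gamma>" if "(x, y) \<in> \<Gamma>"
  proof (cases "x = 0")
    case True
    then show ?thesis using that D(6) sub by force
  next
    case False
    then show ?thesis using that D(1) by (force simp: fractions_def inverse_eq_divide)
  qed
  show "ring_graph (fractions \<Gamma>)"
    unfolding ring_graph_def
  proof (intro conjI)
    show "(1, 1) \<in> fractions \<Gamma>" using sub D(1) by blast
    show "\<forall>(a, b)\<in>fractions \<Gamma>. a = 0 \<longleftrightarrow> b = 0" using D(6) by (force simp: fractions_def)
    show "\<forall>(x, y)\<in>fractions \<Gamma>. \<forall>(x', y')\<in>fractions \<Gamma>.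
            (x - x', y - y') \<in> fractions \<Gamma> \<and> (x * x', y * y') \<in> fractions \<Gamma>"
    proof clarify
      fix x y x' y' assume "(x, y) \<in> fractions \<Gamma>" "(x', y') \<in> fractions \<Gamma>"
      then obtain a b c d a' b' c' d' where *: "(a, b) \<in> \<Gamma>" "(c, d) \<in> \<Gamma>" "c \<noteq> 0" "(a', b') \<in> \<Gamma>" "(c', d') \<in> \<Gamma>" "c' \<noteq> 0"
          "x = a / c" "y = b / d" "x' = a' / c'" "y' = b' / d'"
        by (auto simp: fractions_def)
      have nz: "d \<noteq> 0" "d' \<noteq> 0" using D(6) * by blast+
      have den: "(c * c', d * d') \<in> \<Gamma>" "c * c' \<noteq> 0" using D(4) * by auto
      have "x - x' = (a * c' - a' * c) / (c * c')" "y - y' = (b * d' - b' * d) / (d * d')"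
           "x * x' = (a * a') / (c * c')" "y * y' = (b * b') / (d * d')"
        using nz * by (auto simp: field_simps)
      moreover have "(a * c' - a' * c, b * d' - b' * d) \<in> \<Gamma>" "(a * a', b * b') \<in> \<Gamma>"
        using D(3,4) * by auto
      ultimately show "(x - x', y - y') \<in> fractions \<Gamma> \<and> (x * x', y * y') \<in> fractions \<Gamma>"
        using den unfolding fractions_def by blast
    qed
  qed
qed

text \<open>Euclidean division runs in parallel on both sides: leading coefficients correspond, so
  each step subtracts corresponding multiples, and closure under inverses lets the divisor be
  non-monic. A degree bound on one side suffices because corresponding polynomials have equal
  degrees.\<close>

lemma polys_over_division:
  assumes \<Gamma>: "ring_graph \<Gamma>" and inv: "\<And>x y. (x, y) \<in> \<Gamma> \<Longrightarrow> (inverse x, inverse y) \<in> \<Gamma>"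
    and p: "polys_over \<Gamma> p p'" "p \<noteq> 0" and r: "polys_over \<Gamma> r r'"
  shows "\<exists>s s' t t'. polys_over \<Gamma> s s' \<and> polys_over \<Gamma> t t' \<and> r = s * p + t \<and> r' = s' * p' + t' \<and>
           (t = 0 \<or> degree t < degree p)"
  using r
proof (induction "degree r" arbitrary: r r' rule: less_induct)
  case less
  note I = polys_over_intros[OF \<Gamma>]
  have deg: "degree p = degree p'" "p' \<noteq> 0" using polys_over_degree[OF \<Gamma> p(1)] p(2) by auto
  have deg_r: "degree r = degree r'" "r = 0 \<longleftrightarrow> r' = 0" using polys_over_degree[OF \<Gamma> less.prems] by auto
  show ?case
  proof (cases "r = 0 \<or> degree r < degree p")
    case True
    then show ?thesis using less.prems I(5) by (intro exI[of _ 0] exI[of _ r] exI[of _ r']) auto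
  next
    case False
    define n where "n = degree r - degree p"
    define m m' where "m = monom (lead_coeff r / lead_coeff p) n"
      and "m' = monom (lead_coeff r' / lead_coeff p') n"
    have "(lead_coeff r / lead_coeff p, lead_coeff r' / lead_coeff p') \<in> \<Gamma>"
      using ring_graphD(4)[OF \<Gamma>, of "lead_coeff r" "lead_coeff r'" "inverse (lead_coeff p)" "inverse (lead_coeff p')"]
        inv less.prems p(1) deg deg_r
      by (simp add: polys_over_def divide_inverse)
    then have m: "polys_over \<Gamma> m m'" unfolding m_def m'_def by (rule I(4))
    define r1 r1' where "r1 = r - m * p" and "r1' = r' - m' * p'"
    have r1: "polys_over \<Gamma> r1 r1'" unfolding r1_def r1'_def using I(1,3) m p(1) less.prems by blast
    show ?thesis
    proof (cases "r1 = 0 \<or> degree r1 < degree r")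
      case True
      \<comment> \<open>The zero polynomial has degree 0, so for constant \<open>r\<close> the
        degree does not drop when \<open>r1\<close> vanishes. That case lies outside the induction
        hypothesis and takes zero quotient and remainder.\<close>
      then consider "r1 = 0" | "degree r1 < degree r" by blast
      then obtain s s' t t' where st: "polys_over \<Gamma> s s'" "polys_over \<Gamma> t t'" "r1 = s * p + t"
         "r1' = s' * p' + t'" "t = 0 \<or> degree t < degree p"
      proof cases
        case 1
        then show ?thesis using polys_over_degree(2)[OF \<Gamma> r1] I(5) that[of 0 0 0 0] by auto
      next
        case 2
        then show ?thesis using less.hyps[OF 2 r1] that by blast
      qed
      have "r = (m + s) * p + t" "r' = (m' + s') * p' + t'"
        using st(3,4) unfolding r1_def r1'_def by (auto simp: algebra_simps)
      then show ?thesis using st(2,5) I(2)[OF m st(1)] by blast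
    next
      \<comment> \<open>A contradictory case: \<open>m\<close> was chosen so that the leading terms
        of \<open>r\<close> and \<open>m * p\<close> cancel.\<close>
      case nless: False
      have rnz: "r \<noteq> 0" "degree p \<le> degree r" using False by auto
      have m0: "m \<noteq> 0" using rnz p(2) by (simp add: m_def)
      have "degree (m * p) = degree r"
        using m0 p(2) rnz unfolding m_def n_def by (subst degree_mult_eq) (auto simp: degree_monom_eq)
      moreover have "coeff (m * p) (degree r) = lead_coeff r"
        using rnz p(2) unfolding m_def n_def by (simp add: coeff_monom_mult)
      ultimately have "degree r1 \<le> degree r" "coeff r1 (degree r) = 0"
        unfolding r1_def by (auto intro!: degree_diff_le)
      then have "r1 = 0 \<or> degree r1 < degree r"
        by (metis leading_coeff_0_iff le_neq_implies_less)
      then show ?thesis using nless by blast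
    qed
  qed
qed

text \<open>Let p be a minimal polynomial of x over the domain and y a root of its counterpart p'.
  After parallel division only polynomials t of degree below that of p matter. They do not vanish at
  x by minimality; that their counterparts do not vanish at y expresses the irreducibility of p',
  which is pulled back to p.\<close>

lemma exists_conjugate_root:
  fixes \<Gamma> :: "('a::alg_closed_field \<times> 'a) set"
  assumes \<Gamma>: "ring_graph \<Gamma>" and inv: "\<And>x y. (x, y) \<in> \<Gamma> \<Longrightarrow> (inverse x, inverse y) \<in> \<Gamma>"
    and alg: "polys_over \<Gamma> p0 p0'" "p0 \<noteq> 0" "poly p0 x = 0"
  shows "\<exists>y. \<forall>r r'. polys_over \<Gamma> r r' \<longrightarrow> (poly r x = 0 \<longleftrightarrow> poly r' y = 0)"
proof -
  define Q where "Q p \<longleftrightarrow> (\<exists>p'. polys_over \<Gamma> p p') \<and> p \<noteq> 0 \<and> poly p x = 0" for p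
  have "Q p0" using alg Q_def by blast
  then obtain p where p: "Q p" and min: "\<And>r. Q r \<Longrightarrow> degree p \<le> degree r"
    using ex_has_least_nat[of Q p0 degree] by blast
  obtain p' where p': "polys_over \<Gamma> p p'" "p \<noteq> 0" "poly p x = 0" using p Q_def by blast
  have deg: "degree p' = degree p" "p' \<noteq> 0" using polys_over_degree[OF \<Gamma> p'(1)] p'(2) by auto
  have "degree p > 0" using p'(2,3) by (metis degree_eq_zeroE gr_zeroI pCons_0_0 poly_const_conv)
  then obtain y where y: "poly p' y = 0" using alg_closed_imp_poly_has_root deg(1) by metis
  have nz: "poly t x \<noteq> 0" if "polys_over \<Gamma> t t'" "t \<noteq> 0" "degree t < degree p" for t t'
    using min that Q_def leD by blast
  have nz': "poly t' y \<noteq> 0" if t: "polys_over \<Gamma> t t'" "t \<noteq> 0" "degree t < degree p" for t t'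
  proof
    assume "poly t' y = 0"
    \<comment> \<open>\<open>Q'\<close> selects the polynomials whose counterparts vanish at y. Its
      member m of least degree divides p by parallel division, and p = s * m with two factors of
      smaller degree contradicts the minimality of p at x.\<close>
    define Q' where "Q' u \<longleftrightarrow> (\<exists>u'. polys_over \<Gamma> u u' \<and> poly u' y = 0) \<and> u \<noteq> 0" for u
    have "Q' t" using t \<open>poly t' y = 0\<close> Q'_def by blast
    then obtain m where m: "Q' m" and mmin: "\<And>r. Q' r \<Longrightarrow> degree m \<le> degree r"
      using ex_has_least_nat[of Q' t degree] by blast
    obtain m' where m': "polys_over \<Gamma> m m'" "poly m' y = 0" "m \<noteq> 0" using m Q'_def by blast
    have degm: "degree m < degree p" using mmin[OF \<open>Q' t\<close>] t(3) by linarith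
    obtain s s' w w' where sw: "polys_over \<Gamma> s s'" "polys_over \<Gamma> w w'" "p = s * m + w"
        "p' = s' * m' + w'" "w = 0 \<or> degree w < degree m"
      using polys_over_division[OF \<Gamma> inv m'(1,3) p'(1)] by blast
    have "poly w' y = 0" using sw(4) y m'(2) by simp
    then have "w = 0" using mmin[of w] sw(2,5) Q'_def by fastforce
    then have eq: "p = s * m" using sw by simp
    then have snz: "s \<noteq> 0" using p'(2) by auto
    have "degree m \<noteq> 0"
    proof
      assume "degree m = 0"
      then have "degree m' = 0" "m' \<noteq> 0" using polys_over_degree[OF \<Gamma> m'(1)] m'(3) by auto
      then show False using m'(2) by (metis degree_eq_zeroE pCons_0_0 poly_const_conv)
    qed
    then have "degree s < degree p" using eq snz m'(3) by (simp add: degree_mult_eq)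
    then have "poly s x \<noteq> 0" "poly m x \<noteq> 0" using nz sw(1) snz m' degm by blast+
    then show False using eq p'(3) by simp
  qed
  have "poly r x = 0 \<longleftrightarrow> poly r' y = 0" if rr: "polys_over \<Gamma> r r'" for r r'
  proof -
    obtain s s' t t' where st: "polys_over \<Gamma> t t'" "r = s * p + t" "r' = s' * p' + t'"
       "t = 0 \<or> degree t < degree p"
      using polys_over_division[OF \<Gamma> inv p'(1,2) rr] by blast
    have "poly r x = poly t x" "poly r' y = poly t' y" using st(2,3) p'(3) y by auto
    then show ?thesis using nz[OF st(1)] nz'[OF st(1)] st(4) polys_over_degree(2)[OF \<Gamma> st(1)] by auto
  qed
  then show ?thesis by blast
qed

text \<open>Maximality is applied twice: to the fractions, which gives inverses, and to the
  adjunction of x together with a conjugate root. Full range is obtained separately, by applying the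
  lemma to the converse graph.\<close>

lemma maximal_ring_graph_dom:
  fixes \<Gamma> :: "('a::alg_closed_field \<times> 'a) set"
  assumes \<Gamma>: "ring_graph \<Gamma>" and max: "\<And>\<Delta>. ring_graph \<Delta> \<Longrightarrow> \<Gamma> \<subseteq> \<Delta> \<Longrightarrow> \<Delta> = \<Gamma>"
    and alg: "\<And>x. \<exists>p p'. polys_over \<Gamma> p p' \<and> p \<noteq> 0 \<and> poly p x = 0"
  shows "fst ` \<Gamma> = UNIV"
proof -
  have "fractions \<Gamma> = \<Gamma>" using max ring_graph_fractions[OF \<Gamma>] by blast
  then have inv: "(inverse x, inverse y) \<in> \<Gamma>" if "(x, y) \<in> \<Gamma>" for x y
    using ring_graph_fractions(3)[OF \<Gamma>] that by blast
  have "x \<in> fst ` \<Gamma>" for x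
  proof -
    obtain y where y: "\<forall>r r'. polys_over \<Gamma> r r' \<longrightarrow> (poly r x = 0 \<longleftrightarrow> poly r' y = 0)"
      using exists_conjugate_root[OF \<Gamma> inv] alg[of x] by blast
    have "adjoin \<Gamma> x y = \<Gamma>" using max ring_graph_adjoin[OF \<Gamma>] y by blast
    then have "(x, y) \<in> \<Gamma>" using ring_graph_adjoin(3)[OF \<Gamma>] y by blast
    then show ?thesis by force
  qed
  then show ?thesis by blast
qed

section \<open>Automorphisms of an algebraically closed field\<close>

lemma polys_over_of_image:
  assumes "(0, 0) \<in> \<Gamma>" "\<And>i. coeff p i \<in> fst ` \<Gamma>"
  obtains p' where "polys_over \<Gamma> p p'"
proof -
  have "\<forall>i. \<exists>b. (coeff p i, b) \<in> \<Gamma>" using assms(2) by force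
  then obtain f where f: "\<And>i. (coeff p i, f i) \<in> \<Gamma>" by metis
  define p' where "p' = (\<Sum>i\<le>degree p. monom (f i) i)"
  have "coeff p' i = (if i \<le> degree p then f i else 0)" for i
    by (simp add: p'_def coeff_sum)
  then have "polys_over \<Gamma> p p'"
    using f assms(1) by (auto simp: polys_over_def coeff_eq_0 not_le)
  then show thesis using that by blast
qed

definition ring_automorphism :: "('a::field \<Rightarrow> 'a) \<Rightarrow> bool" where
  "ring_automorphism \<sigma> \<longleftrightarrow> bij \<sigma> \<and> \<sigma> 1 = 1 \<and> (\<forall>x y. \<sigma> (x + y) = \<sigma> x + \<sigma> y) \<and>
     (\<forall>x y. \<sigma> (x * y) = \<sigma> x * \<sigma> y)"

text \<open>Stage one maximises among graphs whose domain equals their range. An element x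
  transcendental over this common ring could still be adjoined with x sent to itself, so every
  element is algebraic over the ring. Stage two drops the constraint: a maximal graph above the
  first one is total, and so is its converse, because domain and range both contain that
  ring.\<close>

theorem ring_automorphism_extension:
  fixes \<Gamma>0 :: "('a::alg_closed_field \<times> 'a) set"
  assumes \<Gamma>0: "ring_graph \<Gamma>0" "fst ` \<Gamma>0 = snd ` \<Gamma>0"
  obtains \<sigma> where "ring_automorphism \<sigma>" "\<And>x y. (x, y) \<in> \<Gamma>0 \<Longrightarrow> \<sigma> x = y"
proof -
  let ?A = "{\<Gamma>. ring_graph \<Gamma> \<and> \<Gamma>0 \<subseteq> \<Gamma> \<and> fst ` \<Gamma> = snd ` \<Gamma>}"
  have "\<exists>M\<in>?A. \<forall>\<Delta>\<in>?A. M \<subseteq> \<Delta> \<longrightarrow> \<Delta> = M"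
  proof (rule subset_Zorn_nonempty)
    show "?A \<noteq> {}" using \<Gamma>0 by blast
    fix \<C> assume \<C>: "\<C> \<noteq> {}" "subset.chain ?A \<C>"
    then have "ring_graph (\<Union>\<C>)"
      by (intro ring_graph_Union_chain) (auto simp: subset_chain_def)
    moreover have "fst ` \<Union>\<C> = snd ` \<Union>\<C>"
      using \<C>(2) by (simp add: image_Union subset_chain_def subset_iff cong: SUP_cong_simp)
    moreover have "\<Gamma>0 \<subseteq> \<Union>\<C>" using \<C> unfolding subset_chain_def by blast
    ultimately show "\<Union>\<C> \<in> ?A" by blast
  qed
  then obtain \<Gamma>1 where M1: "\<Gamma>1 \<in> ?A" "\<forall>\<Delta>\<in>?A. \<Gamma>1 \<subseteq> \<Delta> \<longrightarrow> \<Delta> = \<Gamma>1" by (elim bexE)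
  then have \<Gamma>1: "ring_graph \<Gamma>1" "\<Gamma>0 \<subseteq> \<Gamma>1" "fst ` \<Gamma>1 = snd ` \<Gamma>1" by simp_all
  have max1: "\<Delta> = \<Gamma>1" if "ring_graph \<Delta>" "fst ` \<Delta> = snd ` \<Delta>" "\<Gamma>1 \<subseteq> \<Delta>" for \<Delta>
    using M1(2) that \<Gamma>1(2) by simp
  have conv: "fst ` (\<Gamma>1\<inverse>) = fst ` \<Gamma>1" unfolding \<Gamma>1(3) by force
  have zero1: "(0, 0) \<in> \<Gamma>1" using ring_graphD(2)[OF \<Gamma>1(1)] .
  have zero1': "(0, 0) \<in> \<Gamma>1\<inverse>" using zero1 by simp
  have alg: "\<exists>p. (\<forall>i. coeff p i \<in> fst ` \<Gamma>1) \<and> p \<noteq> 0 \<and> poly p x = 0" for x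
  proof (rule ccontr)
    assume tr: "\<not> ?thesis"
    then have tr': "poly p x = 0 \<longleftrightarrow> p = 0" if "\<And>i. coeff p i \<in> fst ` \<Gamma>1" for p
      using that by fastforce
    \<comment> \<open>For transcendental x a polynomial over the domain vanishes at x only if it is
      zero, and corresponding polynomials are zero together. Sending x to itself therefore meets the
      hypothesis of \<open>ring_graph_adjoin\<close>.\<close>
    have iff: "poly p x = 0 \<longleftrightarrow> poly p' x = 0" if "polys_over \<Gamma>1 p p'" for p p'
    proof -
      have "coeff p i \<in> fst ` \<Gamma>1" "coeff p' i \<in> snd ` \<Gamma>1" for i
        using that by (force simp: polys_over_def)+
      then have "\<And>i. coeff p i \<in> fst ` \<Gamma>1" "\<And>i. coeff p' i \<in> fst ` \<Gamma>1" using \<Gamma>1(3) by auto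
      then have "poly p x = 0 \<longleftrightarrow> p = 0" "poly p' x = 0 \<longleftrightarrow> p' = 0" using tr' by blast+
      then show ?thesis using polys_over_degree(2)[OF \<Gamma>1(1) that] by simp
    qed
    \<comment> \<open>Domain and range of \<Gamma>1 coincide, so the same polynomials are evaluated
      at x on both sides and the enlarged graph stays in \<open>?A\<close>.\<close>
    let ?L = "{p. \<forall>i. coeff p i \<in> fst ` \<Gamma>1}"
    have "{p. \<exists>p'. polys_over \<Gamma>1 p p'} = ?L"
    proof -
      have "\<exists>p'. polys_over \<Gamma>1 p p'" if "p \<in> ?L" for p
        using polys_over_of_image[OF zero1, of p] that by blast
      moreover have "p \<in> ?L" if "polys_over \<Gamma>1 p p'" for p p'
        using that by (force simp: polys_over_def)
      ultimately show ?thesis by blast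
    qed
    moreover have "{p'. \<exists>p. polys_over \<Gamma>1 p p'} = ?L"
    proof -
      have "\<exists>p. polys_over \<Gamma>1 p p'" if "p' \<in> ?L" for p'
      proof -
        have "\<And>i. coeff p' i \<in> fst ` (\<Gamma>1\<inverse>)" using that by (simp add: conv)
        from polys_over_of_image[OF zero1' this] show ?thesis by (auto simp: polys_over_converse)
      qed
      moreover have "p' \<in> ?L" if "polys_over \<Gamma>1 p p'" for p p'
      proof -
        have "coeff p' i \<in> snd ` \<Gamma>1" for i using that by (force simp: polys_over_def)
        then show ?thesis using \<Gamma>1(3) by simp
      qed
      ultimately show ?thesis by blast
    qed
    moreover have "fst ` adjoin \<Gamma>1 x x = (\<lambda>p. poly p x) ` {p. \<exists>p'. polys_over \<Gamma>1 p p'}"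
      "snd ` adjoin \<Gamma>1 x x = (\<lambda>p. poly p x) ` {p'. \<exists>p. polys_over \<Gamma>1 p p'}"
      unfolding adjoin_def by (auto simp: image_iff) blast+
    ultimately have "fst ` adjoin \<Gamma>1 x x = snd ` adjoin \<Gamma>1 x x" by simp
    then have "adjoin \<Gamma>1 x x = \<Gamma>1" using max1 ring_graph_adjoin[OF \<Gamma>1(1) iff] by blast
    then have "(x, x) \<in> \<Gamma>1" using ring_graph_adjoin(3)[OF \<Gamma>1(1) iff] by blast
    moreover have "(1, 1) \<in> \<Gamma>1" using ring_graphD(1)[OF \<Gamma>1(1)] .
    \<comment> \<open>By maximality x already lies in the domain, so the linear polynomial with root
      x refutes its transcendence.\<close>
    ultimately have lin: "\<forall>i. coeff [:- x, 1:] i \<in> fst ` \<Gamma>1"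
      using zero1 ring_graphD(3)[OF \<Gamma>1(1) zero1, of x x]
      by (auto simp: coeff_pCons image_iff split: nat.split intro: bexI[rotated])
    have "[:- x, 1:] \<noteq> 0" "poly [:- x, 1:] x = 0" by simp_all
    with lin show False using tr by blast
  qed
  let ?B = "{\<Gamma>. ring_graph \<Gamma> \<and> \<Gamma>1 \<subseteq> \<Gamma>}"
  have "\<exists>M\<in>?B. \<forall>\<Delta>\<in>?B. M \<subseteq> \<Delta> \<longrightarrow> \<Delta> = M"
  proof (rule subset_Zorn_nonempty)
    show "?B \<noteq> {}" using \<Gamma>1 by blast
    fix \<C> assume \<C>: "\<C> \<noteq> {}" "subset.chain ?B \<C>"
    then have "ring_graph (\<Union>\<C>)"
      by (intro ring_graph_Union_chain) (auto simp: subset_chain_def)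
    moreover have "\<Gamma>1 \<subseteq> \<Union>\<C>" using \<C> unfolding subset_chain_def by blast
    ultimately show "\<Union>\<C> \<in> ?B" by blast
  qed
  then obtain \<Gamma> where M: "\<Gamma> \<in> ?B" "\<forall>\<Delta>\<in>?B. \<Gamma> \<subseteq> \<Delta> \<longrightarrow> \<Delta> = \<Gamma>" by (elim bexE)
  then have \<Gamma>: "ring_graph \<Gamma>" "\<Gamma>1 \<subseteq> \<Gamma>" by simp_all
  have max: "\<Delta> = \<Gamma>" if "ring_graph \<Delta>" "\<Gamma> \<subseteq> \<Delta>" for \<Delta>
    using M(2) that \<Gamma>(2) by simp
  have mono: "polys_over \<Gamma> p p'" if "polys_over \<Gamma>1 p p'" for p p'
    using that \<Gamma>(2) by (auto simp: polys_over_def)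
  have "fst ` \<Gamma> = UNIV"
  proof (rule maximal_ring_graph_dom[OF \<Gamma>(1) max])
    show "\<exists>p p'. polys_over \<Gamma> p p' \<and> p \<noteq> 0 \<and> poly p x = 0" for x
    proof -
      obtain p where p: "\<And>i. coeff p i \<in> fst ` \<Gamma>1" "p \<noteq> 0" "poly p x = 0" using alg[of x] by blast
      obtain p' where "polys_over \<Gamma>1 p p'" using polys_over_of_image[OF zero1 p(1)] .
      then show ?thesis using p(2,3) mono by blast
    qed
  qed
  moreover have "fst ` (\<Gamma>\<inverse>) = UNIV"
  proof (rule maximal_ring_graph_dom)
    show "ring_graph (\<Gamma>\<inverse>)" using \<Gamma>(1) by (simp add: ring_graph_converse)
    show "\<Delta> = \<Gamma>\<inverse>" if "ring_graph \<Delta>" "\<Gamma>\<inverse> \<subseteq> \<Delta>" for \<Delta>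
    proof -
      have "\<Gamma> \<subseteq> \<Delta>\<inverse>" using that(2) converse_mono[of \<Gamma> "\<Delta>\<inverse>"] by simp
      then have "\<Delta>\<inverse> = \<Gamma>" using max that(1) by (simp add: ring_graph_converse)
      then show ?thesis by (metis converse_converse)
    qed
    show "\<exists>p p'. polys_over (\<Gamma>\<inverse>) p p' \<and> p \<noteq> 0 \<and> poly p x = 0" for x
    proof -
      obtain p where p: "\<And>i. coeff p i \<in> fst ` (\<Gamma>1\<inverse>)" "p \<noteq> 0" "poly p x = 0"
        using alg[of x] conv by auto
      obtain p' where "polys_over (\<Gamma>1\<inverse>) p p'" using polys_over_of_image[OF zero1' p(1)] .
      then show ?thesis using p(2,3) mono by (auto simp: polys_over_converse)
    qed
  qed
  ultimately have "x \<in> fst ` \<Gamma>" "y \<in> fst ` (\<Gamma>\<inverse>)" for x y by simp_all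
  then have tot: "\<exists>y. (x, y) \<in> \<Gamma>" "\<exists>x. (x, y) \<in> \<Gamma>" for x y by force+
  define \<sigma> where "\<sigma> x = (THE y. (x, y) \<in> \<Gamma>)" for x
  note D = ring_graphD[OF \<Gamma>(1)]
  have \<sigma>: "\<sigma> x = y \<longleftrightarrow> (x, y) \<in> \<Gamma>" for x y
    using tot D(7) unfolding \<sigma>_def by (metis the_equality)
  have "x = x'" if "(x, y) \<in> \<Gamma>" "(x', y) \<in> \<Gamma>" for x x' y
    using D(6)[OF D(3)[OF that]] by simp
  then have "bij \<sigma>" using \<sigma> tot unfolding bij_def inj_def surj_def by metis
  then have "ring_automorphism \<sigma>" unfolding ring_automorphism_def using \<sigma> D(1,4,5) by blast
  then show thesis using that \<sigma> \<Gamma>(2) \<Gamma>1(2) by blast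
qed

section \<open>Invertible and unitary matrices\<close>

lemma minv_eqI:
  assumes "A \<in> carrier_mat n n" "B \<in> carrier_mat n n" "A * B = 1\<^sub>m n" "B * A = 1\<^sub>m n"
  shows "minv A = B"
  unfolding minv_def
proof (rule the_equality)
  show "B \<in> carrier_mat (dim_col A) (dim_row A) \<and> inverts_mat A B \<and> inverts_mat B A"
    using assms by (auto simp: inverts_mat_def)
  fix C assume "C \<in> carrier_mat (dim_col A) (dim_row A) \<and> inverts_mat A C \<and> inverts_mat C A"
  then have C: "C \<in> carrier_mat n n" "C * A = 1\<^sub>m n" using assms(1) by (auto simp: inverts_mat_def)
  have "C = C * (A * B)" using assms(3) C(1) by simp
  also have "\<dots> = C * A * B" using assms(1,2) C(1) by simp
  finally show "C = B" using C(2) assms(2) by simp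
qed

lemma invertible_matI:
  assumes "A \<in> carrier_mat n n" "B \<in> carrier_mat n n" "A * B = 1\<^sub>m n" "B * A = 1\<^sub>m n"
  shows "invertible_mat A"
  using assms by (auto simp: invertible_mat_def inverts_mat_def)

lemma minv:
  assumes "A \<in> carrier_mat n n" "invertible_mat A"
  shows "minv A \<in> carrier_mat n n" "A * minv A = 1\<^sub>m n" "minv A * A = 1\<^sub>m n"
    "invertible_mat (minv A)" "minv (minv A) = A"
proof -
  obtain B where B: "A * B = 1\<^sub>m n" "B * A = 1\<^sub>m (dim_row B)"
    using assms by (auto simp: invertible_mat_def inverts_mat_def)
  \<comment> \<open>\<open>invertible_mat\<close> does not prescribe the shape of the inverse;
    counting the columns of the two products forces it to be n by n.\<close>
  have "dim_col (A * B) = n" "dim_col (B * A) = dim_row B" by (simp_all only: B index_one_mat)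
  then have "B \<in> carrier_mat n n" using assms(1) by auto
  with B have B': "B \<in> carrier_mat n n" "A * B = 1\<^sub>m n" "B * A = 1\<^sub>m n" by auto
  then have "minv A = B" "minv B = A" using minv_eqI assms(1) by auto
  then show "minv A \<in> carrier_mat n n" "A * minv A = 1\<^sub>m n" "minv A * A = 1\<^sub>m n"
    "invertible_mat (minv A)" "minv (minv A) = A"
    using B' invertible_matI[OF B'(1) assms(1)] by auto
qed

lemma minv_mult:
  assumes A: "A \<in> carrier_mat n n" "invertible_mat A" and B: "B \<in> carrier_mat n n" "invertible_mat B"
  shows "minv (A * B) = minv B * minv A" "invertible_mat (A * B)"
proof -
  note a = minv[OF A] and b = minv[OF B]
  have 1: "A * B * (minv B * minv A) = 1\<^sub>m n"
  proof -
    have "A * B * (minv B * minv A) = A * (B * (minv B * minv A))"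
      using A B a b by (intro assoc_mult_mat) auto
    also have "B * (minv B * minv A) = B * minv B * minv A"
      by (rule assoc_mult_mat[symmetric]) (use A B a b in auto)
    finally show ?thesis using A a b by simp
  qed
  have 2: "minv B * minv A * (A * B) = 1\<^sub>m n"
  proof -
    have "minv B * minv A * (A * B) = minv B * (minv A * (A * B))"
      using A B a b by (intro assoc_mult_mat) auto
    also have "minv A * (A * B) = minv A * A * B"
      by (rule assoc_mult_mat[symmetric]) (use A B a b in auto)
    finally show ?thesis using B a b by simp
  qed
  have "A * B \<in> carrier_mat n n" "minv B * minv A \<in> carrier_mat n n" using A B a b by auto
  then show "minv (A * B) = minv B * minv A" "invertible_mat (A * B)"
    using 1 2 by (auto intro: minv_eqI invertible_matI)
qed

lemma minv_one [simp]: "minv (1\<^sub>m n) = 1\<^sub>m n" and invertible_mat_one [simp]: "invertible_mat (1\<^sub>m n)"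
  by (auto intro: minv_eqI[of _ n] invertible_matI[of _ n "1\<^sub>m n"])

lemma smult_one_mult:
  "(x \<cdot>\<^sub>m 1\<^sub>m n) * (y \<cdot>\<^sub>m 1\<^sub>m n) = (x * y :: 'a::comm_ring_1) \<cdot>\<^sub>m 1\<^sub>m n"
  "A \<in> carrier_mat m n \<Longrightarrow> A * (x \<cdot>\<^sub>m 1\<^sub>m n) = x \<cdot>\<^sub>m A"
  "A \<in> carrier_mat n m \<Longrightarrow> (x \<cdot>\<^sub>m 1\<^sub>m n) * A = x \<cdot>\<^sub>m A"
proof -
  show *: "A * (x \<cdot>\<^sub>m 1\<^sub>m n) = x \<cdot>\<^sub>m A" if "A \<in> carrier_mat m n" for A :: "'a mat" and m x
    using that by (subst mult_smult_distrib[of _ m n _ n]) auto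
  show "(x \<cdot>\<^sub>m 1\<^sub>m n) * A = x \<cdot>\<^sub>m A" if "A \<in> carrier_mat n m"
    using that by (subst mult_smult_assoc_mat[of _ n n _ m]) auto
  show "(x \<cdot>\<^sub>m 1\<^sub>m n) * (y \<cdot>\<^sub>m 1\<^sub>m n) = (x * y) \<cdot>\<^sub>m 1\<^sub>m n"
    by (subst *[of _ n]) (auto simp: mult.commute)
qed

lemma one_smult_mat [simp]: "(1 :: 'a::comm_ring_1) \<cdot>\<^sub>m A = A"
  by (rule eq_matI) auto

lemma minv_smult:
  assumes "A \<in> carrier_mat n n" "invertible_mat A" "z \<noteq> 0"
  shows "minv (z \<cdot>\<^sub>m A) = inverse z \<cdot>\<^sub>m minv A" "invertible_mat (z \<cdot>\<^sub>m A)"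
proof -
  note a = minv[OF assms(1,2)]
  have "z \<cdot>\<^sub>m A * (inverse z \<cdot>\<^sub>m minv A) = 1\<^sub>m n" "inverse z \<cdot>\<^sub>m minv A * (z \<cdot>\<^sub>m A) = 1\<^sub>m n"
    using assms a
    by (simp_all add: mult_smult_distrib[of _ n n _ n] mult_smult_assoc_mat[of _ n n _ n])
      (auto intro!: eq_matI)
  moreover have "z \<cdot>\<^sub>m A \<in> carrier_mat n n" "inverse z \<cdot>\<^sub>m minv A \<in> carrier_mat n n"
    using assms(1) a(1) by auto
  ultimately show "minv (z \<cdot>\<^sub>m A) = inverse z \<cdot>\<^sub>m minv A" "invertible_mat (z \<cdot>\<^sub>m A)"
    by (auto intro: minv_eqI invertible_matI)
qed

lemma minv_smult_one: "z \<noteq> 0 \<Longrightarrow> minv (z \<cdot>\<^sub>m 1\<^sub>m n) = inverse z \<cdot>\<^sub>m 1\<^sub>m n"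
  using minv_smult(1)[of "1\<^sub>m n" n z] by simp

section \<open>Adjoints, unitary matrices and the two kinds of admissibility\<close>

lemma mat_adjoint_dim [simp]: "dim_row (mat_adjoint A) = dim_col A" "dim_col (mat_adjoint A) = dim_row A"
  by (auto simp: mat_adjoint_def)

lemma mat_adjoint_carrier: "A \<in> carrier_mat m n \<Longrightarrow> mat_adjoint A \<in> carrier_mat n m"
  by auto

lemma mat_adjoint_index [simp]:
  "i < dim_col A \<Longrightarrow> j < dim_row A \<Longrightarrow> mat_adjoint A $$ (i, j) = cnj (A $$ (j, i))"
  by (auto simp: mat_adjoint_def mat_of_rows_def)

lemma mat_adjoint_adjoint: "mat_adjoint (mat_adjoint A) = (A :: complex mat)"
  by (rule eq_matI) auto

lemma mat_adjoint_mult: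
  assumes "(A :: complex mat) \<in> carrier_mat l m" "B \<in> carrier_mat m n"
  shows "mat_adjoint (A * B) = mat_adjoint B * mat_adjoint A"
  using assms by (intro eq_matI) (auto simp: scalar_prod_def cnj_sum mult.commute)

lemma mat_adjoint_smult_one: "mat_adjoint (z \<cdot>\<^sub>m 1\<^sub>m n) = cnj z \<cdot>\<^sub>m 1\<^sub>m n"
  by (rule eq_matI) auto

lemma unitary_mat_iff:
  assumes "A \<in> carrier_mat n n"
  shows "unitary_mat A \<longleftrightarrow> invertible_mat A \<and> minv A = mat_adjoint A"
proof
  assume "unitary_mat A"
  then have "A * mat_adjoint A = 1\<^sub>m n" "mat_adjoint A * A = 1\<^sub>m n"
    using assms mat_adjoint_carrier[OF assms] by (auto simp: unitary_mat_def inverts_mat_def)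
  then show "invertible_mat A \<and> minv A = mat_adjoint A"
    using assms mat_adjoint_carrier[OF assms] by (auto intro: invertible_matI minv_eqI)
next
  assume "invertible_mat A \<and> minv A = mat_adjoint A"
  then show "unitary_mat A"
    using minv[OF assms] assms mat_adjoint_carrier[OF assms] by (auto simp: unitary_mat_def inverts_mat_def)
qed

text \<open>A 0 by 0 matrix is unitary whatever the scalar, so unitarity restricts z only on nonzero
  fusion spaces.\<close>

lemma unitary_smult_one:
  "unitary_mat (z \<cdot>\<^sub>m 1\<^sub>m n) \<longleftrightarrow> n = 0 \<or> cmod z = 1"
proof -
  have "unitary_mat (z \<cdot>\<^sub>m 1\<^sub>m n) \<longleftrightarrow> (z * cnj z) \<cdot>\<^sub>m 1\<^sub>m n = (1\<^sub>m n :: complex mat)"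
    by (auto simp: unitary_mat_def inverts_mat_def mat_adjoint_smult_one smult_one_mult mult.commute)
  also have "\<dots> \<longleftrightarrow> n = 0 \<or> z * cnj z = 1"
  proof (cases n)
    case (Suc m)
    have "(x \<cdot>\<^sub>m 1\<^sub>m n :: complex mat) = 1\<^sub>m n \<longleftrightarrow> x = 1" for x
    proof
      assume "x \<cdot>\<^sub>m 1\<^sub>m n = (1\<^sub>m n :: complex mat)"
      then have "(x \<cdot>\<^sub>m 1\<^sub>m n) $$ (0, 0) = (1\<^sub>m n :: complex mat) $$ (0, 0)" by simp
      then show "x = 1" using Suc by simp
    qed auto
    then show ?thesis using Suc by auto
  qed (auto intro!: eq_matI)
  also have "z * cnj z = 1 \<longleftrightarrow> cmod z = 1"
    by (simp flip: complex_norm_square) (metis norm_ge_zero of_real_eq_1_iff of_real_power one_power2 power2_eq_imp_eq zero_le_one)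
  finally show ?thesis .
qed

lemma adm_mat_invertible: "A \<in> carrier_mat n n \<Longrightarrow> adm_mat k A \<Longrightarrow> invertible_mat A"
  by (cases k) (auto simp: unitary_mat_iff)

lemma adm_mat_mult:
  assumes A: "A \<in> carrier_mat n n" "adm_mat k A" and B: "B \<in> carrier_mat n n" "adm_mat k B"
  shows "adm_mat k (A * B)"
  using minv_mult[OF A(1) adm_mat_invertible[OF A] B(1) adm_mat_invertible[OF B]] A B
    mat_adjoint_mult[OF A(1) B(1)]
  by (cases k) (auto simp: unitary_mat_iff[of _ n])

lemma adm_mat_minv:
  assumes "A \<in> carrier_mat n n" "adm_mat k A"
  shows "adm_mat k (minv A)"
  using minv[OF assms(1) adm_mat_invertible[OF assms]] assms mat_adjoint_adjoint[of A]
  by (cases k) (auto simp: unitary_mat_iff[of _ n])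

lemma adm_scalar_nonzero: "adm_scalar k z \<Longrightarrow> z \<noteq> 0"
  by (cases k) auto

lemma adm_scalar_mult: "adm_scalar k x \<Longrightarrow> adm_scalar k y \<Longrightarrow> adm_scalar k (x * y)"
  by (cases k) (auto simp: norm_mult)

lemma adm_scalar_inverse: "adm_scalar k x \<Longrightarrow> adm_scalar k (inverse x)"
  by (cases k) (auto simp: norm_inverse)

lemma adm_scalar_one: "adm_scalar k 1"
  by (cases k) auto

lemma adm_mat_smult_one: "adm_scalar k z \<Longrightarrow> adm_mat k (z \<cdot>\<^sub>m 1\<^sub>m n)"
  using minv_smult(2)[of "1\<^sub>m n" n z] by (cases k) (auto simp: unitary_smult_one)

lemma adm_mat_one: "adm_mat k (1\<^sub>m n)"
  using adm_mat_smult_one[OF adm_scalar_one, of k n] by simp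

section \<open>The action of four matrices on an F symbol\<close>

definition recouple ::
  "nat \<Rightarrow> nat \<Rightarrow> nat \<Rightarrow> nat \<Rightarrow> complex mat \<Rightarrow> complex mat \<Rightarrow> complex mat \<Rightarrow> complex mat \<Rightarrow>
    (nat \<Rightarrow> nat \<Rightarrow> nat \<Rightarrow> nat \<Rightarrow> complex) \<Rightarrow> nat \<Rightarrow> nat \<Rightarrow> nat \<Rightarrow> nat \<Rightarrow> complex" where
  "recouple n1 n2 n3 n4 A B C E F \<alpha> \<beta> \<mu> \<nu> =
     (\<Sum>\<alpha>'<n1. \<Sum>\<beta>'<n2. \<Sum>\<mu>'<n3. \<Sum>\<nu>'<n4.
        A $$ (\<alpha>, \<alpha>') * B $$ (\<beta>, \<beta>') * F \<alpha>' \<beta>' \<mu>' \<nu>' * C $$ (\<mu>', \<mu>) * E $$ (\<nu>', \<nu>))"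

lemma recouple_cong:
  assumes "\<And>\<alpha> \<beta> \<mu> \<nu>. \<alpha> < n1 \<Longrightarrow> \<beta> < n2 \<Longrightarrow> \<mu> < n3 \<Longrightarrow> \<nu> < n4 \<Longrightarrow> F \<alpha> \<beta> \<mu> \<nu> = F' \<alpha> \<beta> \<mu> \<nu>"
  shows "recouple n1 n2 n3 n4 A B C E F \<alpha> \<beta> \<mu> \<nu> = recouple n1 n2 n3 n4 A B C E F' \<alpha> \<beta> \<mu> \<nu>"
  unfolding recouple_def using assms by (intro sum.cong refl) simp

lemma recouple_smult:
  assumes c: "A \<in> carrier_mat n1 n1" "B \<in> carrier_mat n2 n2" "C \<in> carrier_mat n3 n3" "E \<in> carrier_mat n4 n4"
    and i: "\<alpha> < n1" "\<beta> < n2" "\<mu> < n3" "\<nu> < n4"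
  shows "recouple n1 n2 n3 n4 (x \<cdot>\<^sub>m A) (y \<cdot>\<^sub>m B) (z \<cdot>\<^sub>m C) (w \<cdot>\<^sub>m E) F \<alpha> \<beta> \<mu> \<nu> =
    x * y * z * w * recouple n1 n2 n3 n4 A B C E F \<alpha> \<beta> \<mu> \<nu>"
  unfolding recouple_def using c i by (simp add: sum_distrib_left ac_simps)

lemma recouple_one:
  assumes "\<alpha> < n1" "\<beta> < n2" "\<mu> < n3" "\<nu> < n4"
  shows "recouple n1 n2 n3 n4 (1\<^sub>m n1) (1\<^sub>m n2) (1\<^sub>m n3) (1\<^sub>m n4) F \<alpha> \<beta> \<mu> \<nu> = F \<alpha> \<beta> \<mu> \<nu>"
proof -
  have "recouple n1 n2 n3 n4 (1\<^sub>m n1) (1\<^sub>m n2) (1\<^sub>m n3) (1\<^sub>m n4) F \<alpha> \<beta> \<mu> \<nu> =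
    (\<Sum>\<alpha>'<n1. (if \<alpha> = \<alpha>' then 1 else 0) * (\<Sum>\<beta>'<n2. (if \<beta> = \<beta>' then 1 else 0) *
      (\<Sum>\<mu>'<n3. (if \<mu>' = \<mu> then 1 else 0) * (\<Sum>\<nu>'<n4. (if \<nu>' = \<nu> then 1 else 0) * F \<alpha>' \<beta>' \<mu>' \<nu>'))))"
    unfolding recouple_def using assms by (simp add: sum_distrib_left ac_simps cong: if_cong)
  then show ?thesis using assms by (simp add: mult_delta_left)
qed

text \<open>\<open>recouple\<close> is the left side of the F equation with its four matrices as
  parameters. Two such actions compose, with reversed order for the right-tree indices, where
  matrices act from the other side. Flattening the fourfold sums to sums over P leaves a single
  exchange of summations.\<close>

lemma recouple_recouple:
  assumes c: "A \<in> carrier_mat n1 n1" "B \<in> carrier_mat n2 n2" "C \<in> carrier_mat n3 n3" "E \<in> carrier_mat n4 n4"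
      "A' \<in> carrier_mat n1 n1" "B' \<in> carrier_mat n2 n2" "C' \<in> carrier_mat n3 n3" "E' \<in> carrier_mat n4 n4"
    and i: "\<alpha> < n1" "\<beta> < n2" "\<mu> < n3" "\<nu> < n4"
  shows "recouple n1 n2 n3 n4 A B C E (recouple n1 n2 n3 n4 A' B' C' E' F) \<alpha> \<beta> \<mu> \<nu> =
    recouple n1 n2 n3 n4 (A * A') (B * B') (C' * C) (E' * E) F \<alpha> \<beta> \<mu> \<nu>"
proof -
  define P where "P = {..<n1} \<times> {..<n2} \<times> {..<n3} \<times> {..<n4}"
  have sum4: "(\<Sum>a<n1. \<Sum>b<n2. \<Sum>c<n3. \<Sum>d<n4. f a b c d) = (\<Sum>(a, b, c, d)\<in>P. f a b c d)"
    for f :: "nat \<Rightarrow> nat \<Rightarrow> nat \<Rightarrow> nat \<Rightarrow> complex"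
    unfolding P_def by (simp add: sum.cartesian_product)
  have prod4: "(\<Sum>a<n1. f1 a) * (\<Sum>b<n2. f2 b) * w * (\<Sum>c<n3. f3 c) * (\<Sum>d<n4. f4 d) =
      (\<Sum>(a, b, c, d)\<in>P. f1 a * f2 b * w * f3 c * f4 d)" for f1 f2 f3 f4 and w :: complex
    unfolding sum4[symmetric] by (simp only: sum_distrib_left[symmetric] sum_distrib_right[symmetric])
  have entry: "(M * M') $$ (r, s) = (\<Sum>t<n. M $$ (r, t) * M' $$ (t, s))"
    if "M \<in> carrier_mat n n" "M' \<in> carrier_mat n n" "r < n" "s < n" for M M' :: "complex mat" and n r s
    using that by (simp add: scalar_prod_def atLeast0LessThan)
  have "recouple n1 n2 n3 n4 (A * A') (B * B') (C' * C) (E' * E) F \<alpha> \<beta> \<mu> \<nu> =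
    (\<Sum>(a', b', c', d')\<in>P. \<Sum>(a, b, c, d)\<in>P.
       (A $$ (\<alpha>, a) * A' $$ (a, a')) * (B $$ (\<beta>, b) * B' $$ (b, b')) * F a' b' c' d' *
       (C' $$ (c', c) * C $$ (c, \<mu>)) * (E' $$ (d', d) * E $$ (d, \<nu>)))"
    unfolding recouple_def sum4 prod4[symmetric]
    using i by (intro sum.cong refl) (auto simp: P_def entry[OF c(1) c(5)] entry[OF c(2) c(6)] entry[OF c(7) c(3)] entry[OF c(8) c(4)])
  also have "\<dots> = (\<Sum>(a, b, c, d)\<in>P. \<Sum>(a', b', c', d')\<in>P.
       (A $$ (\<alpha>, a) * A' $$ (a, a')) * (B $$ (\<beta>, b) * B' $$ (b, b')) * F a' b' c' d' *
       (C' $$ (c', c) * C $$ (c, \<mu>)) * (E' $$ (d', d) * E $$ (d, \<nu>)))"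
    unfolding split_def by (rule sum.swap)
  also have "\<dots> = recouple n1 n2 n3 n4 A B C E (recouple n1 n2 n3 n4 A' B' C' E' F) \<alpha> \<beta> \<mu> \<nu>"
    unfolding recouple_def sum4 split_def by (simp add: sum_distrib_left sum_distrib_right ac_simps)
  finally show ?thesis by simp
qed

section \<open>The groups of symmetries\<close>

lemma smult_smult_mat: "a \<cdot>\<^sub>m (b \<cdot>\<^sub>m A) = (a * b :: 'a::semigroup_mult) \<cdot>\<^sub>m A"
  by (rule eq_matI) (auto simp: mult.assoc)

abbreviation perm_inv :: "('a \<Rightarrow> 'a) \<Rightarrow> 'a \<Rightarrow> 'a" where
  "perm_inv \<equiv> inv_into UNIV"

text \<open>Both C and its Galois conjugate become instances, so the group theory of symmetries is
  developed once for the two.\<close>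

locale skeletal_data =
  fixes D :: "'a::finite mtc_data"
  assumes fusion: "fusion_rules D"
    and triangle: "triangle D"
    and Rsym_carrier: "Rsym D a b c \<in> carrier_mat (Nfus D b a c) (Nfus D a b c)"
begin

lemma Nfus_vac_left: "Nfus D (vac D) a b = (if a = b then 1 else 0)"
  and Nfus_vac_right: "Nfus D a (vac D) b = (if a = b then 1 else 0)"
  and Nfus_commute: "Nfus D a b c = Nfus D b a c"
  and Nfus_assoc: "(\<Sum>e\<in>UNIV. Nfus D a b e * Nfus D e c d) = (\<Sum>f\<in>UNIV. Nfus D b c f * Nfus D a f d)"
  and Nfus_dual_ex: "\<exists>b. \<forall>c. Nfus D a c (vac D) = (if c = b then 1 else 0)"
  using fusion unfolding fusion_rules_def by blast+

lemma sym_mapsI: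
  assumes "bij g" "\<And>a b c. Nfus D (g a) (g b) (g c) = Nfus D a b c"
    and "\<And>a b c. U a b c \<in> carrier_mat (Nfus D a b c) (Nfus D a b c)" "\<And>a b c. adm_mat k (U a b c)"
    and "\<And>a b c. U (g b) (g a) (g c) * Rsym D (g a) (g b) (g c) * minv (U (g a) (g b) (g c)) = Rsym D a b c"
    and "\<And>a b c d e f \<alpha> \<beta> \<mu> \<nu>.
       \<alpha> < Nfus D a b e \<Longrightarrow> \<beta> < Nfus D e c d \<Longrightarrow> \<mu> < Nfus D b c f \<Longrightarrow> \<nu> < Nfus D a f d \<Longrightarrow>
       recouple (Nfus D a b e) (Nfus D e c d) (Nfus D b c f) (Nfus D a f d)
         (U (g a) (g b) (g e)) (U (g e) (g c) (g d)) (minv (U (g b) (g c) (g f))) (minv (U (g a) (g f) (g d)))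
         (\<lambda>\<alpha>' \<beta>' \<mu>' \<nu>'. Fsym D (g a) (g b) (g c) (g d) (g e, \<alpha>', \<beta>') (g f, \<mu>', \<nu>')) \<alpha> \<beta> \<mu> \<nu> =
       Fsym D a b c d (e, \<alpha>, \<beta>) (f, \<mu>, \<nu>)"
  shows "(g, U) \<in> sym_maps k D"
  using assms unfolding sym_maps_def preserves_R_def preserves_F_def recouple_def by simp

lemma sym_mapsD:
  assumes "(g, U) \<in> sym_maps k D"
  shows "bij g" "Nfus D (g a) (g b) (g c) = Nfus D a b c"
    and "U a b c \<in> carrier_mat (Nfus D a b c) (Nfus D a b c)" "adm_mat k (U a b c)"
    and "U (g b) (g a) (g c) * Rsym D (g a) (g b) (g c) * minv (U (g a) (g b) (g c)) = Rsym D a b c"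
    and "\<alpha> < Nfus D a b e \<Longrightarrow> \<beta> < Nfus D e c d \<Longrightarrow> \<mu> < Nfus D b c f \<Longrightarrow> \<nu> < Nfus D a f d \<Longrightarrow>
       recouple (Nfus D a b e) (Nfus D e c d) (Nfus D b c f) (Nfus D a f d)
         (U (g a) (g b) (g e)) (U (g e) (g c) (g d)) (minv (U (g b) (g c) (g f))) (minv (U (g a) (g f) (g d)))
         (\<lambda>\<alpha>' \<beta>' \<mu>' \<nu>'. Fsym D (g a) (g b) (g c) (g d) (g e, \<alpha>', \<beta>') (g f, \<mu>', \<nu>')) \<alpha> \<beta> \<mu> \<nu> =
       Fsym D a b c d (e, \<alpha>, \<beta>) (f, \<mu>, \<nu>)"
  using assms unfolding sym_maps_def preserves_R_def preserves_F_def recouple_def by simp_all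

lemma sym_maps_minv:
  assumes "(g, U) \<in> sym_maps k D"
  shows "invertible_mat (U a b c)" "minv (U a b c) \<in> carrier_mat (Nfus D a b c) (Nfus D a b c)"
    and "U a b c * minv (U a b c) = 1\<^sub>m (Nfus D a b c)" "minv (U a b c) * U a b c = 1\<^sub>m (Nfus D a b c)"
    and "minv (minv (U a b c)) = U a b c"
proof -
  show i: "invertible_mat (U a b c)" using adm_mat_invertible sym_mapsD(3,4)[OF assms] by blast
  show "minv (U a b c) \<in> carrier_mat (Nfus D a b c) (Nfus D a b c)"
    "U a b c * minv (U a b c) = 1\<^sub>m (Nfus D a b c)" "minv (U a b c) * U a b c = 1\<^sub>m (Nfus D a b c)"
    "minv (minv (U a b c)) = U a b c"
    using minv[OF sym_mapsD(3)[OF assms] i] by blast+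
qed

lemma sym_maps_inv:
  assumes "(g, U) \<in> sym_maps k D"
  shows "Nfus D (perm_inv g a) (perm_inv g b) (perm_inv g c) = Nfus D a b c" "g (perm_inv g a) = a" "perm_inv g (g a) = a"
  using sym_mapsD(2)[OF assms, of "perm_inv g a" "perm_inv g b" "perm_inv g c"] sym_mapsD(1)[OF assms]
  by (simp_all add: bij_is_surj surj_f_inv_f bij_is_inj inv_f_f)

text \<open>The equations nest: inside those of h at given anyons, the data at their images under h
  are rewritten by the equations of g. The matrices then multiply in the order prescribed by
  \<open>sym_monoid\<close>.\<close>

lemma sym_maps_mult:
  assumes gU: "(g, U) \<in> sym_maps k D" and hV: "(h, V) \<in> sym_maps k D"
  shows "(g \<circ> h, \<lambda>a b c. V (perm_inv g a) (perm_inv g b) (perm_inv g c) * U a b c) \<in> sym_maps k D"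
proof (rule sym_mapsI)
  note N = sym_mapsD(2)[OF gU] sym_mapsD(2)[OF hV] sym_maps_inv[OF gU] sym_maps_inv[OF hV]
  have U: "U a b c \<in> carrier_mat n n" "adm_mat k (U a b c)" "minv (U a b c) \<in> carrier_mat n n"
       "invertible_mat (U a b c)" if "n = Nfus D a b c" for a b c n
    using sym_mapsD(3,4)[OF gU] sym_maps_minv(1,2)[OF gU] that by auto
  have V: "V a b c \<in> carrier_mat n n" "adm_mat k (V a b c)" "minv (V a b c) \<in> carrier_mat n n"
       "invertible_mat (V a b c)" if "n = Nfus D a b c" for a b c n
    using sym_mapsD(3,4)[OF hV] sym_maps_minv(1,2)[OF hV] that by auto
  show "bij (g \<circ> h)" using sym_mapsD(1) gU hV bij_comp by blast
  show "Nfus D ((g \<circ> h) a) ((g \<circ> h) b) ((g \<circ> h) c) = Nfus D a b c" for a b c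
    by (simp add: N)
  show "V (perm_inv g a) (perm_inv g b) (perm_inv g c) * U a b c \<in> carrier_mat (Nfus D a b c) (Nfus D a b c)" for a b c
    by (rule mult_carrier_mat[of _ _ "Nfus D a b c"]) (simp_all add: U V N)
  show "adm_mat k (V (perm_inv g a) (perm_inv g b) (perm_inv g c) * U a b c)" for a b c
    by (rule adm_mat_mult[of _ "Nfus D a b c"]) (simp_all add: U V N)
  have inv_comp: "minv (V a b c * U (g a) (g b) (g c)) = minv (U (g a) (g b) (g c)) * minv (V a b c)" for a b c
    by (rule minv_mult[of _ "Nfus D a b c"]) (simp_all add: U V N)
  show "V (perm_inv g ((g \<circ> h) b)) (perm_inv g ((g \<circ> h) a)) (perm_inv g ((g \<circ> h) c)) * U ((g \<circ> h) b) ((g \<circ> h) a) ((g \<circ> h) c) *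
      Rsym D ((g \<circ> h) a) ((g \<circ> h) b) ((g \<circ> h) c) *
      minv (V (perm_inv g ((g \<circ> h) a)) (perm_inv g ((g \<circ> h) b)) (perm_inv g ((g \<circ> h) c)) * U ((g \<circ> h) a) ((g \<circ> h) b) ((g \<circ> h) c)) =
      Rsym D a b c" for a b c
  proof -
    define n where "n = Nfus D a b c"
    have n: "Nfus D (h a) (h b) (h c) = n" "Nfus D (h b) (h a) (h c) = n"
      "Nfus D (g (h a)) (g (h b)) (g (h c)) = n" "Nfus D (g (h b)) (g (h a)) (g (h c)) = n"
      by (simp_all add: N n_def Nfus_commute[of b a])
    let ?V = "V (h b) (h a) (h c)" and ?U = "U (g (h b)) (g (h a)) (g (h c))"
    let ?R = "Rsym D (g (h a)) (g (h b)) (g (h c))"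
    let ?U' = "minv (U (g (h a)) (g (h b)) (g (h c)))" and ?V' = "minv (V (h a) (h b) (h c))"
    have c: "?V \<in> carrier_mat n n" "?U \<in> carrier_mat n n" "?R \<in> carrier_mat n n"
      "?U' \<in> carrier_mat n n" "?V' \<in> carrier_mat n n"
      using Rsym_carrier[of "g (h a)" "g (h b)" "g (h c)"] by (simp_all add: U V n)
    have "?V * ?U * ?R * (?U' * ?V') = ?V * (?U * ?R * ?U') * ?V'"
    proof -
      have "?V * ?U * ?R * (?U' * ?V') = ?V * (?U * ?R) * (?U' * ?V')"
        using c by (simp add: assoc_mult_mat[of _ n n _ n _ n])
      also have "\<dots> = ?V * (?U * ?R * (?U' * ?V'))"
        by (rule assoc_mult_mat[of _ n n _ n _ n]) (use c in auto)
      also have "?U * ?R * (?U' * ?V') = ?U * ?R * ?U' * ?V'"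
        by (rule assoc_mult_mat[of _ n n _ n _ n, symmetric]) (use c in auto)
      also have "?V * \<dots> = ?V * (?U * ?R * ?U') * ?V'"
        by (rule assoc_mult_mat[of _ n n _ n _ n, symmetric]) (use c in auto)
      finally show ?thesis .
    qed
    also have "\<dots> = Rsym D a b c"
      using sym_mapsD(5)[OF gU, of "h b" "h a" "h c"] sym_mapsD(5)[OF hV, of b a c] by simp
    finally show ?thesis by (simp add: N inv_comp)
  qed
  show "recouple (Nfus D a b e) (Nfus D e c d) (Nfus D b c f) (Nfus D a f d)
         (V (perm_inv g ((g \<circ> h) a)) (perm_inv g ((g \<circ> h) b)) (perm_inv g ((g \<circ> h) e)) * U ((g \<circ> h) a) ((g \<circ> h) b) ((g \<circ> h) e))
         (V (perm_inv g ((g \<circ> h) e)) (perm_inv g ((g \<circ> h) c)) (perm_inv g ((g \<circ> h) d)) * U ((g \<circ> h) e) ((g \<circ> h) c) ((g \<circ> h) d))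
         (minv (V (perm_inv g ((g \<circ> h) b)) (perm_inv g ((g \<circ> h) c)) (perm_inv g ((g \<circ> h) f)) * U ((g \<circ> h) b) ((g \<circ> h) c) ((g \<circ> h) f)))
         (minv (V (perm_inv g ((g \<circ> h) a)) (perm_inv g ((g \<circ> h) f)) (perm_inv g ((g \<circ> h) d)) * U ((g \<circ> h) a) ((g \<circ> h) f) ((g \<circ> h) d)))
         (\<lambda>\<alpha>' \<beta>' \<mu>' \<nu>'. Fsym D ((g \<circ> h) a) ((g \<circ> h) b) ((g \<circ> h) c) ((g \<circ> h) d)
            ((g \<circ> h) e, \<alpha>', \<beta>') ((g \<circ> h) f, \<mu>', \<nu>')) \<alpha> \<beta> \<mu> \<nu> =
       Fsym D a b c d (e, \<alpha>, \<beta>) (f, \<mu>, \<nu>)"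
    if i: "\<alpha> < Nfus D a b e" "\<beta> < Nfus D e c d" "\<mu> < Nfus D b c f" "\<nu> < Nfus D a f d"
    for a b c d e f \<alpha> \<beta> \<mu> \<nu>
  proof -
    have "recouple (Nfus D a b e) (Nfus D e c d) (Nfus D b c f) (Nfus D a f d)
         (V (h a) (h b) (h e)) (V (h e) (h c) (h d)) (minv (V (h b) (h c) (h f))) (minv (V (h a) (h f) (h d)))
         (recouple (Nfus D a b e) (Nfus D e c d) (Nfus D b c f) (Nfus D a f d)
           (U (g (h a)) (g (h b)) (g (h e))) (U (g (h e)) (g (h c)) (g (h d)))
           (minv (U (g (h b)) (g (h c)) (g (h f)))) (minv (U (g (h a)) (g (h f)) (g (h d))))
           (\<lambda>\<alpha>' \<beta>' \<mu>' \<nu>'. Fsym D (g (h a)) (g (h b)) (g (h c)) (g (h d))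
            (g (h e), \<alpha>', \<beta>') (g (h f), \<mu>', \<nu>'))) \<alpha> \<beta> \<mu> \<nu> =
       recouple (Nfus D a b e) (Nfus D e c d) (Nfus D b c f) (Nfus D a f d)
         (V (h a) (h b) (h e)) (V (h e) (h c) (h d)) (minv (V (h b) (h c) (h f))) (minv (V (h a) (h f) (h d)))
         (\<lambda>\<alpha>' \<beta>' \<mu>' \<nu>'. Fsym D (h a) (h b) (h c) (h d) (h e, \<alpha>', \<beta>') (h f, \<mu>', \<nu>')) \<alpha> \<beta> \<mu> \<nu>"
      using sym_mapsD(6)[OF gU, of _ "h a" "h b" "h e" _ "h c" "h d" _ "h f"]
      by (intro recouple_cong) (simp add: N)
    also have "\<dots> = Fsym D a b c d (e, \<alpha>, \<beta>) (f, \<mu>, \<nu>)" by (rule sym_mapsD(6)[OF hV i])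
    finally show ?thesis
      using i by (subst (asm) recouple_recouple) (simp_all add: U V N inv_comp)
  qed
qed

lemma sym_maps_one: "(id, \<lambda>a b c. 1\<^sub>m (Nfus D a b c)) \<in> sym_maps k D"
proof (rule sym_mapsI)
  show "1\<^sub>m (Nfus D (id b) (id a) (id c)) * Rsym D (id a) (id b) (id c) * minv (1\<^sub>m (Nfus D (id a) (id b) (id c))) =
      Rsym D a b c" for a b c
    using Rsym_carrier[of a b c] by simp
qed (simp_all add: recouple_one adm_mat_one)

lemma nat_isos_subset: "nat_isos k D \<subseteq> sym_maps k D"
proof
  fix x assume "x \<in> nat_isos k D"
  then obtain \<gamma> where x: "x = (id, \<lambda>a b c. (\<gamma> a * \<gamma> b / \<gamma> c) \<cdot>\<^sub>m 1\<^sub>m (Nfus D a b c))"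
    and \<gamma>: "\<And>a. adm_scalar k (\<gamma> a)" by (auto simp: nat_isos_def)
  have nz: "\<gamma> a \<noteq> 0" for a using adm_scalar_nonzero[OF \<gamma>] .
  have minv: "minv ((\<gamma> a * \<gamma> b / \<gamma> c) \<cdot>\<^sub>m 1\<^sub>m n) = (\<gamma> c / (\<gamma> a * \<gamma> b)) \<cdot>\<^sub>m 1\<^sub>m n" for a b c n
    using nz by (simp add: minv_smult_one)
  show "x \<in> sym_maps k D"
    unfolding x
  proof (rule sym_mapsI)
    show "adm_mat k ((\<gamma> a * \<gamma> b / \<gamma> c) \<cdot>\<^sub>m 1\<^sub>m (Nfus D a b c))" for a b c
      unfolding divide_inverse
      by (intro adm_mat_smult_one adm_scalar_mult adm_scalar_inverse \<gamma>)
    show "(\<gamma> (id b) * \<gamma> (id a) / \<gamma> (id c)) \<cdot>\<^sub>m 1\<^sub>m (Nfus D (id b) (id a) (id c)) * Rsym D (id a) (id b) (id c) *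
        minv ((\<gamma> (id a) * \<gamma> (id b) / \<gamma> (id c)) \<cdot>\<^sub>m 1\<^sub>m (Nfus D (id a) (id b) (id c))) = Rsym D a b c" for a b c
    proof -
      have "\<gamma> c / (\<gamma> a * \<gamma> b) * (\<gamma> b * \<gamma> a / \<gamma> c) = 1" using nz by simp
      then show ?thesis
        using Rsym_carrier[of a b c] nz
        by (simp add: minv smult_smult_mat smult_one_mult(2)[of _ "Nfus D b a c"] smult_one_mult(3)[of _ _ "Nfus D a b c"])
    qed
    show "recouple (Nfus D a b e) (Nfus D e c d) (Nfus D b c f) (Nfus D a f d)
         ((\<gamma> (id a) * \<gamma> (id b) / \<gamma> (id e)) \<cdot>\<^sub>m 1\<^sub>m (Nfus D (id a) (id b) (id e)))
         ((\<gamma> (id e) * \<gamma> (id c) / \<gamma> (id d)) \<cdot>\<^sub>m 1\<^sub>m (Nfus D (id e) (id c) (id d)))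
         (minv ((\<gamma> (id b) * \<gamma> (id c) / \<gamma> (id f)) \<cdot>\<^sub>m 1\<^sub>m (Nfus D (id b) (id c) (id f))))
         (minv ((\<gamma> (id a) * \<gamma> (id f) / \<gamma> (id d)) \<cdot>\<^sub>m 1\<^sub>m (Nfus D (id a) (id f) (id d))))
         (\<lambda>\<alpha>' \<beta>' \<mu>' \<nu>'. Fsym D (id a) (id b) (id c) (id d) (id e, \<alpha>', \<beta>') (id f, \<mu>', \<nu>')) \<alpha> \<beta> \<mu> \<nu> =
       Fsym D a b c d (e, \<alpha>, \<beta>) (f, \<mu>, \<nu>)"
      if i: "\<alpha> < Nfus D a b e" "\<beta> < Nfus D e c d" "\<mu> < Nfus D b c f" "\<nu> < Nfus D a f d"
      for a b c d e f \<alpha> \<beta> \<mu> \<nu>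
    proof -
      \<comment> \<open>The scalars of the internal anyons e and f cancel, and the two trees share
        the leaves a, b, c and the root d, so the others cancel as well.\<close>
      have "\<gamma> a * \<gamma> b / \<gamma> e * (\<gamma> e * \<gamma> c / \<gamma> d) * (\<gamma> f / (\<gamma> b * \<gamma> c)) * (\<gamma> d / (\<gamma> a * \<gamma> f)) = 1"
        using nz by simp
      then show ?thesis using i by (simp add: minv recouple_smult recouple_one del: times_divide_eq_left times_divide_eq_right)
    qed
  qed auto
qed

end

section \<open>Group structure and the quotient by natural isomorphisms\<close>

lemma sym_monoid_simps [simp]:
  "carrier (sym_monoid k D) = sym_maps k D"
  "\<one>\<^bsub>sym_monoid k D\<^esub> = (id, \<lambda>a b c. 1\<^sub>m (Nfus D a b c))"
  "(g, U) \<otimes>\<^bsub>sym_monoid k D\<^esub> (h, V) =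
     (g \<circ> h, \<lambda>a b c. V (perm_inv g a) (perm_inv g b) (perm_inv g c) * U a b c)"
  by (simp_all add: sym_monoid_def)

context skeletal_data
begin

text \<open>The equations of g are read at the preimages of the anyons and multiplied by inverse
  matrices, which solves them for the data at the anyons themselves.\<close>

lemma sym_maps_inverse:
  assumes "(g, U) \<in> sym_maps k D"
  shows "(perm_inv g, \<lambda>a b c. minv (U (g a) (g b) (g c))) \<in> sym_maps k D"
proof (rule sym_mapsI)
  note N = sym_mapsD(2)[OF assms] sym_maps_inv[OF assms]
  note car = sym_mapsD(3)[OF assms] sym_maps_minv[OF assms]
  show "bij (perm_inv g)" using sym_mapsD(1)[OF assms] by (rule bij_imp_bij_inv)
  show "Nfus D (perm_inv g a) (perm_inv g b) (perm_inv g c) = Nfus D a b c" for a b c by (rule N)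
  show "minv (U (g a) (g b) (g c)) \<in> carrier_mat (Nfus D a b c) (Nfus D a b c)" for a b c
    using car(3)[of "g a" "g b" "g c"] by (simp add: N)
  show "adm_mat k (minv (U (g a) (g b) (g c)))" for a b c
    using adm_mat_minv sym_mapsD(3,4)[OF assms] by blast
  show "minv (U (g (perm_inv g b)) (g (perm_inv g a)) (g (perm_inv g c))) *
       Rsym D (perm_inv g a) (perm_inv g b) (perm_inv g c) *
       minv (minv (U (g (perm_inv g a)) (g (perm_inv g b)) (g (perm_inv g c)))) = Rsym D a b c" for a b c
  proof -
    define n where "n = Nfus D a b c"
    have n: "Nfus D b a c = n" by (simp add: n_def Nfus_commute[of b a])
    have c: "U b a c \<in> carrier_mat n n" "minv (U b a c) \<in> carrier_mat n n" "Rsym D a b c \<in> carrier_mat n n"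
      "U a b c \<in> carrier_mat n n" "minv (U a b c) \<in> carrier_mat n n"
      using car(1,3)[of b a c] car(1,3)[of a b c] Rsym_carrier[of a b c] n unfolding n_def by auto
    have "minv (U b a c) * (U b a c * Rsym D a b c * minv (U a b c)) * U a b c =
       (minv (U b a c) * U b a c) * Rsym D a b c * (minv (U a b c) * U a b c)"
      using c by (simp add: assoc_mult_mat[of _ n n _ n _ n])
    also have "\<dots> = Rsym D a b c" using c car(5)[of b a c] car(5)[of a b c] n n_def by simp
    finally show ?thesis
      using sym_mapsD(5)[OF assms, of "perm_inv g b" "perm_inv g a" "perm_inv g c"] by (simp add: N car)
  qed
  show "recouple (Nfus D a b e) (Nfus D e c d) (Nfus D b c f) (Nfus D a f d)
       (minv (U (g (perm_inv g a)) (g (perm_inv g b)) (g (perm_inv g e))))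
       (minv (U (g (perm_inv g e)) (g (perm_inv g c)) (g (perm_inv g d))))
       (minv (minv (U (g (perm_inv g b)) (g (perm_inv g c)) (g (perm_inv g f)))))
       (minv (minv (U (g (perm_inv g a)) (g (perm_inv g f)) (g (perm_inv g d)))))
       (\<lambda>\<alpha>' \<beta>' \<mu>' \<nu>'. Fsym D (perm_inv g a) (perm_inv g b) (perm_inv g c) (perm_inv g d)
          (perm_inv g e, \<alpha>', \<beta>') (perm_inv g f, \<mu>', \<nu>')) \<alpha> \<beta> \<mu> \<nu> =
     Fsym D a b c d (e, \<alpha>, \<beta>) (f, \<mu>, \<nu>)"
    if i: "\<alpha> < Nfus D a b e" "\<beta> < Nfus D e c d" "\<mu> < Nfus D b c f" "\<nu> < Nfus D a f d"
    for a b c d e f \<alpha> \<beta> \<mu> \<nu>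
  proof -
    let ?r = "recouple (Nfus D a b e) (Nfus D e c d) (Nfus D b c f) (Nfus D a f d)"
    have "?r (minv (U a b e)) (minv (U e c d)) (U b c f) (U a f d)
       (\<lambda>\<alpha>' \<beta>' \<mu>' \<nu>'. Fsym D (perm_inv g a) (perm_inv g b) (perm_inv g c) (perm_inv g d)
          (perm_inv g e, \<alpha>', \<beta>') (perm_inv g f, \<mu>', \<nu>')) \<alpha> \<beta> \<mu> \<nu> =
      ?r (minv (U a b e)) (minv (U e c d)) (U b c f) (U a f d)
       (?r (U a b e) (U e c d) (minv (U b c f)) (minv (U a f d))
          (\<lambda>\<alpha>' \<beta>' \<mu>' \<nu>'. Fsym D a b c d (e, \<alpha>', \<beta>') (f, \<mu>', \<nu>'))) \<alpha> \<beta> \<mu> \<nu>"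
      using sym_mapsD(6)[OF assms, of _ "perm_inv g a" "perm_inv g b" "perm_inv g e" _ "perm_inv g c" "perm_inv g d" _ "perm_inv g f"]
      by (intro recouple_cong) (simp add: N)
    also have "\<dots> = Fsym D a b c d (e, \<alpha>, \<beta>) (f, \<mu>, \<nu>)"
      using i by (subst recouple_recouple) (simp_all add: car recouple_one)
    finally show ?thesis by (simp add: N car)
  qed
qed

lemma group_sym_monoid: "group (sym_monoid k D)"
proof (rule groupI)
  fix x y z assume "x \<in> carrier (sym_monoid k D)" "y \<in> carrier (sym_monoid k D)" "z \<in> carrier (sym_monoid k D)"
  then obtain g U h V l W where eq: "x = (g, U)" "y = (h, V)" "z = (l, W)"
    and g: "(g, U) \<in> sym_maps k D" and h: "(h, V) \<in> sym_maps k D" and l: "(l, W) \<in> sym_maps k D"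
    by (cases x; cases y; cases z) auto
  show "x \<otimes>\<^bsub>sym_monoid k D\<^esub> y \<in> carrier (sym_monoid k D)"
    using sym_maps_mult[OF g h] by (simp add: eq)
  have pinv: "perm_inv (g \<circ> h) = perm_inv h \<circ> perm_inv g"
    using sym_mapsD(1)[OF g] sym_mapsD(1)[OF h] by (rule o_inv_distrib)
  note N = sym_maps_inv(1)[OF g] sym_maps_inv(1)[OF h]
  have "W a b c * (V a' b' c' * U a'' b'' c'') = W a b c * V a' b' c' * U a'' b'' c''"
    if "Nfus D a b c = Nfus D a' b' c'" "Nfus D a' b' c' = Nfus D a'' b'' c''" for a b c a' b' c' a'' b'' c''
    by (rule assoc_mult_mat[of _ "Nfus D a b c" "Nfus D a b c" _ "Nfus D a b c" _ "Nfus D a b c", symmetric])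
      (use sym_mapsD(3)[OF l, of a b c] sym_mapsD(3)[OF h, of a' b' c'] sym_mapsD(3)[OF g, of a'' b'' c''] that in simp_all)
  then show "x \<otimes>\<^bsub>sym_monoid k D\<^esub> y \<otimes>\<^bsub>sym_monoid k D\<^esub> z =
     x \<otimes>\<^bsub>sym_monoid k D\<^esub> (y \<otimes>\<^bsub>sym_monoid k D\<^esub> z)"
    by (simp add: eq pinv o_assoc N)
  show "\<one>\<^bsub>sym_monoid k D\<^esub> \<otimes>\<^bsub>sym_monoid k D\<^esub> x = x"
    using right_mult_one_mat[OF sym_mapsD(3)[OF g]] by (simp add: eq)
next
  show "\<one>\<^bsub>sym_monoid k D\<^esub> \<in> carrier (sym_monoid k D)" by (simp add: sym_maps_one)
next
  fix x assume "x \<in> carrier (sym_monoid k D)"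
  then obtain g U where eq: "x = (g, U)" and g: "(g, U) \<in> sym_maps k D" by (cases x) auto
  have "(perm_inv g, \<lambda>a b c. minv (U (g a) (g b) (g c))) \<otimes>\<^bsub>sym_monoid k D\<^esub> x = \<one>\<^bsub>sym_monoid k D\<^esub>"
    using sym_mapsD(1)[OF g] sym_maps_minv(3)[OF g] sym_mapsD(2)[OF g]
    by (simp add: eq inv_inv_eq bij_is_inj fun_eq_iff)
  then show "\<exists>y\<in>carrier (sym_monoid k D). y \<otimes>\<^bsub>sym_monoid k D\<^esub> x = \<one>\<^bsub>sym_monoid k D\<^esub>"
    using sym_maps_inverse[OF g] by auto
qed

lemma nat_isosE:
  assumes "n \<in> nat_isos k D"
  obtains \<gamma> where "\<And>a. adm_scalar k (\<gamma> a)"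
    "n = (id, \<lambda>a b c. (\<gamma> a * \<gamma> b / \<gamma> c) \<cdot>\<^sub>m 1\<^sub>m (Nfus D a b c))"
  using assms by (auto simp: nat_isos_def)

lemma nat_isosI:
  "(\<And>a. adm_scalar k (\<gamma> a)) \<Longrightarrow> (id, \<lambda>a b c. (\<gamma> a * \<gamma> b / \<gamma> c) \<cdot>\<^sub>m 1\<^sub>m (Nfus D a b c)) \<in> nat_isos k D"
  by (auto simp: nat_isos_def)

lemma nat_iso_mult:
  assumes "(g, U) \<in> sym_maps k D"
  shows "(id, \<lambda>a b c. (\<gamma> a * \<gamma> b / \<gamma> c) \<cdot>\<^sub>m 1\<^sub>m (Nfus D a b c)) \<otimes>\<^bsub>sym_monoid k' D\<^esub> (g, U) =
      (g, \<lambda>a b c. (\<gamma> a * \<gamma> b / \<gamma> c) \<cdot>\<^sub>m U a b c)"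
  by (simp add: smult_one_mult(2)[OF sym_mapsD(3)[OF assms]])

lemma nat_isos_subgroup: "subgroup (nat_isos k D) (sym_monoid k D)"
proof -
  interpret G: group "sym_monoid k D" by (rule group_sym_monoid)
  show ?thesis
  proof (rule G.subgroupI)
    show "nat_isos k D \<subseteq> carrier (sym_monoid k D)" using nat_isos_subset by simp
    show "nat_isos k D \<noteq> {}" using nat_isosI[of k "\<lambda>_. 1"] adm_scalar_one by blast
  next
    fix x assume x: "x \<in> nat_isos k D"
    obtain \<gamma> where \<gamma>: "\<And>a. adm_scalar k (\<gamma> a)"
      "x = (id, \<lambda>a b c. (\<gamma> a * \<gamma> b / \<gamma> c) \<cdot>\<^sub>m 1\<^sub>m (Nfus D a b c))" using nat_isosE[OF x] by blast
    define y where "y = (id :: 'a \<Rightarrow> 'a, \<lambda>a b c. (inverse (\<gamma> a) * inverse (\<gamma> b) / inverse (\<gamma> c)) \<cdot>\<^sub>m 1\<^sub>m (Nfus D a b c))"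
    have y: "y \<in> nat_isos k D"
      unfolding y_def by (rule nat_isosI) (simp add: \<gamma>(1) adm_scalar_inverse)
    have "\<gamma> a \<noteq> 0" for a using \<gamma>(1) adm_scalar_nonzero by blast
    then have "inverse (\<gamma> a) * inverse (\<gamma> b) / inverse (\<gamma> c) * (\<gamma> a * \<gamma> b / \<gamma> c) = 1"
      "\<gamma> a * \<gamma> b / \<gamma> c * (inverse (\<gamma> a) * inverse (\<gamma> b) / inverse (\<gamma> c)) = 1" for a b c
      by (simp_all add: field_simps)
    then have "y \<otimes>\<^bsub>sym_monoid k D\<^esub> x = \<one>\<^bsub>sym_monoid k D\<^esub>"
      unfolding y_def \<gamma>(2) by (simp only: sym_monoid_simps smult_one_mult(1) inv_id id_apply o_id) simp
    then have "inv\<^bsub>sym_monoid k D\<^esub> x = y"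
      by (rule G.inv_equality) (use x y nat_isos_subset in auto)
    then show "inv\<^bsub>sym_monoid k D\<^esub> x \<in> nat_isos k D" using y by simp
  next
    fix x y assume x: "x \<in> nat_isos k D" and y: "y \<in> nat_isos k D"
    obtain \<gamma> where \<gamma>: "\<And>a. adm_scalar k (\<gamma> a)"
      "x = (id, \<lambda>a b c. (\<gamma> a * \<gamma> b / \<gamma> c) \<cdot>\<^sub>m 1\<^sub>m (Nfus D a b c))" using nat_isosE[OF x] by blast
    obtain \<delta> where \<delta>: "\<And>a. adm_scalar k (\<delta> a)"
      "y = (id, \<lambda>a b c. (\<delta> a * \<delta> b / \<delta> c) \<cdot>\<^sub>m 1\<^sub>m (Nfus D a b c))" using nat_isosE[OF y] by blast
    have "x \<otimes>\<^bsub>sym_monoid k D\<^esub> y =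
      (id, \<lambda>a b c. ((\<gamma> a * \<delta> a) * (\<gamma> b * \<delta> b) / (\<gamma> c * \<delta> c)) \<cdot>\<^sub>m 1\<^sub>m (Nfus D a b c))"
      unfolding \<gamma>(2) \<delta>(2) by (simp add: smult_one_mult(1) mult_ac)
    then show "x \<otimes>\<^bsub>sym_monoid k D\<^esub> y \<in> nat_isos k D"
      using nat_isosI[of k "\<lambda>a. \<gamma> a * \<delta> a"] \<gamma>(1) \<delta>(1) adm_scalar_mult by simp
  qed
qed

lemma nat_isos_normal: "nat_isos k D \<lhd> sym_monoid k D"
proof -
  interpret G: group "sym_monoid k D" by (rule group_sym_monoid)
  show ?thesis
    unfolding G.normal_inv_iff
  proof (intro conjI ballI nat_isos_subgroup)
    fix x n assume x: "x \<in> carrier (sym_monoid k D)" and n: "n \<in> nat_isos k D"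
    obtain \<gamma> where \<gamma>: "\<And>a. adm_scalar k (\<gamma> a)"
      "n = (id, \<lambda>a b c. (\<gamma> a * \<gamma> b / \<gamma> c) \<cdot>\<^sub>m 1\<^sub>m (Nfus D a b c))" using nat_isosE[OF n] by blast
    obtain g U where eq: "x = (g, U)" and g: "(g, U) \<in> sym_maps k D" using x by (cases x) auto
    \<comment> \<open>Moving a natural isomorphism past g relabels its scalars by the inverse of g;
      m is the result, so that x n = m x.\<close>
    define m where "m = (id :: 'a \<Rightarrow> 'a, \<lambda>a b c. (\<gamma> (perm_inv g a) * \<gamma> (perm_inv g b) / \<gamma> (perm_inv g c)) \<cdot>\<^sub>m 1\<^sub>m (Nfus D a b c))"
    have m: "m \<in> nat_isos k D" unfolding m_def by (rule nat_isosI) (rule \<gamma>(1))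
    have "x \<otimes>\<^bsub>sym_monoid k D\<^esub> n = m \<otimes>\<^bsub>sym_monoid k D\<^esub> x"
      unfolding m_def eq nat_iso_mult[OF g]
      by (simp add: \<gamma>(2) sym_maps_inv[OF g] smult_one_mult(3)[OF sym_mapsD(3)[OF g]])
    moreover have "m \<in> carrier (sym_monoid k D)" using m nat_isos_subset by auto
    ultimately have "x \<otimes>\<^bsub>sym_monoid k D\<^esub> n \<otimes>\<^bsub>sym_monoid k D\<^esub> inv\<^bsub>sym_monoid k D\<^esub> x = m"
      using x G.inv_closed[OF x] by (metis G.inv_solve_right G.m_closed)
    then show "x \<otimes>\<^bsub>sym_monoid k D\<^esub> n \<otimes>\<^bsub>sym_monoid k D\<^esub> inv\<^bsub>sym_monoid k D\<^esub> x \<in> nat_isos k D"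
      using m by simp
  qed
qed

lemma group_zero_form: "group (zero_form k D)"
  unfolding zero_form_def by (rule normal.factorgroup_is_group[OF nat_isos_normal])

end

section \<open>Transport of twisted cocycles\<close>

text \<open>Pullback along \<chi>. The restriction keeps the result extensional, as membership in
  the cochain group demands.\<close>

definition transport ::
  "('h, 'n) monoid_scheme \<Rightarrow> ('h \<Rightarrow> 'g) \<Rightarrow> ('g \<times> 'g \<times> 'g \<Rightarrow> 'b) \<Rightarrow> 'h \<times> 'h \<times> 'h \<Rightarrow> 'b" where
  "transport G \<chi> \<beta> = (\<lambda>(g, h, k) \<in> carrier G \<times> carrier G \<times> carrier G. \<beta> (\<chi> g, \<chi> h, \<chi> k))"

text \<open>The inverse \<chi> is a second parameter rather than an \<open>inv_into\<close>. This
  makes the notion symmetric, so a statement about transport in one direction yields the opposite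
  one through \<open>swap\<close>.\<close>

locale group_equivalence =
  G: group G + G': group G'
  for G :: "'g monoid" and G' :: "'h monoid" and \<phi> \<chi> +
  assumes \<phi>_hom: "\<phi> \<in> hom G G'" and \<chi>_hom: "\<chi> \<in> hom G' G"
    and \<chi>_\<phi>: "x \<in> carrier G \<Longrightarrow> \<chi> (\<phi> x) = x"
    and \<phi>_\<chi>: "y \<in> carrier G' \<Longrightarrow> \<phi> (\<chi> y) = y"
begin

lemma closed: "x \<in> carrier G \<Longrightarrow> \<phi> x \<in> carrier G'" "y \<in> carrier G' \<Longrightarrow> \<chi> y \<in> carrier G"
  using \<phi>_hom \<chi>_hom by (auto simp: hom_def)

lemma mult_\<chi>: "x \<in> carrier G' \<Longrightarrow> y \<in> carrier G' \<Longrightarrow> \<chi> (x \<otimes>\<^bsub>G'\<^esub> y) = \<chi> x \<otimes>\<^bsub>G\<^esub> \<chi> y"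
  using \<chi>_hom by (auto simp: hom_def)

lemma swap: "group_equivalence G' G \<chi> \<phi>"
  by unfold_locales (use \<phi>_hom \<chi>_hom \<chi>_\<phi> \<phi>_\<chi> in auto)

lemma \<phi>_iso: "\<phi> \<in> iso G G'"
  unfolding iso_def using \<phi>_hom closed \<chi>_\<phi> \<phi>_\<chi> by (auto intro!: bij_betw_byWitness[where f' = \<chi>])

lemma inv_into_\<phi>: "y \<in> carrier G' \<Longrightarrow> inv_into (carrier G) \<phi> y = \<chi> y"
  using \<phi>_iso closed(2) \<phi>_\<chi> unfolding iso_def by (auto simp: bij_betw_def intro: inv_into_f_eq)

lemma \<chi>_one: "\<chi> \<one>\<^bsub>G'\<^esub> = \<one>\<^bsub>G\<^esub>"
  using hom_one[OF \<chi>_hom] G.is_group G'.is_group by blast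

lemma transport_transport:
  assumes "\<beta> \<in> extensional (carrier G \<times> carrier G \<times> carrier G)"
  shows "transport G \<phi> (transport G' \<chi> \<beta>) = \<beta>"
  using assms closed \<chi>_\<phi> by (auto simp: transport_def fun_eq_iff extensional_def restrict_def)

lemma transport_cocycle:
  assumes act: "\<And>g. g \<in> carrier G' \<Longrightarrow> r' g = r (\<chi> g)" and \<beta>: "\<beta> \<in> cocycles3 G A r"
  shows "transport G' \<chi> \<beta> \<in> cocycles3 G' A r'"
  using \<beta> closed(2) act unfolding cocycles3_def cochains3_def
  by (auto simp: transport_def mult_\<chi> PiE_iff)

lemma transport_coboundary:
  assumes act: "\<And>g. g \<in> carrier G' \<Longrightarrow> r' g = r (\<chi> g)" and \<beta>: "\<beta> \<in> coboundaries3 G A r"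
  shows "transport G' \<chi> \<beta> \<in> coboundaries3 G' A r'"
proof -
  obtain \<eta> where \<eta>: "\<eta> \<in> carrier G \<times> carrier G \<rightarrow>\<^sub>E carrier A"
    and \<beta>_eq: "\<beta> = (\<lambda>(g, h, k) \<in> carrier G \<times> carrier G \<times> carrier G.
        r g (\<eta> (h, k)) \<otimes>\<^bsub>A\<^esub> inv\<^bsub>A\<^esub> \<eta> (g \<otimes>\<^bsub>G\<^esub> h, k) \<otimes>\<^bsub>A\<^esub> \<eta> (g, h \<otimes>\<^bsub>G\<^esub> k) \<otimes>\<^bsub>A\<^esub> inv\<^bsub>A\<^esub> \<eta> (g, h))"
    using \<beta> unfolding coboundaries3_def by auto
  define \<eta>' where "\<eta>' = (\<lambda>(g, h) \<in> carrier G' \<times> carrier G'. \<eta> (\<chi> g, \<chi> h))"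
  have "\<eta>' \<in> carrier G' \<times> carrier G' \<rightarrow>\<^sub>E carrier A"
    using \<eta> closed(2) by (auto simp: \<eta>'_def PiE_iff)
  moreover have "transport G' \<chi> \<beta> = (\<lambda>(g, h, k) \<in> carrier G' \<times> carrier G' \<times> carrier G'.
        r' g (\<eta>' (h, k)) \<otimes>\<^bsub>A\<^esub> inv\<^bsub>A\<^esub> \<eta>' (g \<otimes>\<^bsub>G'\<^esub> h, k) \<otimes>\<^bsub>A\<^esub> \<eta>' (g, h \<otimes>\<^bsub>G'\<^esub> k) \<otimes>\<^bsub>A\<^esub> inv\<^bsub>A\<^esub> \<eta>' (g, h))"
    unfolding transport_def \<beta>_eq by (rule restrict_ext) (auto simp: closed \<eta>'_def act mult_\<chi>)
  ultimately show ?thesis unfolding coboundaries3_def by blast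
qed

text \<open>An element of the cohomology group is a set, so its image has to be a full coset again.
  Transport hits every coboundary because the swapped equivalence supplies a preimage.\<close>

lemma transport_cohomology:
  assumes act: "\<And>g. g \<in> carrier G' \<Longrightarrow> r' g = r (\<chi> g)" and x: "x \<in> carrier (cohomology3 G A r)"
  shows "transport G' \<chi> ` x \<in> carrier (cohomology3 G' A r')"
proof -
  interpret swap: group_equivalence G' G \<chi> \<phi> by (rule swap)
  have act': "r g = r' (\<phi> g)" if "g \<in> carrier G" for g using act closed(1) \<chi>_\<phi> that by metis
  obtain \<beta> where \<beta>: "\<beta> \<in> cocycles3 G A r"
    and x_eq: "x = (\<lambda>b. b \<otimes>\<^bsub>cochains3 G A\<^esub> \<beta>) ` coboundaries3 G A r"
    using x unfolding cohomology3_def carrier_FactGroup by (auto simp: r_coset_def)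
  have mult: "transport G' \<chi> (b \<otimes>\<^bsub>cochains3 G A\<^esub> \<beta>) = transport G' \<chi> b \<otimes>\<^bsub>cochains3 G' A\<^esub> transport G' \<chi> \<beta>" for b
    unfolding transport_def cochains3_def by (auto simp: closed fun_eq_iff restrict_def)
  have "transport G' \<chi> ` coboundaries3 G A r = coboundaries3 G' A r'"
  proof
    show "transport G' \<chi> ` coboundaries3 G A r \<subseteq> coboundaries3 G' A r'"
      using transport_coboundary[where r = r and r' = r', OF act] by blast
    show "coboundaries3 G' A r' \<subseteq> transport G' \<chi> ` coboundaries3 G A r"
    proof
      fix b assume b: "b \<in> coboundaries3 G' A r'"
      then have "transport G' \<chi> (transport G \<phi> b) = b"
        by (intro swap.transport_transport) (auto simp: coboundaries3_def)
      then show "b \<in> transport G' \<chi> ` coboundaries3 G A r"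
        using swap.transport_coboundary[where r = r' and r' = r, OF act' b] by (metis image_eqI)
    qed
  qed
  then have "transport G' \<chi> ` x = (\<lambda>b. b \<otimes>\<^bsub>cochains3 G' A\<^esub> transport G' \<chi> \<beta>) ` coboundaries3 G' A r'"
    unfolding x_eq by (simp add: image_image mult flip: \<open>_ = coboundaries3 G' A r'\<close>)
  then show ?thesis
    using transport_cocycle[where r = r and r' = r', OF act \<beta>] unfolding cohomology3_def carrier_FactGroup by (auto simp: r_coset_def)
qed

end

text \<open>The two abelian groups are literally equal, so the identity serves as the isomorphism of
  anyons. Cocycles are transported in both directions so that the unions in
  \<open>postnikov_class\<close> are mapped onto each other.\<close>

definition postnikov_equivalence ::
  "kind \<Rightarrow> 'a::finite mtc_data \<Rightarrow> kind \<Rightarrow> 'a mtc_data \<Rightarrow>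
    ('a sym set \<Rightarrow> 'a sym set) \<Rightarrow> ('a sym set \<Rightarrow> 'a sym set) \<Rightarrow> bool" where
  "postnikov_equivalence k D k' D' \<phi> \<chi> \<longleftrightarrow>
     group_equivalence (zero_form k D) (zero_form k' D') \<phi> \<chi> \<and>
     one_form D' = one_form D \<and>
     (\<forall>y\<in>carrier (zero_form k' D'). perm_of y = perm_of (\<chi> y)) \<and>
     (\<forall>\<beta>. postnikov_cocycle k D \<beta> \<longrightarrow> postnikov_cocycle k' D' (transport (zero_form k' D') \<chi> \<beta>)) \<and>
     (\<forall>\<beta>. postnikov_cocycle k' D' \<beta> \<longrightarrow> postnikov_cocycle k D (transport (zero_form k D) \<phi> \<beta>))"

lemma postnikov_equivalence_swap:
  assumes "postnikov_equivalence k D k' D' \<phi> \<chi>"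
  shows "postnikov_equivalence k' D' k D \<chi> \<phi>"
proof -
  interpret group_equivalence "zero_form k D" "zero_form k' D'" \<phi> \<chi>
    using assms by (simp add: postnikov_equivalence_def)
  show ?thesis
    using assms swap closed(1) \<chi>_\<phi> unfolding postnikov_equivalence_def by metis
qed

lemma transport_postnikov_class:
  assumes "postnikov_equivalence k D k' D' \<phi> \<chi>"
  shows "transport (zero_form k' D') \<chi> ` postnikov_class k D \<subseteq> postnikov_class k' D'"
proof -
  interpret group_equivalence "zero_form k D" "zero_form k' D'" \<phi> \<chi>
    using assms by (simp add: postnikov_equivalence_def)
  have "sym_action D' y = sym_action D (\<chi> y)" if "y \<in> carrier (zero_form k' D')" for y
    using assms that by (simp add: postnikov_equivalence_def sym_action_def)
  note coh = transport_cohomology[where A = "one_form D" and r = "sym_action D" and r' = "sym_action D'", OF this]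
  show ?thesis
  proof (rule image_subsetI)
    fix \<alpha> assume "\<alpha> \<in> postnikov_class k D"
    then obtain x \<beta> where x: "\<alpha> \<in> x" "x \<in> carrier (cohomology3 (zero_form k D) (one_form D) (sym_action D))"
      "\<beta> \<in> x" "postnikov_cocycle k D \<beta>"
      unfolding postnikov_class_def by blast
    have "transport (zero_form k' D') \<chi> ` x \<in> carrier (cohomology3 (zero_form k' D') (one_form D') (sym_action D'))"
      using coh[OF _ x(2)] assms by (simp add: postnikov_equivalence_def)
    moreover have "postnikov_cocycle k' D' (transport (zero_form k' D') \<chi> \<beta>)"
      using assms x(4) by (simp add: postnikov_equivalence_def)
    ultimately show "transport (zero_form k' D') \<chi> \<alpha> \<in> postnikov_class k' D'"
      using x(1,3) unfolding postnikov_class_def by blast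
  qed
qed

lemma cohomology3_extensional:
  assumes "x \<in> carrier (cohomology3 G A r)" "\<beta> \<in> x"
  shows "\<beta> \<in> extensional (carrier G \<times> carrier G \<times> carrier G)"
  using assms unfolding cohomology3_def carrier_FactGroup
  by (auto simp: r_coset_def cochains3_def)

lemma two_group_iso_of_postnikov_equivalence:
  assumes "postnikov_equivalence k D k' D' \<phi> \<chi>"
  shows "two_group_iso (two_group_symmetry k D) (two_group_symmetry k' D')"
proof -
  let ?Z = "zero_form k D" and ?Z' = "zero_form k' D'"
  interpret group_equivalence ?Z ?Z' \<phi> \<chi>
    using assms by (simp add: postnikov_equivalence_def)
  interpret swap: group_equivalence ?Z' ?Z \<chi> \<phi> by (rule swap)
  have one: "one_form D' = one_form D" using assms by (simp add: postnikov_equivalence_def)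
  have "sym_action D g a = sym_action D' (\<phi> g) a" if "g \<in> carrier ?Z" for g a
    using assms closed(1)[OF that] \<chi>_\<phi>[OF that] by (simp add: postnikov_equivalence_def sym_action_def)
  moreover have "id \<in> iso (one_form D) (one_form D')" by (simp add: one id_iso)
  have cls: "postnikov_class k' D' = transport ?Z' \<chi> ` postnikov_class k D"
  proof
    show "postnikov_class k' D' \<subseteq> transport ?Z' \<chi> ` postnikov_class k D"
    proof
      fix \<beta> assume \<beta>: "\<beta> \<in> postnikov_class k' D'"
      then have "\<beta> \<in> extensional (carrier ?Z' \<times> carrier ?Z' \<times> carrier ?Z')"
        using cohomology3_extensional unfolding postnikov_class_def by blast
      then have "transport ?Z' \<chi> (transport ?Z \<phi> \<beta>) = \<beta>" by (rule swap.transport_transport)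
      moreover have "transport ?Z \<phi> \<beta> \<in> postnikov_class k D"
        using transport_postnikov_class[OF postnikov_equivalence_swap[OF assms]] \<beta> by blast
      ultimately show "\<beta> \<in> transport ?Z' \<chi> ` postnikov_class k D" by (metis image_eqI)
    qed
  qed (rule transport_postnikov_class[OF assms])
  moreover have "postnikov_class k' D' =
      (\<lambda>\<beta>. \<lambda>(g, h, l) \<in> carrier ?Z' \<times> carrier ?Z' \<times> carrier ?Z'.
        id (\<beta> (inv_into (carrier ?Z) \<phi> g, inv_into (carrier ?Z) \<phi> h, inv_into (carrier ?Z) \<phi> l))) ` postnikov_class k D"
    unfolding cls by (rule image_cong) (auto simp: transport_def inv_into_\<phi> fun_eq_iff restrict_def)
  ultimately show ?thesis
    unfolding two_group_iso_def two_group_symmetry_def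
    by (intro exI[of _ \<phi>] exI[of _ id]) (simp add: \<phi>_iso one id_iso)
qed

lemma two_group_iso_trans:
  assumes "two_group_iso T T'" "two_group_iso T' T''"
  shows "two_group_iso T T''"
proof -
  obtain \<phi> \<psi> where 1: "\<phi> \<in> iso (tg_group T) (tg_group T')" "\<psi> \<in> iso (tg_abelian T) (tg_abelian T')"
     "\<And>g a. g \<in> carrier (tg_group T) \<Longrightarrow> a \<in> carrier (tg_abelian T) \<Longrightarrow> \<psi> (tg_action T g a) = tg_action T' (\<phi> g) (\<psi> a)"
     "tg_class T' = (\<lambda>\<beta>. \<lambda>(g, h, k) \<in> carrier (tg_group T') \<times> carrier (tg_group T') \<times> carrier (tg_group T').
          \<psi> (\<beta> (inv_into (carrier (tg_group T)) \<phi> g, inv_into (carrier (tg_group T)) \<phi> h,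
                inv_into (carrier (tg_group T)) \<phi> k))) ` tg_class T"
    using assms(1) unfolding two_group_iso_def by blast
  obtain \<phi>' \<psi>' where 2: "\<phi>' \<in> iso (tg_group T') (tg_group T'')" "\<psi>' \<in> iso (tg_abelian T') (tg_abelian T'')"
     "\<And>g a. g \<in> carrier (tg_group T') \<Longrightarrow> a \<in> carrier (tg_abelian T') \<Longrightarrow> \<psi>' (tg_action T' g a) = tg_action T'' (\<phi>' g) (\<psi>' a)"
     "tg_class T'' = (\<lambda>\<beta>. \<lambda>(g, h, k) \<in> carrier (tg_group T'') \<times> carrier (tg_group T'') \<times> carrier (tg_group T'').
          \<psi>' (\<beta> (inv_into (carrier (tg_group T')) \<phi>' g, inv_into (carrier (tg_group T')) \<phi>' h,
                inv_into (carrier (tg_group T')) \<phi>' k))) ` tg_class T'"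
    using assms(2) unfolding two_group_iso_def by blast
  have bij: "bij_betw \<phi> (carrier (tg_group T)) (carrier (tg_group T'))"
    "bij_betw \<phi>' (carrier (tg_group T')) (carrier (tg_group T''))"
    using 1(1) 2(1) by (auto simp: iso_def)
  have inv: "inv_into (carrier (tg_group T)) (\<phi>' \<circ> \<phi>) g =
      inv_into (carrier (tg_group T)) \<phi> (inv_into (carrier (tg_group T')) \<phi>' g)"
     "inv_into (carrier (tg_group T')) \<phi>' g \<in> carrier (tg_group T')"
    if "g \<in> carrier (tg_group T'')" for g
    using bij that inv_into_comp[of \<phi>' \<phi> "carrier (tg_group T)" g]
    by (auto simp: bij_betw_def inv_into_into)
  have "tg_class T'' = (\<lambda>\<beta>. \<lambda>(g, h, k) \<in> carrier (tg_group T'') \<times> carrier (tg_group T'') \<times> carrier (tg_group T'').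
          (\<psi>' \<circ> \<psi>) (\<beta> (inv_into (carrier (tg_group T)) (\<phi>' \<circ> \<phi>) g, inv_into (carrier (tg_group T)) (\<phi>' \<circ> \<phi>) h,
                inv_into (carrier (tg_group T)) (\<phi>' \<circ> \<phi>) k))) ` tg_class T"
    unfolding 2(4) 1(4) image_image
    by (intro image_cong refl restrict_ext) (auto simp: inv)
  moreover have "\<phi>' \<circ> \<phi> \<in> iso (tg_group T) (tg_group T'')" "\<psi>' \<circ> \<psi> \<in> iso (tg_abelian T) (tg_abelian T'')"
    using 1(1,2) 2(1,2) by (auto intro: iso_set_trans)
  moreover have "(\<psi>' \<circ> \<psi>) (tg_action T g a) = tg_action T'' ((\<phi>' \<circ> \<phi>) g) ((\<psi>' \<circ> \<psi>) a)"
    if "g \<in> carrier (tg_group T)" "a \<in> carrier (tg_abelian T)" for g a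
  proof -
    have "\<phi> g \<in> carrier (tg_group T')" "\<psi> a \<in> carrier (tg_abelian T')"
      using 1(1,2) that by (auto simp: iso_def hom_def)
    then show ?thesis using 1(3)[OF that] 2(3) by simp
  qed
  ultimately show ?thesis unfolding two_group_iso_def by blast
qed

section \<open>Conjugation by a field automorphism\<close>

lemma ring_automorphismD:
  assumes "ring_automorphism \<sigma>"
  shows "bij \<sigma>" "\<sigma> 1 = 1" "\<sigma> 0 = 0" "\<sigma> (x + y) = \<sigma> x + \<sigma> y" "\<sigma> (x * y) = \<sigma> x * \<sigma> y"
    and "\<sigma> (- x) = - \<sigma> x" "\<sigma> (inverse x) = inverse (\<sigma> x)" "\<sigma> (x / y) = \<sigma> x / \<sigma> y"
    and "\<sigma> x = 0 \<longleftrightarrow> x = 0" "\<sigma> (sum f I) = (\<Sum>i\<in>I. \<sigma> (f i))"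
proof -
  show bij: "bij \<sigma>" and one: "\<sigma> 1 = 1" and add: "\<sigma> (x + y) = \<sigma> x + \<sigma> y" and mult: "\<sigma> (x * y) = \<sigma> x * \<sigma> y" for x y
    using assms by (simp_all add: ring_automorphism_def)
  show zero: "\<sigma> 0 = 0" using add[of 0 0] by (metis add.right_neutral add_cancel_right_right)
  show "\<sigma> (- x) = - \<sigma> x" using add[of x "- x"] zero by (simp add: eq_neg_iff_add_eq_0 add.commute)
  show eq0: "\<sigma> x = 0 \<longleftrightarrow> x = 0" for x using zero bij by (metis bij_pointE)
  show inv: "\<sigma> (inverse x) = inverse (\<sigma> x)" for x
  proof (cases "x = 0")
    case False
    then have "\<sigma> x * \<sigma> (inverse x) = 1" using one mult[of x "inverse x"] by simp
    then show ?thesis by (metis inverse_unique)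
  qed (simp add: zero)
  show "\<sigma> (x / y) = \<sigma> x / \<sigma> y" by (simp add: divide_inverse mult inv)
  show "\<sigma> (sum f I) = (\<Sum>i\<in>I. \<sigma> (f i))"
    by (induction I rule: infinite_finite_induct) (simp_all add: zero add)
qed

lemma ring_automorphism_inverse:
  assumes "ring_automorphism \<sigma>"
  shows "ring_automorphism (inv_into UNIV \<sigma>)"
proof -
  note D = ring_automorphismD[OF assms]
  have eq: "inv_into UNIV \<sigma> y = x \<longleftrightarrow> y = \<sigma> x" for x y using D(1) by (metis bij_inv_eq_iff)
  have *: "\<sigma> (inv_into UNIV \<sigma> x) = x" for x using D(1) by (simp add: bij_is_surj surj_f_inv_f)
  show ?thesis
    unfolding ring_automorphism_def eq using D(1) by (simp add: bij_imp_bij_inv D(2,4,5) *)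
qed

lemma map_mat_ring_automorphism:
  assumes "ring_automorphism \<sigma>"
  shows "A \<in> carrier_mat l m \<Longrightarrow> B \<in> carrier_mat m n \<Longrightarrow> map_mat \<sigma> (A * B) = map_mat \<sigma> A * map_mat \<sigma> B"
    and "map_mat \<sigma> (1\<^sub>m n) = 1\<^sub>m n" "map_mat \<sigma> (x \<cdot>\<^sub>m C) = \<sigma> x \<cdot>\<^sub>m map_mat \<sigma> C"
  by (rule eq_matI; auto simp: ring_automorphismD[OF assms] scalar_prod_def)+

lemma map_mat_minv:
  assumes "ring_automorphism \<sigma>" "A \<in> carrier_mat n n" "invertible_mat A"
  shows "minv (map_mat \<sigma> A) = map_mat \<sigma> (minv A)" "invertible_mat (map_mat \<sigma> A)"
proof -
  note i = minv[OF assms(2,3)]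
  have "map_mat \<sigma> A * map_mat \<sigma> (minv A) = 1\<^sub>m n" "map_mat \<sigma> (minv A) * map_mat \<sigma> A = 1\<^sub>m n"
    using i map_mat_ring_automorphism(1,2)[OF assms(1)] assms(2) by metis+
  then show "minv (map_mat \<sigma> A) = map_mat \<sigma> (minv A)" "invertible_mat (map_mat \<sigma> A)"
    using assms(2) i(1) by (auto intro!: minv_eqI[of _ n] invertible_matI[of _ n "map_mat \<sigma> (minv A)"])
qed

definition rescale :: "('a \<Rightarrow> complex) \<Rightarrow> ('a \<Rightarrow> 'a \<Rightarrow> 'a \<Rightarrow> complex mat) \<Rightarrow> 'a \<Rightarrow> 'a \<Rightarrow> 'a \<Rightarrow> complex mat" where
  "rescale \<gamma> U a b c = (\<gamma> a * \<gamma> b / \<gamma> c) \<cdot>\<^sub>m U a b c"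

section \<open>Cosets of natural isomorphisms and the elements of the 0-form group\<close>

context skeletal_data
begin

lemma nat_isos_image:
  "nat_isos k D = (\<lambda>\<gamma>. (id, \<lambda>a b c. (\<gamma> a * \<gamma> b / \<gamma> c) \<cdot>\<^sub>m 1\<^sub>m (Nfus D a b c))) ` {\<gamma>. \<forall>a. adm_scalar k (\<gamma> a)}"
  by (auto simp: nat_isos_def)

abbreviation coset :: "kind \<Rightarrow> 'a sym \<Rightarrow> 'a sym set" where
  "coset k m \<equiv> nat_isos k D #>\<^bsub>sym_monoid k D\<^esub> m"

text \<open>The kinds k and k' are independent: a unitary map also has a coset under all nonzero
  scalars, which is how the two kinds are compared later.\<close>

lemma coset_eq:
  assumes "(g, U) \<in> sym_maps k D"
  shows "coset k' (g, U) = {(g, rescale \<gamma> U) | \<gamma>. \<forall>a. adm_scalar k' (\<gamma> a)}"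
proof -
  have *: "(id, \<lambda>a b c. (\<gamma> a * \<gamma> b / \<gamma> c) \<cdot>\<^sub>m 1\<^sub>m (Nfus D a b c)) \<otimes>\<^bsub>sym_monoid k' D\<^esub> (g, U) = (g, rescale \<gamma> U)" for \<gamma>
    unfolding nat_iso_mult[OF assms] by (simp add: rescale_def fun_eq_iff)
  show ?thesis
    unfolding r_coset_def nat_isos_image UN_simps * by auto
qed

lemma perm_of_coset:
  assumes "(g, U) \<in> sym_maps k D"
  shows "perm_of (coset k' (g, U)) = g"
proof -
  have "(g, rescale (\<lambda>_. 1) U) \<in> coset k' (g, U)"
    using adm_scalar_one by (auto simp: coset_eq[OF assms])
  then show ?thesis
    unfolding perm_of_def by (intro the_equality) (auto simp: coset_eq[OF assms])
qed

lemma carrier_zero_form: "carrier (zero_form k D) = coset k ` sym_maps k D"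
  by (simp add: zero_form_def carrier_FactGroup)

lemma zero_form_mem:
  assumes "x \<in> carrier (zero_form k D)" "m \<in> x"
  shows "m \<in> sym_maps k D" "x = coset k m" "perm_of x = fst m"
proof -
  interpret G: group "sym_monoid k D" by (rule group_sym_monoid)
  obtain m' where m': "m' \<in> sym_maps k D" "x = coset k m'" using assms(1) carrier_zero_form by blast
  show m: "m \<in> sym_maps k D"
    using assms(2) m' nat_isos_subgroup[of k] G.r_coset_subset_G[of "nat_isos k D" m'] nat_isos_subset by auto
  show x: "x = coset k m"
    using G.repr_independence[of m "nat_isos k D" m'] assms(2) m' nat_isos_subgroup by auto
  show "perm_of x = fst m" using m unfolding x by (cases m) (simp add: perm_of_coset)
qed

lemma zero_form_mem_self: "m \<in> sym_maps k D \<Longrightarrow> m \<in> coset k m"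
proof -
  interpret G: group "sym_monoid k D" by (rule group_sym_monoid)
  show "m \<in> sym_maps k D \<Longrightarrow> m \<in> coset k m"
    using G.rcos_self[of m "nat_isos k D"] nat_isos_subgroup by simp
qed

lemma zero_form_nonempty: "x \<in> carrier (zero_form k D) \<Longrightarrow> \<exists>m. m \<in> x"
  using zero_form_mem_self carrier_zero_form by blast

lemma coset_mult:
  assumes "m \<in> sym_maps k D" "m' \<in> sym_maps k D"
  shows "coset k m \<otimes>\<^bsub>zero_form k D\<^esub> coset k m' = coset k (m \<otimes>\<^bsub>sym_monoid k D\<^esub> m')"
  using normal.rcos_sum[OF nat_isos_normal, of m k m'] assms by (simp add: zero_form_def)

lemma zero_form_mult_mem:
  assumes x: "x \<in> carrier (zero_form k D)" "m \<in> x" and y: "y \<in> carrier (zero_form k D)" "m' \<in> y"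
  shows "m \<otimes>\<^bsub>sym_monoid k D\<^esub> m' \<in> x \<otimes>\<^bsub>zero_form k D\<^esub> y"
proof -
  interpret G: group "sym_monoid k D" by (rule group_sym_monoid)
  note mx = zero_form_mem[OF x] and my = zero_form_mem[OF y]
  have "m \<otimes>\<^bsub>sym_monoid k D\<^esub> m' \<in> sym_maps k D" using G.m_closed[of m m'] mx(1) my(1) by simp
  then show ?thesis using coset_mult[OF mx(1) my(1)] mx(2) my(2) zero_form_mem_self by simp
qed

lemma zero_form_one: "\<one>\<^bsub>zero_form k D\<^esub> = coset k \<one>\<^bsub>sym_monoid k D\<^esub>"
proof -
  interpret G: group "sym_monoid k D" by (rule group_sym_monoid)
  show ?thesis using G.coset_mult_one[of "nat_isos k D"] nat_isos_subset by (simp add: zero_form_def)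
qed

lemma perm_of_mult:
  assumes "x \<in> carrier (zero_form k D)" "y \<in> carrier (zero_form k D)"
  shows "perm_of (x \<otimes>\<^bsub>zero_form k D\<^esub> y) = perm_of x \<circ> perm_of y"
proof -
  interpret Z: group "zero_form k D" by (rule group_zero_form)
  obtain g U h V where m: "(g, U) \<in> x" "(h, V) \<in> y"
    using zero_form_nonempty[OF assms(1)] zero_form_nonempty[OF assms(2)] by auto
  show ?thesis
    using zero_form_mem(3)[OF Z.m_closed[OF assms] zero_form_mult_mem[OF assms(1) m(1) assms(2) m(2)]]
      zero_form_mem(3)[OF assms(1) m(1)] zero_form_mem(3)[OF assms(2) m(2)] by simp
qed

lemma perm_of_one: "perm_of \<one>\<^bsub>zero_form k D\<^esub> = id"
  unfolding zero_form_one using perm_of_coset[OF sym_maps_one] by simp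

lemma perm_of_props:
  assumes "x \<in> carrier (zero_form k D)"
  shows "bij (perm_of x)" "Nfus D (perm_inv (perm_of x) a) (perm_inv (perm_of x) b) (perm_inv (perm_of x) c) = Nfus D a b c"
proof -
  obtain m where m: "m \<in> x" using zero_form_nonempty[OF assms] by blast
  then have g: "(perm_of x, snd m) \<in> sym_maps k D" using zero_form_mem[OF assms m] by simp
  show "bij (perm_of x)" "Nfus D (perm_inv (perm_of x) a) (perm_inv (perm_of x) b) (perm_inv (perm_of x) c) = Nfus D a b c"
    using sym_mapsD(1)[OF g] sym_maps_inv(1)[OF g] by auto
qed

lemma zero_form_rescale:
  assumes "x \<in> carrier (zero_form k D)" "m \<in> x" "m' \<in> x"
  obtains \<gamma> where "\<And>a. adm_scalar k (\<gamma> a)" "m' = (fst m, rescale \<gamma> (snd m))"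
proof -
  obtain g U where m: "m = (g, U)" by (cases m)
  have "(g, U) \<in> sym_maps k D" "x = coset k (g, U)" using zero_form_mem[OF assms(1,2)] m by auto
  then show thesis using that assms(3) m by (auto simp: coset_eq)
qed

lemma dual: "Nfus D a (dual D a) (vac D) = 1" "Nfus D (dual D a) a (vac D) = 1"
proof -
  obtain b where b: "\<And>c. Nfus D a c (vac D) = (if c = b then 1 else 0)" using Nfus_dual_ex by blast
  have "dual D a = b" unfolding dual_def by (rule the_equality) (simp_all add: b split: if_splits)
  then show *: "Nfus D a (dual D a) (vac D) = 1" by (simp add: b)
  show "Nfus D (dual D a) a (vac D) = 1" using * Nfus_commute by simp
qed

end

section \<open>Data and symmetries of the conjugate category\<close>

definition conjugate_sym :: "(complex \<Rightarrow> complex) \<Rightarrow> 'a sym \<Rightarrow> 'a sym" where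
  "conjugate_sym \<sigma> = (\<lambda>(g, U). (g, \<lambda>a b c. map_mat \<sigma> (U a b c)))"

lemma conjugate_sym_simp [simp]: "conjugate_sym \<sigma> (g, U) = (g, \<lambda>a b c. map_mat \<sigma> (U a b c))"
  by (simp add: conjugate_sym_def)

text \<open>The relation uses the automorphism \<sigma> of the complex numbers rather than q, so
  that the inverse relation is again an instance. F symbols are compared on admissible trees only:
  elsewhere their values are arbitrary and may lie outside the field on which \<sigma> agrees with
  q.\<close>

locale conjugate_data = D: skeletal_data D + D': skeletal_data D'
  for D D' :: "'a::finite mtc_data" and \<sigma> :: "complex \<Rightarrow> complex" +
  assumes \<sigma>: "ring_automorphism \<sigma>"
    and vac_eq: "vac D' = vac D" and Nfus_eq: "Nfus D' = Nfus D"
    and piv_eq: "piv D' a = \<sigma> (piv D a)"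
    and Fsym_eq: "x \<in> left_trees D a b c d \<Longrightarrow> y \<in> right_trees D a b c d \<Longrightarrow>
      Fsym D' a b c d x y = \<sigma> (Fsym D a b c d x y)"
    and Rsym_eq: "Rsym D' a b c = map_mat \<sigma> (Rsym D a b c)"
begin

lemmas \<sigma>_simps = ring_automorphismD[OF \<sigma>]
lemmas map_mat_\<sigma> = map_mat_ring_automorphism[OF \<sigma>]

lemma conjugate_data_inverse: "conjugate_data D' D (perm_inv \<sigma>)"
proof
  have *: "perm_inv \<sigma> (\<sigma> x) = x" for x using \<sigma>_simps(1) by (simp add: bij_is_inj inv_f_f)
  show "ring_automorphism (perm_inv \<sigma>)" by (rule ring_automorphism_inverse[OF \<sigma>])
  show "vac D = vac D'" "Nfus D = Nfus D'" by (simp_all add: vac_eq Nfus_eq)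
  show "piv D a = perm_inv \<sigma> (piv D' a)" for a by (simp add: piv_eq *)
  show "Fsym D a b c d x y = perm_inv \<sigma> (Fsym D' a b c d x y)"
    if "x \<in> left_trees D' a b c d" "y \<in> right_trees D' a b c d" for a b c d x y
    using that Fsym_eq by (simp add: * left_trees_def right_trees_def Nfus_eq)
  show "Rsym D a b c = map_mat (perm_inv \<sigma>) (Rsym D' a b c)" for a b c
    unfolding Rsym_eq by (rule eq_matI) (auto simp: *)
qed

lemma one_form_eq: "one_form D' = one_form D"
  by (simp add: one_form_def vac_eq Nfus_eq)

lemma qdim_eq: "qdim D' a = \<sigma> (qdim D a)"
proof -
  have "dual D' a = dual D a" by (simp add: dual_def vac_eq Nfus_eq)
  moreover have "(vac D, 0, 0) \<in> left_trees D a (dual D a) a a" "(vac D, 0, 0) \<in> right_trees D a (dual D a) a a"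
    using D.dual[of a] by (simp_all add: left_trees_def right_trees_def D.Nfus_vac_left D.Nfus_vac_right)
  ultimately show ?thesis by (simp add: qdim_def vac_eq piv_eq Fsym_eq \<sigma>_simps)
qed

lemma Smat_eq: "Smat D' a b = \<sigma> (Smat D a b)"
  unfolding Smat_def \<sigma>_simps Nfus_eq qdim_eq Rsym_eq
  using D.Rsym_carrier
  by (intro sum.cong refl arg_cong2[of _ _ _ _ times])
    (metis carrier_matD index_map_mat(1) lessThan_iff)+

text \<open>The R and F equations are polynomial in U, its inverse, R and F, and \<sigma> commutes
  with matrix products and inverses. Since g preserves fusion multiplicities, it keeps trees
  admissible, so \<open>Fsym_eq\<close> covers every F symbol that occurs.\<close>

lemma conjugate_sym_maps:
  assumes "m \<in> sym_maps Linear D"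
  shows "conjugate_sym \<sigma> m \<in> sym_maps Linear D'"
proof -
  obtain g U where m: "m = (g, U)" by (cases m)
  have gU: "(g, U) \<in> sym_maps Linear D" using assms m by simp
  note car = D.sym_mapsD(3)[OF gU] D.sym_maps_minv[OF gU]
  have minv: "minv (map_mat \<sigma> (U a b c)) = map_mat \<sigma> (minv (U a b c))" "invertible_mat (map_mat \<sigma> (U a b c))" for a b c
    using map_mat_minv[OF \<sigma> car(1,2)] by auto
  have "(g, \<lambda>a b c. map_mat \<sigma> (U a b c)) \<in> sym_maps Linear D'"
  proof (rule D'.sym_mapsI)
    show "bij g" by (rule D.sym_mapsD(1)[OF gU])
    show "Nfus D' (g a) (g b) (g c) = Nfus D' a b c" for a b c
      using D.sym_mapsD(2)[OF gU] by (simp add: Nfus_eq)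
    show "map_mat \<sigma> (U a b c) \<in> carrier_mat (Nfus D' a b c) (Nfus D' a b c)" for a b c
      using car(1) by (simp add: Nfus_eq)
    show "adm_mat Linear (map_mat \<sigma> (U a b c))" for a b c using minv by simp
    show "map_mat \<sigma> (U (g b) (g a) (g c)) * Rsym D' (g a) (g b) (g c) *
      minv (map_mat \<sigma> (U (g a) (g b) (g c))) = Rsym D' a b c" for a b c
    proof -
      have c: "U (g b) (g a) (g c) \<in> carrier_mat (Nfus D b a c) (Nfus D b a c)"
        "Rsym D (g a) (g b) (g c) \<in> carrier_mat (Nfus D b a c) (Nfus D a b c)"
        "minv (U (g a) (g b) (g c)) \<in> carrier_mat (Nfus D a b c) (Nfus D a b c)"
        using car(1)[of "g b" "g a" "g c"] car(3)[of "g a" "g b" "g c"] D.Rsym_carrier[of "g a" "g b" "g c"]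
        by (simp_all add: D.sym_mapsD(2)[OF gU])
      have "map_mat \<sigma> (U (g b) (g a) (g c)) * map_mat \<sigma> (Rsym D (g a) (g b) (g c)) * map_mat \<sigma> (minv (U (g a) (g b) (g c))) =
        map_mat \<sigma> (U (g b) (g a) (g c) * Rsym D (g a) (g b) (g c) * minv (U (g a) (g b) (g c)))"
        by (simp only: map_mat_\<sigma>(1)[OF mult_carrier_mat[OF c(1,2)] c(3)] map_mat_\<sigma>(1)[OF c(1,2)])
      then show ?thesis by (simp add: minv Rsym_eq D.sym_mapsD(5)[OF gU])
    qed
    show "recouple (Nfus D' a b e) (Nfus D' e c d) (Nfus D' b c f) (Nfus D' a f d)
         (map_mat \<sigma> (U (g a) (g b) (g e))) (map_mat \<sigma> (U (g e) (g c) (g d)))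
         (minv (map_mat \<sigma> (U (g b) (g c) (g f)))) (minv (map_mat \<sigma> (U (g a) (g f) (g d))))
         (\<lambda>\<alpha>' \<beta>' \<mu>' \<nu>'. Fsym D' (g a) (g b) (g c) (g d) (g e, \<alpha>', \<beta>') (g f, \<mu>', \<nu>')) \<alpha> \<beta> \<mu> \<nu> =
       Fsym D' a b c d (e, \<alpha>, \<beta>) (f, \<mu>, \<nu>)"
      if i': "\<alpha> < Nfus D' a b e" "\<beta> < Nfus D' e c d" "\<mu> < Nfus D' b c f" "\<nu> < Nfus D' a f d"
      for a b c d e f \<alpha> \<beta> \<mu> \<nu>
    proof -
      have i: "\<alpha> < Nfus D a b e" "\<beta> < Nfus D e c d" "\<mu> < Nfus D b c f" "\<nu> < Nfus D a f d"
        using i' by (simp_all add: Nfus_eq)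
      have dims: "U (g a) (g b) (g e) \<in> carrier_mat (Nfus D a b e) (Nfus D a b e)"
         "U (g e) (g c) (g d) \<in> carrier_mat (Nfus D e c d) (Nfus D e c d)"
         "minv (U (g b) (g c) (g f)) \<in> carrier_mat (Nfus D b c f) (Nfus D b c f)"
         "minv (U (g a) (g f) (g d)) \<in> carrier_mat (Nfus D a f d) (Nfus D a f d)"
        using car(1)[of "g a" "g b" "g e"] car(1)[of "g e" "g c" "g d"] car(3)[of "g b" "g c" "g f"] car(3)[of "g a" "g f" "g d"]
        by (simp_all add: D.sym_mapsD(2)[OF gU])
      have F: "Fsym D' (g a) (g b) (g c) (g d) (g e, \<alpha>', \<beta>') (g f, \<mu>', \<nu>') =
         \<sigma> (Fsym D (g a) (g b) (g c) (g d) (g e, \<alpha>', \<beta>') (g f, \<mu>', \<nu>'))"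
        if "\<alpha>' < Nfus D a b e" "\<beta>' < Nfus D e c d" "\<mu>' < Nfus D b c f" "\<nu>' < Nfus D a f d" for \<alpha>' \<beta>' \<mu>' \<nu>'
        using that by (intro Fsym_eq) (simp_all add: left_trees_def right_trees_def D.sym_mapsD(2)[OF gU])
      have "Fsym D' a b c d (e, \<alpha>, \<beta>) (f, \<mu>, \<nu>) = \<sigma> (Fsym D a b c d (e, \<alpha>, \<beta>) (f, \<mu>, \<nu>))"
        using i by (intro Fsym_eq) (simp_all add: left_trees_def right_trees_def)
      also have "\<dots> = recouple (Nfus D a b e) (Nfus D e c d) (Nfus D b c f) (Nfus D a f d)
         (map_mat \<sigma> (U (g a) (g b) (g e))) (map_mat \<sigma> (U (g e) (g c) (g d)))
         (map_mat \<sigma> (minv (U (g b) (g c) (g f)))) (map_mat \<sigma> (minv (U (g a) (g f) (g d))))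
         (\<lambda>\<alpha>' \<beta>' \<mu>' \<nu>'. Fsym D' (g a) (g b) (g c) (g d) (g e, \<alpha>', \<beta>') (g f, \<mu>', \<nu>')) \<alpha> \<beta> \<mu> \<nu>"
        unfolding D.sym_mapsD(6)[OF gU i, symmetric] recouple_def \<sigma>_simps
        using i dims by (intro sum.cong refl) (auto simp: F)
      finally show ?thesis by (simp add: Nfus_eq minv)
    qed
  qed
  then show ?thesis by (simp add: m)
qed

end

section \<open>Representatives and Postnikov cocycles under conjugation\<close>

context skeletal_data
begin

lemma symmetry_choiceD:
  assumes "symmetry_choice k D s \<gamma>" "g \<in> carrier (zero_form k D)" "h \<in> carrier (zero_form k D)"
  shows "s g \<in> g" "normalised_sym D (s g)" "s \<one>\<^bsub>zero_form k D\<^esub> = \<one>\<^bsub>sym_monoid k D\<^esub>"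
    "adm_scalar k (\<gamma> a g h)" "\<gamma> (vac D) g h = 1" "\<gamma> a \<one>\<^bsub>zero_form k D\<^esub> g = 1" "\<gamma> a g \<one>\<^bsub>zero_form k D\<^esub> = 1"
    "Nfus D a b c \<noteq> 0 \<Longrightarrow> (\<gamma> a g h * \<gamma> b g h / \<gamma> c g h) \<cdot>\<^sub>m 1\<^sub>m (Nfus D a b c) =
        minv (snd (s g) a b c) *
        minv (snd (s h) (perm_inv (perm_of g) a) (perm_inv (perm_of g) b) (perm_inv (perm_of g) c)) *
        snd (s (g \<otimes>\<^bsub>zero_form k D\<^esub> h)) a b c"
  using assms unfolding symmetry_choice_def Let_def by blast+

lemma symmetry_choice_mats:
  assumes s: "symmetry_choice k D s \<gamma>" and g: "g \<in> carrier (zero_form k D)"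
  shows "snd (s g) a b c \<in> carrier_mat (Nfus D a b c) (Nfus D a b c)"
    "invertible_mat (snd (s g) a b c)" "adm_mat k (snd (s g) a b c)" "fst (s g) = perm_of g"
proof -
  have "(fst (s g), snd (s g)) \<in> sym_maps k D" using zero_form_mem(1)[OF g] symmetry_choiceD(1)[OF s g g] by simp
  then show "snd (s g) a b c \<in> carrier_mat (Nfus D a b c) (Nfus D a b c)"
    "invertible_mat (snd (s g) a b c)" "adm_mat k (snd (s g) a b c)"
    using sym_mapsD(3,4) sym_maps_minv(1) by blast+
  show "fst (s g) = perm_of g" using zero_form_mem(3)[OF g] symmetry_choiceD(1)[OF s g g] by simp
qed

end

context conjugate_data
begin

text \<open>The new representative of y is the conjugate of the old one of \<chi> y, and
  \<open>mem\<close> says that it does lie in y. The kinds k and k' may differ: with the identity in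
  place of \<sigma>, the lemma also passes from unitary to linear symmetries.\<close>

lemma postnikov_cocycle_transport:
  assumes equiv: "group_equivalence (zero_form k D) (zero_form k' D') \<phi> \<chi>"
    and scalar: "\<And>z. adm_scalar k z \<Longrightarrow> adm_scalar k' (\<sigma> z)"
    and mem: "\<And>y m. y \<in> carrier (zero_form k' D') \<Longrightarrow> m \<in> \<chi> y \<Longrightarrow> conjugate_sym \<sigma> m \<in> y"
  shows "y \<in> carrier (zero_form k' D') \<Longrightarrow> perm_of y = perm_of (\<chi> y)"
    and "postnikov_cocycle k D \<beta> \<Longrightarrow> postnikov_cocycle k' D' (transport (zero_form k' D') \<chi> \<beta>)"
proof -
  let ?Z = "zero_form k D" and ?Z' = "zero_form k' D'"
  interpret E: group_equivalence ?Z ?Z' \<phi> \<chi> by (rule equiv)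
  show perm: "perm_of y = perm_of (\<chi> y)" if y: "y \<in> carrier ?Z'" for y
  proof -
    obtain m where m: "m \<in> \<chi> y" using D.zero_form_nonempty[OF E.closed(2)[OF y]] by blast
    show ?thesis
      using D.zero_form_mem(3)[OF E.closed(2)[OF y] m] D'.zero_form_mem(3)[OF y mem[OF y m]]
      by (cases m) simp
  qed
  assume "postnikov_cocycle k D \<beta>"
  then obtain s \<gamma> where \<beta>: "\<beta> \<in> cocycles3 ?Z (one_form D) (sym_action D)"
    and s: "symmetry_choice k D s \<gamma>"
    and \<Omega>: "\<And>g h l a. g \<in> carrier ?Z \<Longrightarrow> h \<in> carrier ?Z \<Longrightarrow> l \<in> carrier ?Z \<Longrightarrow>
       Omega k D \<gamma> a g h l = Smat D a (\<beta> (g, h, l)) * Smat D (vac D) (vac D) /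
           (Smat D (vac D) (\<beta> (g, h, l)) * Smat D (vac D) a)"
    unfolding postnikov_cocycle_def Let_def by blast
  define s' where "s' y = conjugate_sym \<sigma> (s (\<chi> y))" for y
  define \<gamma>' where "\<gamma>' a y z = \<sigma> (\<gamma> a (\<chi> y) (\<chi> z))" for a y z
  have snd_s': "snd (s' y) a b c = map_mat \<sigma> (snd (s (\<chi> y)) a b c)" for y a b c
    by (simp add: s'_def conjugate_sym_def split_def)
  note mats = D.symmetry_choice_mats[OF s]
  note choice = D.symmetry_choiceD[OF s]
  have "symmetry_choice k' D' s' \<gamma>'"
    unfolding symmetry_choice_def Let_def
  proof (intro conjI ballI allI impI)
    fix y assume y: "y \<in> carrier ?Z'"
    note cy = E.closed(2)[OF y]
    show "s' y \<in> y" unfolding s'_def using mem[OF y] choice(1)[OF cy cy] by blast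
    show "normalised_sym D' (s' y)"
      using choice(2)[OF cy cy]
      by (simp add: normalised_sym_def s'_def conjugate_sym_def split_def vac_eq Nfus_eq map_mat_\<sigma>)
    fix a
    show "\<gamma>' a \<one>\<^bsub>?Z'\<^esub> y = 1" "\<gamma>' a y \<one>\<^bsub>?Z'\<^esub> = 1"
      using choice(6,7)[OF cy cy] by (simp_all add: \<gamma>'_def E.\<chi>_one \<sigma>_simps)
  next
    show "s' \<one>\<^bsub>?Z'\<^esub> = \<one>\<^bsub>sym_monoid k' D'\<^esub>"
      using choice(3)[OF E.G.one_closed E.G.one_closed] by (simp add: s'_def E.\<chi>_one Nfus_eq map_mat_\<sigma>)
  next
    fix y z a assume y: "y \<in> carrier ?Z'" and z: "z \<in> carrier ?Z'"
    note cy = E.closed(2)[OF y] and cz = E.closed(2)[OF z]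
    show "adm_scalar k' (\<gamma>' a y z)" unfolding \<gamma>'_def by (intro scalar choice(4) cy cz)
    show "\<gamma>' (vac D') y z = 1" by (simp add: \<gamma>'_def vac_eq choice(5)[OF cy cz] \<sigma>_simps)
    fix b c assume "Nfus D' a b c \<noteq> 0"
    then have N: "Nfus D a b c \<noteq> 0" by (simp add: Nfus_eq)
    let ?p = "perm_inv (perm_of (\<chi> y))" and ?n = "Nfus D a b c"
    have inv: "Nfus D (?p a) (?p b) (?p c) = ?n" by (rule D.perm_of_props(2)[OF cy])
    have m1: "minv (snd (s (\<chi> y)) a b c) \<in> carrier_mat ?n ?n"
      by (rule minv[OF mats(1,2)[OF cy]])
    have m2: "minv (snd (s (\<chi> z)) (?p a) (?p b) (?p c)) \<in> carrier_mat ?n ?n"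
      using minv(1)[OF mats(1,2)[OF cz, of "?p a" "?p b" "?p c"]] by (simp add: inv)
    have m3: "snd (s (\<chi> y \<otimes>\<^bsub>?Z\<^esub> \<chi> z)) a b c \<in> carrier_mat ?n ?n"
      by (rule mats(1)[OF E.G.m_closed[OF cy cz]])
    have "(\<gamma>' a y z * \<gamma>' b y z / \<gamma>' c y z) \<cdot>\<^sub>m 1\<^sub>m ?n =
      map_mat \<sigma> ((\<gamma> a (\<chi> y) (\<chi> z) * \<gamma> b (\<chi> y) (\<chi> z) / \<gamma> c (\<chi> y) (\<chi> z)) \<cdot>\<^sub>m 1\<^sub>m ?n)"
      by (simp add: \<gamma>'_def map_mat_\<sigma> \<sigma>_simps)
    also have "\<dots> = map_mat \<sigma> (minv (snd (s (\<chi> y)) a b c)) *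
        map_mat \<sigma> (minv (snd (s (\<chi> z)) (?p a) (?p b) (?p c))) *
        map_mat \<sigma> (snd (s (\<chi> y \<otimes>\<^bsub>?Z\<^esub> \<chi> z)) a b c)"
      unfolding choice(8)[OF cy cz N] map_mat_\<sigma>(1)[OF mult_carrier_mat[OF m1 m2] m3] map_mat_\<sigma>(1)[OF m1 m2] ..
    also have "\<dots> = minv (snd (s' y) a b c) *
        minv (snd (s' z) (perm_inv (perm_of y) a) (perm_inv (perm_of y) b) (perm_inv (perm_of y) c)) *
        snd (s' (y \<otimes>\<^bsub>?Z'\<^esub> z)) a b c"
      by (simp add: snd_s' map_mat_minv(1)[OF \<sigma> mats(1,2)[OF cy]] map_mat_minv(1)[OF \<sigma> mats(1,2)[OF cz]]
          perm[OF y] E.mult_\<chi>[OF y z])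
    finally show "(\<gamma>' a y z * \<gamma>' b y z / \<gamma>' c y z) \<cdot>\<^sub>m 1\<^sub>m (Nfus D' a b c) = minv (snd (s' y) a b c) *
        minv (snd (s' z) (perm_inv (perm_of y) a) (perm_inv (perm_of y) b) (perm_inv (perm_of y) c)) *
        snd (s' (y \<otimes>\<^bsub>?Z'\<^esub> z)) a b c" by (simp add: Nfus_eq)
  qed
  moreover have "Omega k' D' \<gamma>' a x y z =
      Smat D' a (transport ?Z' \<chi> \<beta> (x, y, z)) * Smat D' (vac D') (vac D') /
           (Smat D' (vac D') (transport ?Z' \<chi> \<beta> (x, y, z)) * Smat D' (vac D') a)"
    if "x \<in> carrier ?Z'" "y \<in> carrier ?Z'" "z \<in> carrier ?Z'" for a x y z
  proof -
    \<comment> \<open>Both sides of the equation defining \<beta> are rational expressions in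
      \<gamma> and S, so \<sigma> carries the equation over with the same anyon as its
      solution.\<close>
    have "Omega k' D' \<gamma>' a x y z = \<sigma> (Omega k D \<gamma> a (\<chi> x) (\<chi> y) (\<chi> z))"
      using that by (simp add: Omega_def Let_def \<gamma>'_def perm E.mult_\<chi> \<sigma>_simps)
    also have "\<dots> = \<sigma> (Smat D a (\<beta> (\<chi> x, \<chi> y, \<chi> z)) * Smat D (vac D) (vac D) /
           (Smat D (vac D) (\<beta> (\<chi> x, \<chi> y, \<chi> z)) * Smat D (vac D) a))"
      using that by (simp add: \<Omega> E.closed)
    finally show ?thesis
      using that by (simp add: transport_def Smat_eq vac_eq \<sigma>_simps)
  qed
  moreover have "transport ?Z' \<chi> \<beta> \<in> cocycles3 ?Z' (one_form D') (sym_action D')"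
    unfolding one_form_eq
    by (rule E.transport_cocycle[OF _ \<beta>]) (simp add: sym_action_def perm one_form_eq)
  ultimately show "postnikov_cocycle k' D' (transport ?Z' \<chi> \<beta>)"
    unfolding postnikov_cocycle_def Let_def by blast
qed

section \<open>Conjugation as an isomorphism of linear symmetry groups\<close>

lemma conjugate_sym_mult:
  assumes "m \<in> sym_maps Linear D" "m' \<in> sym_maps Linear D"
  shows "conjugate_sym \<sigma> (m \<otimes>\<^bsub>sym_monoid k D\<^esub> m') = conjugate_sym \<sigma> m \<otimes>\<^bsub>sym_monoid k' D'\<^esub> conjugate_sym \<sigma> m'"
proof -
  obtain g U h V where m: "m = (g, U)" "m' = (h, V)" by (cases m; cases m')
  then have g: "(g, U) \<in> sym_maps Linear D" and h: "(h, V) \<in> sym_maps Linear D" using assms by auto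
  have V: "V (perm_inv g a) (perm_inv g b) (perm_inv g c) \<in> carrier_mat (Nfus D a b c) (Nfus D a b c)" for a b c
    using D.sym_mapsD(3)[OF h, of "perm_inv g a" "perm_inv g b" "perm_inv g c"] by (simp add: D.sym_maps_inv[OF g])
  show ?thesis by (simp add: m map_mat_\<sigma>(1)[OF V D.sym_mapsD(3)[OF g]])
qed

text \<open>The nonzero scalars are permuted by \<sigma>, so the rescalings on the two sides match;
  phases are not permuted by a general \<sigma>.\<close>

lemma conjugate_coset:
  assumes "m \<in> sym_maps Linear D"
  shows "conjugate_sym \<sigma> ` D.coset Linear m = D'.coset Linear (conjugate_sym \<sigma> m)"
proof -
  obtain g U where m: "m = (g, U)" by (cases m)
  have gU: "(g, U) \<in> sym_maps Linear D" and gU': "(g, \<lambda>a b c. map_mat \<sigma> (U a b c)) \<in> sym_maps Linear D'"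
    using assms conjugate_sym_maps[OF assms] by (simp_all add: m)
  have eq: "conjugate_sym \<sigma> (g, rescale \<gamma> U) = (g, rescale (\<sigma> \<circ> \<gamma>) (\<lambda>a b c. map_mat \<sigma> (U a b c)))" for \<gamma>
    by (simp add: rescale_def map_mat_\<sigma> \<sigma>_simps fun_eq_iff)
  show ?thesis
  proof
    show "conjugate_sym \<sigma> ` D.coset Linear m \<subseteq> D'.coset Linear (conjugate_sym \<sigma> m)"
    proof (rule image_subsetI)
      fix m' assume "m' \<in> D.coset Linear m"
      then obtain \<gamma> where \<gamma>: "m' = (g, rescale \<gamma> U)" "\<And>a. \<gamma> a \<noteq> 0"
        unfolding m D.coset_eq[OF gU] by auto
      have "(\<sigma> \<circ> \<gamma>) a \<noteq> 0" for a using \<gamma>(2) \<sigma>_simps(9) by simp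
      then show "conjugate_sym \<sigma> m' \<in> D'.coset Linear (conjugate_sym \<sigma> m)"
        unfolding m \<gamma>(1) eq unfolding conjugate_sym_simp D'.coset_eq[OF gU'] by auto
    qed
    show "D'.coset Linear (conjugate_sym \<sigma> m) \<subseteq> conjugate_sym \<sigma> ` D.coset Linear m"
    proof
      fix m' assume "m' \<in> D'.coset Linear (conjugate_sym \<sigma> m)"
      then obtain \<gamma> where \<gamma>: "m' = (g, rescale \<gamma> (\<lambda>a b c. map_mat \<sigma> (U a b c)))" "\<And>a. \<gamma> a \<noteq> 0"
        unfolding m conjugate_sym_simp D'.coset_eq[OF gU'] by auto
      have "\<sigma> \<circ> (perm_inv \<sigma> \<circ> \<gamma>) = \<gamma>" using \<sigma>_simps(1) by (simp add: fun_eq_iff bij_is_surj surj_f_inv_f)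
      then have "m' = conjugate_sym \<sigma> (g, rescale (perm_inv \<sigma> \<circ> \<gamma>) U)" unfolding eq \<gamma>(1) by simp
      moreover have "(perm_inv \<sigma> \<circ> \<gamma>) a \<noteq> 0" for a
        using \<gamma>(2) ring_automorphismD(9)[OF ring_automorphism_inverse[OF \<sigma>]] by simp
      then have "(g, rescale (perm_inv \<sigma> \<circ> \<gamma>) U) \<in> D.coset Linear m"
        unfolding m D.coset_eq[OF gU] by auto
      ultimately show "m' \<in> conjugate_sym \<sigma> ` D.coset Linear m" by (rule image_eqI)
    qed
  qed
qed

lemma conjugate_hom: "(`) (conjugate_sym \<sigma>) \<in> hom (zero_form Linear D) (zero_form Linear D')"
proof (rule homI)
  interpret G: group "sym_monoid Linear D" by (rule D.group_sym_monoid)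
  fix x assume x: "x \<in> carrier (zero_form Linear D)"
  then obtain m where m: "m \<in> sym_maps Linear D" "x = D.coset Linear m" unfolding D.carrier_zero_form by blast
  then show "conjugate_sym \<sigma> ` x \<in> carrier (zero_form Linear D')"
    unfolding D'.carrier_zero_form using conjugate_coset conjugate_sym_maps by simp
  fix y assume "y \<in> carrier (zero_form Linear D)"
  then obtain m' where m': "m' \<in> sym_maps Linear D" "y = D.coset Linear m'" unfolding D.carrier_zero_form by blast
  have "m \<otimes>\<^bsub>sym_monoid Linear D\<^esub> m' \<in> sym_maps Linear D" using G.m_closed[of m m'] m(1) m'(1) by simp
  then show "conjugate_sym \<sigma> ` (x \<otimes>\<^bsub>zero_form Linear D\<^esub> y) =
     conjugate_sym \<sigma> ` x \<otimes>\<^bsub>zero_form Linear D'\<^esub> conjugate_sym \<sigma> ` y"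
    using m m' by (simp only: D.coset_mult D'.coset_mult conjugate_coset conjugate_sym_maps
        conjugate_sym_mult[of m m' Linear Linear])
qed

lemma conjugate_sym_inverse: "conjugate_sym (perm_inv \<sigma>) (conjugate_sym \<sigma> m) = m"
proof -
  have "map_mat (perm_inv \<sigma>) (map_mat \<sigma> A) = A" for A
    using \<sigma>_simps(1) by (intro eq_matI) (auto simp: bij_is_inj inv_f_f)
  then show ?thesis by (cases m) simp
qed

end

lemma (in conjugate_data) linear_postnikov_equivalence:
  "postnikov_equivalence Linear D Linear D' ((`) (conjugate_sym \<sigma>)) ((`) (conjugate_sym (perm_inv \<sigma>)))"
proof -
  interpret inverse: conjugate_data D' D "perm_inv \<sigma>" by (rule conjugate_data_inverse)
  have inv: "perm_inv (perm_inv \<sigma>) = \<sigma>" using \<sigma>_simps(1) by (rule inv_inv_eq)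
  have id: "conjugate_sym (perm_inv \<sigma>) ` conjugate_sym \<sigma> ` x = x" "conjugate_sym \<sigma> ` conjugate_sym (perm_inv \<sigma>) ` x = x" for x :: "'a sym set"
    by (simp_all add: image_image conjugate_sym_inverse inverse.conjugate_sym_inverse[unfolded inv])
  have equiv: "group_equivalence (zero_form Linear D) (zero_form Linear D')
      ((`) (conjugate_sym \<sigma>)) ((`) (conjugate_sym (perm_inv \<sigma>)))"
    by (intro group_equivalence.intro group_equivalence_axioms.intro D.group_zero_form D'.group_zero_form
        conjugate_hom inverse.conjugate_hom id)
  note swap = group_equivalence.swap[OF equiv]
  have mem: "conjugate_sym \<sigma> m \<in> y" if "m \<in> conjugate_sym (perm_inv \<sigma>) ` y" for m and y :: "'a sym set"
    using that id(2)[of y] by blast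
  have mem': "conjugate_sym (perm_inv \<sigma>) m \<in> y" if "m \<in> conjugate_sym \<sigma> ` y" for m and y :: "'a sym set"
    using that id(1)[of y] by blast
  have scalar: "adm_scalar Linear (\<sigma> z)" "adm_scalar Linear (perm_inv \<sigma> z)" if "adm_scalar Linear z" for z
    using that \<sigma>_simps(9) inverse.\<sigma>_simps(9) by simp_all
  show ?thesis
    unfolding postnikov_equivalence_def
    using equiv one_form_eq postnikov_cocycle_transport[OF equiv scalar(1) mem]
      inverse.postnikov_cocycle_transport(2)[OF swap scalar(2) mem'] by blast
qed

section \<open>Linear and unitary symmetries\<close>

context skeletal_data
begin

text \<open>The dual of a fused with a contains the unit, so the dual of a fused with a and b
  contains b. By associativity the product of a and b cannot be empty.\<close>

lemma fusion_channel_exists: "\<exists>c. Nfus D a b c \<noteq> 0"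
proof -
  have "0 < Nfus D (dual D a) a (vac D) * Nfus D (vac D) b b"
    by (simp add: dual Nfus_vac_left)
  also have "\<dots> \<le> (\<Sum>e\<in>UNIV. Nfus D (dual D a) a e * Nfus D e b b)"
    by (rule member_le_sum) auto
  also have "\<dots> = (\<Sum>f\<in>UNIV. Nfus D a b f * Nfus D (dual D a) f b)" by (rule Nfus_assoc)
  finally show ?thesis by (metis (no_types, lifting) mult_zero_left sum.neutral less_irrefl)
qed

text \<open>A positive grading of the fusion rules by the multiplicative reals takes its maximum \<open>M\<close> with
  \<open>M\<^sup>2 \<le> M\<close> and its minimum \<open>m\<close> with \<open>m\<^sup>2 \<ge> m\<close>.\<close>

lemma positive_grading_trivial:
  fixes f :: "'a \<Rightarrow> real"
  assumes pos: "\<And>a. f a > 0" and mult: "\<And>a b c. Nfus D a b c \<noteq> 0 \<Longrightarrow> f a * f b = f c"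
  shows "f a = 1"
proof -
  have sq: "\<exists>c. f c = f a * f a" for a using fusion_channel_exists[of a a] mult by metis
  have fin: "finite (range f)" "range f \<noteq> {}" by auto
  obtain b where b: "f b = Max (range f)" using Max_in[OF fin] by (metis imageE)
  have "f b * f b \<le> f b" using sq[of b] b Max_ge[OF fin(1)] by (metis rangeI)
  then have "f b \<le> 1" using pos[of b] by simp
  obtain c where c: "f c = Min (range f)" using Min_in[OF fin] by (metis imageE)
  have "f c \<le> f c * f c" using sq[of c] c Min_le[OF fin(1)] by (metis rangeI)
  then have "1 \<le> f c" using pos[of c] by simp
  moreover have "f c \<le> f a" "f a \<le> f b" using b c fin(1) by simp_all
  ultimately show ?thesis using \<open>f b \<le> 1\<close> by simp
qed

text \<open>Invariance of the multiplicities under g turns fusion of the image of the unit with the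
  unit into fusion of the unit with an anyon, whose multiplicity is 1; the unit rules then leave
  only the unit as image.\<close>

lemma perm_vac:
  assumes "(g, U) \<in> sym_maps k D"
  shows "g (vac D) = vac D"
proof -
  have "Nfus D (g (vac D)) (vac D) (vac D) = Nfus D (vac D) (perm_inv g (vac D)) (perm_inv g (vac D))"
    using sym_mapsD(2)[OF assms, of "vac D" "perm_inv g (vac D)" "perm_inv g (vac D)"]
    by (simp add: sym_maps_inv[OF assms])
  then show ?thesis by (simp add: Nfus_vac_left Nfus_vac_right split: if_splits)
qed

text \<open>By the triangle axiom an F-preserving map acts on all unit spaces \<open>V\<^sub>a\<^sub>1\<^sup>a\<close> and \<open>V\<^sub>1\<^sub>a\<^sup>a\<close> through one
  and the same scalar, which a constant \<open>\<gamma>\<close> removes.\<close>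

lemma unit_space_entries:
  assumes "(g, U) \<in> sym_maps k D" "Nfus D a c d \<noteq> 0"
  shows "U a (vac D) a $$ (0, 0) = U (vac D) c c $$ (0, 0)"
proof -
  let ?a = "perm_inv g a" and ?c = "perm_inv g c" and ?d = "perm_inv g d"
  let ?n = "Nfus D a c d"
  note N = sym_maps_inv[OF assms(1)]
  note car = sym_mapsD(3)[OF assms(1)] sym_maps_minv[OF assms(1)]
  have vac: "g (vac D) = vac D" by (rule perm_vac[OF assms(1)])
  have n: "Nfus D ?a ?c ?d = ?n" by (rule N)
  have T: "Fsym D a (vac D) c d (a, 0, \<beta>) (c, 0, \<nu>) = (if \<beta> = \<nu> then 1 else 0)"
    if "\<beta> < Nfus D a c d" "\<nu> < Nfus D a c d" for a c d \<beta> \<nu>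
    using triangle that unfolding triangle_def by blast
  have "recouple 1 ?n 1 ?n (U a (vac D) a) (U a c d) (minv (U (vac D) c c)) (minv (U a c d))
      (\<lambda>\<alpha>' \<beta>' \<mu>' \<nu>'. Fsym D a (vac D) c d (a, \<alpha>', \<beta>') (c, \<mu>', \<nu>')) 0 0 0 0 = 1"
    using sym_mapsD(6)[OF assms(1), of 0 ?a "vac D" ?a 0 ?c ?d 0 ?c 0] assms(2) T[of 0 ?a ?c ?d 0]
    by (simp add: n N vac Nfus_vac_left Nfus_vac_right)
  moreover have "recouple 1 ?n 1 ?n (U a (vac D) a) (U a c d) (minv (U (vac D) c c)) (minv (U a c d))
      (\<lambda>\<alpha>' \<beta>' \<mu>' \<nu>'. Fsym D a (vac D) c d (a, \<alpha>', \<beta>') (c, \<mu>', \<nu>')) 0 0 0 0 =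
      (\<Sum>\<beta><?n. \<Sum>\<nu><?n. U a (vac D) a $$ (0, 0) * U a c d $$ (0, \<beta>) * (if \<beta> = \<nu> then 1 else 0) *
        minv (U (vac D) c c) $$ (0, 0) * minv (U a c d) $$ (\<nu>, 0))"
    unfolding recouple_def by (simp add: T)
  moreover have "\<dots> = (\<Sum>\<beta><?n. U a (vac D) a $$ (0, 0) * minv (U (vac D) c c) $$ (0, 0) *
      (U a c d $$ (0, \<beta>) * minv (U a c d) $$ (\<beta>, 0)))"
    by (intro sum.cong refl) (simp add: mult_delta_left mult_delta_right ac_simps)
  moreover have "\<dots> = U a (vac D) a $$ (0, 0) * minv (U (vac D) c c) $$ (0, 0) * (U a c d * minv (U a c d)) $$ (0, 0)"
    using assms(2) car(1)[of a c d] car(3)[of a c d]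
    by (simp add: sum_distrib_left[symmetric] scalar_prod_def atLeast0LessThan)
  moreover have "\<dots> = U a (vac D) a $$ (0, 0) * minv (U (vac D) c c) $$ (0, 0)"
    using assms(2) by (simp add: car)
  ultimately have *: "U a (vac D) a $$ (0, 0) * minv (U (vac D) c c) $$ (0, 0) = 1" by simp
  have c: "U (vac D) c c \<in> carrier_mat 1 1" "minv (U (vac D) c c) \<in> carrier_mat 1 1"
    using car(1)[of "vac D" c c] car(3)[of "vac D" c c] by (simp_all add: Nfus_vac_left)
  have "(U (vac D) c c * minv (U (vac D) c c)) $$ (0, 0) = 1"
    by (simp add: car Nfus_vac_left)
  then have "U (vac D) c c $$ (0, 0) * minv (U (vac D) c c) $$ (0, 0) = 1"
    using c by (simp add: scalar_prod_def)
  with * show ?thesis by (metis mult_cancel_right mult_zero_right zero_neq_one)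
qed

text \<open>Taking the unit for one of the two anyons in \<open>unit_space_entries\<close> ties
  every unit space to the one in which all three anyons are the unit. The other spaces with a unit
  argument have dimension 0.\<close>

lemma unit_space_scalar:
  assumes "(g, U) \<in> sym_maps k D"
  obtains u where "adm_scalar k u" "\<And>b c. U (vac D) b c = u \<cdot>\<^sub>m 1\<^sub>m (Nfus D (vac D) b c)"
    "\<And>b c. U b (vac D) c = u \<cdot>\<^sub>m 1\<^sub>m (Nfus D b (vac D) c)"
proof -
  define u where "u = U (vac D) (vac D) (vac D) $$ (0, 0)"
  have entry: "U (vac D) b b $$ (0, 0) = u" "U b (vac D) b $$ (0, 0) = u" for b
    using unit_space_entries[OF assms, of "vac D" b b] unit_space_entries[OF assms, of b "vac D" b]
    by (simp_all add: u_def Nfus_vac_left Nfus_vac_right)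
  have *: "U (vac D) b c = u \<cdot>\<^sub>m 1\<^sub>m (Nfus D (vac D) b c)" "U b (vac D) c = u \<cdot>\<^sub>m 1\<^sub>m (Nfus D b (vac D) c)" for b c
    using sym_mapsD(3)[OF assms, of "vac D" b c] sym_mapsD(3)[OF assms, of b "vac D" c] entry[of b]
    by (auto intro!: eq_matI simp: Nfus_vac_left Nfus_vac_right split: if_splits)
  have 1: "u \<cdot>\<^sub>m 1\<^sub>m 1 = U (vac D) (vac D) (vac D)" using *(1)[of "vac D" "vac D"] by (simp add: Nfus_vac_left)
  have "adm_scalar k u"
  proof (cases k)
    case Unitary
    have "unitary_mat (u \<cdot>\<^sub>m 1\<^sub>m 1)" using sym_mapsD(4)[OF assms] Unitary unfolding 1 by simp
    then show ?thesis using Unitary by (simp add: unitary_smult_one)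
  next
    case Linear
    have "U (vac D) (vac D) (vac D) * minv (U (vac D) (vac D) (vac D)) = 1\<^sub>m 1"
      using sym_maps_minv(3)[OF assms] by (simp add: Nfus_vac_left)
    moreover have "minv (U (vac D) (vac D) (vac D)) \<in> carrier_mat 1 1"
      using sym_maps_minv(2)[OF assms, of "vac D" "vac D" "vac D"] by (simp add: Nfus_vac_left)
    ultimately have "(u \<cdot>\<^sub>m minv (U (vac D) (vac D) (vac D))) $$ (0, 0) = 1"
      by (metis 1 smult_one_mult(3) index_one_mat(1) less_numeral_extra(1))
    then have "u \<noteq> 0" using \<open>minv _ \<in> _\<close> by auto
    then show ?thesis using Linear by simp
  qed
  then show thesis using that * by blast
qed

lemma rescale_sym_maps:
  assumes "x \<in> carrier (zero_form k D)" "(g, U) \<in> x" "\<And>a. adm_scalar k (\<gamma> a)"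
  shows "(g, rescale \<gamma> U) \<in> x"
  using zero_form_mem[OF assms(1,2)] coset_eq[of g U k k] assms(3) by auto

lemma normalised_representative:
  assumes "x \<in> carrier (zero_form k D)"
  shows "\<exists>m\<in>x. normalised_sym D m"
proof -
  obtain g U where m: "(g, U) \<in> x" using zero_form_nonempty[OF assms] by auto
  obtain u where u: "adm_scalar k u" "\<And>b c. U (vac D) b c = u \<cdot>\<^sub>m 1\<^sub>m (Nfus D (vac D) b c)"
    "\<And>b c. U b (vac D) c = u \<cdot>\<^sub>m 1\<^sub>m (Nfus D b (vac D) c)"
    using unit_space_scalar[OF zero_form_mem(1)[OF assms m]] by blast
  have "u \<noteq> 0" using adm_scalar_nonzero u(1) by blast
  then have "normalised_sym D (g, rescale (\<lambda>_. inverse u) U)"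
    by (simp add: normalised_sym_def rescale_def u(2,3) smult_smult_mat)
  then show ?thesis using rescale_sym_maps[OF assms m adm_scalar_inverse[OF u(1)]] by blast
qed

section \<open>Unitary members of linear classes\<close>

lemma unitary_sym_maps_linear: "sym_maps Unitary D \<subseteq> sym_maps Linear D"
proof (rule subrelI)
  fix g U assume "(g, U) \<in> sym_maps Unitary D"
  then show "(g, U) \<in> sym_maps Linear D"
    using sym_maps_minv(1)[of g U Unitary] by (simp add: sym_maps_def)
qed

text \<open>The rescaled matrix times the inverse of the original is a unitary scalar matrix. On a
  nonzero fusion space its scalar has modulus 1, so the absolute values of \<gamma> form a positive
  grading.\<close>

lemma unimodular_rescale:
  assumes "(g, U) \<in> sym_maps Unitary D" "(g, rescale \<gamma> U) \<in> sym_maps Unitary D" "\<And>a. \<gamma> a \<noteq> 0"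
  shows "cmod (\<gamma> a) = 1"
proof (rule positive_grading_trivial)
  show "0 < cmod (\<gamma> a)" for a using assms(3) by simp
  fix a b c assume N: "Nfus D a b c \<noteq> 0"
  let ?z = "\<gamma> a * \<gamma> b / \<gamma> c"
  note car = sym_mapsD(3)[OF assms(1), of a b c] sym_maps_minv[OF assms(1), of a b c]
  have "unitary_mat (rescale \<gamma> U a b c * minv (U a b c))"
    using adm_mat_mult[of "rescale \<gamma> U a b c" "Nfus D a b c" Unitary "minv (U a b c)"]
      sym_mapsD(3,4)[OF assms(2), of a b c] adm_mat_minv[OF car(1) sym_mapsD(4)[OF assms(1)]] car(3) by simp
  also have "rescale \<gamma> U a b c * minv (U a b c) = ?z \<cdot>\<^sub>m 1\<^sub>m (Nfus D a b c)"
    unfolding rescale_def using car by (subst mult_smult_assoc_mat[of _ "Nfus D a b c" "Nfus D a b c" _ "Nfus D a b c"]) auto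
  finally have "cmod ?z = 1" using N by (simp add: unitary_smult_one)
  then show "cmod (\<gamma> a) * cmod (\<gamma> b) = cmod (\<gamma> c)"
    using assms(3)[of c] by (simp add: norm_mult norm_divide divide_eq_eq)
qed

text \<open>The union avoids choosing a representative: all members of x generate the same linear
  coset.\<close>

definition to_linear :: "'a sym set \<Rightarrow> 'a sym set" where
  "to_linear x = \<Union>(coset Linear ` x)"

definition to_unitary :: "'a sym set \<Rightarrow> 'a sym set" where
  "to_unitary y = y \<inter> sym_maps Unitary D"

lemma to_linear_coset:
  assumes "x \<in> carrier (zero_form Unitary D)" "m \<in> x"
  shows "to_linear x = coset Linear m"
proof -
  interpret G: group "sym_monoid Linear D" by (rule group_sym_monoid)
  have "coset Linear m' = coset Linear m" if m': "m' \<in> x" for m'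
  proof -
    obtain g U where m: "m = (g, U)" by (cases m)
    have gU: "(g, U) \<in> sym_maps Linear D" using zero_form_mem(1)[OF assms] unitary_sym_maps_linear m by blast
    obtain \<gamma> where \<gamma>: "\<And>a. adm_scalar Unitary (\<gamma> a)" "m' = (fst m, rescale \<gamma> (snd m))"
      using zero_form_rescale[OF assms m'] by blast
    have "\<gamma> a \<noteq> 0" for a using \<gamma>(1) adm_scalar_nonzero by blast
    then have "m' \<in> coset Linear m" using \<gamma>(2) m coset_eq[OF gU, of Linear] by auto
    then show ?thesis
      using G.repr_independence[of m' "nat_isos Linear D" m] gU m nat_isos_subgroup by auto
  qed
  then show ?thesis unfolding to_linear_def using assms(2) by blast
qed

text \<open>This makes \<open>to_linear\<close> injective: unitary maps in one linear class differ
  by a rescaling, whose scalars are phases by \<open>unimodular_rescale\<close>.\<close>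

lemma to_unitary_coset:
  assumes "m \<in> sym_maps Unitary D"
  shows "to_unitary (coset Linear m) = coset Unitary m"
proof -
  obtain g U where m: "m = (g, U)" by (cases m)
  have gU: "(g, U) \<in> sym_maps Unitary D" using assms m by simp
  show ?thesis
  proof
    show "to_unitary (coset Linear m) \<subseteq> coset Unitary m"
    proof
      fix m' assume "m' \<in> to_unitary (coset Linear m)"
      then obtain \<gamma> where \<gamma>: "m' = (g, rescale \<gamma> U)" "\<And>a. \<gamma> a \<noteq> 0" "m' \<in> sym_maps Unitary D"
        unfolding to_unitary_def m coset_eq[OF gU] by auto
      then have "cmod (\<gamma> a) = 1" for a using unimodular_rescale[OF gU] by blast
      then show "m' \<in> coset Unitary m" unfolding m coset_eq[OF gU] \<gamma>(1) by auto
    qed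
    show "coset Unitary m \<subseteq> to_unitary (coset Linear m)"
    proof
      fix m' assume m': "m' \<in> coset Unitary m"
      then obtain \<gamma> where \<gamma>: "m' = (g, rescale \<gamma> U)" "\<And>a. cmod (\<gamma> a) = 1"
        unfolding m coset_eq[OF gU] by auto
      have "\<gamma> a \<noteq> 0" for a using \<gamma>(2)[of a] by auto
      then have "m' \<in> coset Linear m" unfolding m coset_eq[OF gU] \<gamma>(1) by auto
      moreover have "m' \<in> sym_maps Unitary D"
        by (rule zero_form_mem(1)[OF _ m']) (use assms carrier_zero_form in blast)
      ultimately show "m' \<in> to_unitary (coset Linear m)" by (simp add: to_unitary_def)
    qed
  qed
qed

end

section \<open>Comparison of the unitary and linear 2-groups\<close>

context skeletal_data
begin

lemma to_linear_hom: "to_linear \<in> hom (zero_form Unitary D) (zero_form Linear D)"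
proof (rule homI)
  interpret G: group "sym_monoid Unitary D" by (rule group_sym_monoid)
  fix x assume x: "x \<in> carrier (zero_form Unitary D)"
  then obtain m where m: "m \<in> sym_maps Unitary D" "x = coset Unitary m" unfolding carrier_zero_form by blast
  have mx: "to_linear x = coset Linear m" using to_linear_coset[OF x] m zero_form_mem_self by blast
  then show "to_linear x \<in> carrier (zero_form Linear D)"
    unfolding carrier_zero_form using m unitary_sym_maps_linear by blast
  fix y assume y: "y \<in> carrier (zero_form Unitary D)"
  then obtain m' where m': "m' \<in> sym_maps Unitary D" "y = coset Unitary m'" unfolding carrier_zero_form by blast
  have my: "to_linear y = coset Linear m'" using to_linear_coset[OF y] m' zero_form_mem_self by blast
  have mm: "m \<otimes>\<^bsub>sym_monoid Unitary D\<^esub> m' \<in> sym_maps Unitary D" using G.m_closed[of m m'] m(1) m'(1) by simp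
  have xy: "x \<otimes>\<^bsub>zero_form Unitary D\<^esub> y = coset Unitary (m \<otimes>\<^bsub>sym_monoid Unitary D\<^esub> m')"
    using coset_mult m m' by simp
  have "to_linear (x \<otimes>\<^bsub>zero_form Unitary D\<^esub> y) = coset Linear (m \<otimes>\<^bsub>sym_monoid Unitary D\<^esub> m')"
    unfolding xy by (rule to_linear_coset) (use mm zero_form_mem_self carrier_zero_form in blast)+
  also have "m \<otimes>\<^bsub>sym_monoid Unitary D\<^esub> m' = m \<otimes>\<^bsub>sym_monoid Linear D\<^esub> m'" by (cases m; cases m') simp
  finally show "to_linear (x \<otimes>\<^bsub>zero_form Unitary D\<^esub> y) = to_linear x \<otimes>\<^bsub>zero_form Linear D\<^esub> to_linear y"
    using m(1) m'(1) unitary_sym_maps_linear unfolding mx my by (subst coset_mult) auto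
qed

text \<open>The gauge condition puts a unitary map into every linear class, which is surjectivity of
  \<open>to_linear\<close>. The homomorphism property of \<open>to_unitary\<close> is then inherited
  from its inverse.\<close>

lemma group_equivalence_unitary_linear:
  assumes gauge: "unitary_gauge D"
  shows "group_equivalence (zero_form Unitary D) (zero_form Linear D) to_linear to_unitary"
proof (intro group_equivalence.intro group_equivalence_axioms.intro group_zero_form to_linear_hom)
  have rep: "\<exists>m\<in>sym_maps Unitary D. y = coset Linear m" if "y \<in> carrier (zero_form Linear D)" for y
    using gauge that zero_form_mem(2)[OF that] unfolding unitary_gauge_def by blast
  show inv: "to_unitary (to_linear x) = x" if x: "x \<in> carrier (zero_form Unitary D)" for x
  proof -
    obtain m where m: "m \<in> sym_maps Unitary D" "x = coset Unitary m" using x unfolding carrier_zero_form by blast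
    then show ?thesis using to_linear_coset[OF x, of m] zero_form_mem_self to_unitary_coset by simp
  qed
  have img: "\<exists>x\<in>carrier (zero_form Unitary D). y = to_linear x" if y: "y \<in> carrier (zero_form Linear D)" for y
  proof -
    obtain m where m: "m \<in> sym_maps Unitary D" "y = coset Linear m" using rep[OF y] by blast
    then have "coset Unitary m \<in> carrier (zero_form Unitary D)" using carrier_zero_form by blast
    then show ?thesis using to_linear_coset[of "coset Unitary m" m] m zero_form_mem_self by blast
  qed
  show "to_linear (to_unitary y) = y" if "y \<in> carrier (zero_form Linear D)" for y
    using img[OF that] inv by auto
  interpret U: group "zero_form Unitary D" by (rule group_zero_form)
  show "to_unitary \<in> hom (zero_form Linear D) (zero_form Unitary D)"
  proof (rule homI)
    fix y assume y: "y \<in> carrier (zero_form Linear D)"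
    obtain x where x: "x \<in> carrier (zero_form Unitary D)" "y = to_linear x" using img[OF y] by blast
    then show "to_unitary y \<in> carrier (zero_form Unitary D)" using inv by simp
    fix y' assume y': "y' \<in> carrier (zero_form Linear D)"
    obtain x' where x': "x' \<in> carrier (zero_form Unitary D)" "y' = to_linear x'" using img[OF y'] by blast
    have "y \<otimes>\<^bsub>zero_form Linear D\<^esub> y' = to_linear (x \<otimes>\<^bsub>zero_form Unitary D\<^esub> x')"
      using hom_mult[OF to_linear_hom x(1) x'(1)] x x' by simp
    then show "to_unitary (y \<otimes>\<^bsub>zero_form Linear D\<^esub> y') = to_unitary y \<otimes>\<^bsub>zero_form Unitary D\<^esub> to_unitary y'"
      using inv x x' U.m_closed by simp
  qed
qed

text \<open>A choice of linear representatives \<open>s\<close> is replaced by normalised unitary ones, \<open>s\<^sub>U = \<lambda> s\<close>. This changes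
  \<open>\<gamma>\<close> by the twisted coboundary of \<open>\<lambda>\<close>, so \<open>\<Omega>\<close> stays the same. The new \<open>\<gamma>\<close> consists of phases
  because its absolute values grade the fusion rules.\<close>

lemma postnikov_cocycle_unitary:
  assumes gauge: "unitary_gauge D" and P: "postnikov_cocycle Linear D \<beta>"
  shows "postnikov_cocycle Unitary D (transport (zero_form Unitary D) to_linear \<beta>)"
proof -
  let ?Z = "zero_form Unitary D" and ?L = "zero_form Linear D"
  interpret E: group_equivalence ?Z ?L to_linear to_unitary
    by (rule group_equivalence_unitary_linear[OF gauge])
  interpret E': group_equivalence ?L ?Z to_unitary to_linear by (rule E.swap)
  obtain s \<gamma> where \<beta>: "\<beta> \<in> cocycles3 ?L (one_form D) (sym_action D)"
    and s: "symmetry_choice Linear D s \<gamma>"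
    and \<Omega>: "\<And>g h l a. g \<in> carrier ?L \<Longrightarrow> h \<in> carrier ?L \<Longrightarrow> l \<in> carrier ?L \<Longrightarrow>
       Omega Linear D \<gamma> a g h l = Smat D a (\<beta> (g, h, l)) * Smat D (vac D) (vac D) /
           (Smat D (vac D) (\<beta> (g, h, l)) * Smat D (vac D) a)"
    using P unfolding postnikov_cocycle_def Let_def by blast
  note choice = symmetry_choiceD[OF s] and mats = symmetry_choice_mats[OF s]
  have sub: "x \<subseteq> to_linear x" if x: "x \<in> carrier ?Z" for x
  proof
    fix m assume m: "m \<in> x"
    have "m \<in> coset Linear m" using zero_form_mem(1)[OF x m] unitary_sym_maps_linear zero_form_mem_self by blast
    then show "m \<in> to_linear x" using to_linear_coset[OF x m] by simp
  qed
  have perm: "perm_of (to_linear x) = perm_of x" if x: "x \<in> carrier ?Z" for x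
  proof -
    obtain m where m: "m \<in> x" using zero_form_nonempty[OF x] by blast
    then show ?thesis
      using zero_form_mem(3)[OF x m] zero_form_mem(3)[OF E.closed(1)[OF x], of m] sub[OF x] by auto
  qed
  \<comment> \<open>Every class has a normalised member, but on the trivial class the choice must
    return the identity map itself, so that class is treated apart.\<close>
  have "\<exists>m. m \<in> x \<and> normalised_sym D m \<and> (x = \<one>\<^bsub>?Z\<^esub> \<longrightarrow> m = \<one>\<^bsub>sym_monoid Unitary D\<^esub>)"
    if "x \<in> carrier ?Z" for x
  proof (cases "x = \<one>\<^bsub>?Z\<^esub>")
    case True
    have "\<one>\<^bsub>sym_monoid Unitary D\<^esub> \<in> x"
      using True zero_form_one zero_form_mem_self[OF sym_maps_one] by simp
    moreover have "normalised_sym D \<one>\<^bsub>sym_monoid Unitary D\<^esub>" by (simp add: normalised_sym_def)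
    ultimately show ?thesis by blast
  next
    case False
    then show ?thesis using normalised_representative[OF that] by blast
  qed
  then obtain sU where sU: "\<And>x. x \<in> carrier ?Z \<Longrightarrow> sU x \<in> x" "\<And>x. x \<in> carrier ?Z \<Longrightarrow> normalised_sym D (sU x)"
    "sU \<one>\<^bsub>?Z\<^esub> = \<one>\<^bsub>sym_monoid Unitary D\<^esub>"
    using E.G.one_closed by metis
  have one: "to_linear \<one>\<^bsub>?Z\<^esub> = \<one>\<^bsub>?L\<^esub>" by (rule E'.\<chi>_one)
  \<comment> \<open>The scalars l are determined only up to gradings of the fusion rules. On the
    trivial class, where both representatives are the identity map, the constant 1 is picked
    explicitly; the normalisation of \<gamma>' at the identity depends on it.\<close>
  have "\<exists>l. (\<forall>a. l a \<noteq> 0) \<and> snd (sU x) = rescale l (snd (s (to_linear x))) \<and> l (vac D) = 1 \<and>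
      (x = \<one>\<^bsub>?Z\<^esub> \<longrightarrow> (\<forall>a. l a = 1))" if x: "x \<in> carrier ?Z" for x
  proof (cases "x = \<one>\<^bsub>?Z\<^esub>")
    case True
    have "snd (sU x) = snd (s (to_linear x))"
      using True sU(3) one choice(3)[OF E.G'.one_closed E.G'.one_closed] by simp
    then show ?thesis by (intro exI[of _ "\<lambda>_. 1"]) (simp add: rescale_def fun_eq_iff)
  next
    case False
    note lx = E.closed(1)[OF x]
    obtain l where l: "\<And>a. l a \<noteq> 0" "sU x = (fst (s (to_linear x)), rescale l (snd (s (to_linear x))))"
      using zero_form_rescale[OF lx choice(1)[OF lx lx], of "sU x"] sub[OF x] sU(1)[OF x] by auto
    have "snd (sU x) (vac D) (vac D) (vac D) = 1\<^sub>m 1" "snd (s (to_linear x)) (vac D) (vac D) (vac D) = 1\<^sub>m 1"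
      using sU(2)[OF x] choice(2)[OF lx lx] by (auto simp: normalised_sym_def split_def Nfus_vac_left)
    then have "l (vac D) \<cdot>\<^sub>m 1\<^sub>m 1 = (1\<^sub>m 1 :: complex mat)" by (simp add: l rescale_def)
    then have "(l (vac D) \<cdot>\<^sub>m 1\<^sub>m 1) $$ (0, 0) = (1\<^sub>m 1 :: complex mat) $$ (0, 0)" by (rule arg_cong)
    then have "l (vac D) = 1" by simp
    then show ?thesis using l False by auto
  qed
  then obtain l where l: "\<And>x a. x \<in> carrier ?Z \<Longrightarrow> l x a \<noteq> 0"
    "\<And>x. x \<in> carrier ?Z \<Longrightarrow> snd (sU x) = rescale (l x) (snd (s (to_linear x)))"
    "\<And>x. x \<in> carrier ?Z \<Longrightarrow> l x (vac D) = 1" "\<And>a. l \<one>\<^bsub>?Z\<^esub> a = 1"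
    using E.G.one_closed by metis
  \<comment> \<open>Obtained by inserting the rescaled representatives into the relation for
    \<gamma>. The factor of y is taken at a preimage because the matrix of y is evaluated at
    preimages under x.\<close>
  define \<gamma>' where "\<gamma>' a x y = \<gamma> a (to_linear x) (to_linear y) * l (x \<otimes>\<^bsub>?Z\<^esub> y) a /
    (l x a * l y (perm_inv (perm_of x) a))" for a x y
  have vac: "perm_inv (perm_of x) (vac D) = vac D" if x: "x \<in> carrier ?Z" for x
  proof -
    obtain m where m: "m \<in> x" using zero_form_nonempty[OF x] by blast
    then have "perm_of x (vac D) = vac D"
      using perm_vac[of "fst m" "snd m" Unitary] zero_form_mem[OF x m] by simp
    then show ?thesis using perm_of_props(1)[OF x] by (metis bij_inv_eq_iff)
  qed
  have rel: "(\<gamma>' a x y * \<gamma>' b x y / \<gamma>' c x y) \<cdot>\<^sub>m 1\<^sub>m (Nfus D a b c) = minv (snd (sU x) a b c) *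
        minv (snd (sU y) (perm_inv (perm_of x) a) (perm_inv (perm_of x) b) (perm_inv (perm_of x) c)) *
        snd (sU (x \<otimes>\<^bsub>?Z\<^esub> y)) a b c"
    if x: "x \<in> carrier ?Z" and y: "y \<in> carrier ?Z" and N: "Nfus D a b c \<noteq> 0" for a b c x y
  proof -
    let ?n = "Nfus D a b c" and ?p = "perm_inv (perm_of x)"
    note xy = E.G.m_closed[OF x y]
    note lx = E.closed(1)[OF x] and ly = E.closed(1)[OF y] and lxy = E.closed(1)[OF xy]
    have inv: "Nfus D (?p a) (?p b) (?p c) = ?n" by (rule perm_of_props(2)[OF x])
    let ?A = "snd (s (to_linear x)) a b c" and ?B = "snd (s (to_linear y)) (?p a) (?p b) (?p c)"
      and ?C = "snd (s (to_linear (x \<otimes>\<^bsub>?Z\<^esub> y))) a b c"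
    have A: "?A \<in> carrier_mat ?n ?n" "invertible_mat ?A" by (rule mats[OF lx])+
    have B: "?B \<in> carrier_mat ?n ?n" "invertible_mat ?B"
      using mats(1,2)[OF ly, of "?p a" "?p b" "?p c"] by (simp_all add: inv)
    have C: "?C \<in> carrier_mat ?n ?n" by (rule mats[OF lxy])
    note mA = minv(1)[OF A] and mB = minv(1)[OF B]
    define u v w where "u = l x a * l x b / l x c"
      and "v = l y (?p a) * l y (?p b) / l y (?p c)" and "w = l (x \<otimes>\<^bsub>?Z\<^esub> y) a * l (x \<otimes>\<^bsub>?Z\<^esub> y) b / l (x \<otimes>\<^bsub>?Z\<^esub> y) c"
    have nz: "u \<noteq> 0" "v \<noteq> 0" using l(1)[OF x] l(1)[OF y] by (simp_all add: u_def v_def)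
    have "minv (snd (sU x) a b c) * minv (snd (sU y) (?p a) (?p b) (?p c)) * snd (sU (x \<otimes>\<^bsub>?Z\<^esub> y)) a b c =
      (inverse u \<cdot>\<^sub>m minv ?A) * (inverse v \<cdot>\<^sub>m minv ?B) * (w \<cdot>\<^sub>m ?C)"
      unfolding l(2)[OF x] l(2)[OF y] l(2)[OF xy] rescale_def u_def[symmetric] v_def[symmetric] w_def[symmetric]
      using minv_smult(1)[OF A nz(1)] minv_smult(1)[OF B nz(2)] by simp
    also have "\<dots> = (inverse u * inverse v * w) \<cdot>\<^sub>m (minv ?A * minv ?B * ?C)"
    proof -
      have "(inverse u \<cdot>\<^sub>m minv ?A) * (inverse v \<cdot>\<^sub>m minv ?B) = (inverse u * inverse v) \<cdot>\<^sub>m (minv ?A * minv ?B)"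
        using mA mB by (simp add: mult_smult_distrib[of _ ?n ?n _ ?n] mult_smult_assoc_mat[of _ ?n ?n _ ?n]
            smult_smult_mat mult.commute)
      moreover have "minv ?A * minv ?B \<in> carrier_mat ?n ?n" using mA mB by simp
      ultimately show ?thesis
        using C by (simp add: mult_smult_distrib[of _ ?n ?n _ ?n] mult_smult_assoc_mat[of _ ?n ?n _ ?n]
            smult_smult_mat mult_ac)
    qed
    also have "minv ?A * minv ?B * ?C = (\<gamma> a (to_linear x) (to_linear y) * \<gamma> b (to_linear x) (to_linear y) /
        \<gamma> c (to_linear x) (to_linear y)) \<cdot>\<^sub>m 1\<^sub>m ?n"
      using choice(8)[OF lx ly N] by (simp add: perm[OF x] E'.mult_\<chi>[OF x y])
    also have "(inverse u * inverse v * w) \<cdot>\<^sub>m \<dots> = (\<gamma>' a x y * \<gamma>' b x y / \<gamma>' c x y) \<cdot>\<^sub>m 1\<^sub>m ?n"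
    proof -
      have "inverse u * inverse v * w * (\<gamma> a (to_linear x) (to_linear y) * \<gamma> b (to_linear x) (to_linear y) /
        \<gamma> c (to_linear x) (to_linear y)) = \<gamma>' a x y * \<gamma>' b x y / \<gamma>' c x y"
        using l(1)[OF x] l(1)[OF y] l(1)[OF xy] by (simp add: u_def v_def w_def \<gamma>'_def mult_ac)
      then show ?thesis by (simp add: smult_smult_mat)
    qed
    finally show ?thesis by simp
  qed
  have unimodular: "cmod (\<gamma>' a x y) = 1" if x: "x \<in> carrier ?Z" and y: "y \<in> carrier ?Z" for a x y
  proof (rule positive_grading_trivial)
    note xy = E.G.m_closed[OF x y]
    have nz: "\<gamma>' a x y \<noteq> 0" for a
      using l(1)[OF x] l(1)[OF y] l(1)[OF xy] adm_scalar_nonzero[OF choice(4)[OF E.closed(1)[OF x] E.closed(1)[OF y]]]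
      by (simp add: \<gamma>'_def)
    then show "0 < cmod (\<gamma>' a x y)" for a by simp
    fix a b c assume N: "Nfus D a b c \<noteq> 0"
    let ?p = "perm_inv (perm_of x)"
    have sym: "(fst (sU z), snd (sU z)) \<in> sym_maps Unitary D" if "z \<in> carrier ?Z" for z
      using zero_form_mem(1)[OF that sU(1)[OF that]] by simp
    note ux = sym_mapsD(3,4)[OF sym[OF x], of a b c] sym_maps_minv(2)[OF sym[OF x], of a b c]
    note uy = sym_mapsD(3,4)[OF sym[OF y], of "?p a" "?p b" "?p c"] sym_maps_minv(2)[OF sym[OF y], of "?p a" "?p b" "?p c"]
    note uxy = sym_mapsD(3,4)[OF sym[OF xy], of a b c]
    have inv: "Nfus D (?p a) (?p b) (?p c) = Nfus D a b c" by (rule perm_of_props(2)[OF x])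
    have "adm_mat Unitary (minv (snd (sU x) a b c) * minv (snd (sU y) (?p a) (?p b) (?p c)) * snd (sU (x \<otimes>\<^bsub>?Z\<^esub> y)) a b c)"
      using uy inv
      by (intro adm_mat_mult[of _ "Nfus D a b c"] adm_mat_minv[OF ux(1,2)] adm_mat_minv[OF uy(1,2)] ux uxy
          mult_carrier_mat[of _ _ "Nfus D a b c"]) auto
    then have "unitary_mat ((\<gamma>' a x y * \<gamma>' b x y / \<gamma>' c x y) \<cdot>\<^sub>m 1\<^sub>m (Nfus D a b c))"
      unfolding rel[OF x y N] by simp
    then have "cmod (\<gamma>' a x y * \<gamma>' b x y / \<gamma>' c x y) = 1" using N by (simp add: unitary_smult_one)
    then show "cmod (\<gamma>' a x y) * cmod (\<gamma>' b x y) = cmod (\<gamma>' c x y)"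
      using nz by (simp add: norm_mult norm_divide divide_eq_eq)
  qed
  have "symmetry_choice Unitary D sU \<gamma>'"
    unfolding symmetry_choice_def Let_def
  proof (intro conjI ballI allI impI)
    fix x assume x: "x \<in> carrier ?Z"
    note lx = E.closed(1)[OF x]
    show "sU x \<in> x" "normalised_sym D (sU x)" using sU x by blast+
    show "\<gamma>' a \<one>\<^bsub>?Z\<^esub> x = 1" "\<gamma>' a x \<one>\<^bsub>?Z\<^esub> = 1" for a
      using x choice(6,7)[OF lx lx] l(1)[OF x] by (simp_all add: \<gamma>'_def one l(4) perm_of_one)
    fix y assume y: "y \<in> carrier ?Z"
    show "\<gamma>' (vac D) x y = 1"
      using choice(5)[OF lx E.closed(1)[OF y]] l(3) x y E.G.m_closed[OF x y] by (simp add: \<gamma>'_def vac)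
  qed (use sU(3) unimodular rel in simp_all)
  moreover have "Omega Unitary D \<gamma>' a x y z =
      Smat D a (transport ?Z to_linear \<beta> (x, y, z)) * Smat D (vac D) (vac D) /
           (Smat D (vac D) (transport ?Z to_linear \<beta> (x, y, z)) * Smat D (vac D) a)"
    if x: "x \<in> carrier ?Z" and y: "y \<in> carrier ?Z" and z: "z \<in> carrier ?Z" for a x y z
  proof -
    note closed = E.G.m_closed[OF x y] E.G.m_closed[OF y z]
    \<comment> \<open>The factors of z in \<gamma>' for the pairs (y, z) and (x y, z) cancel once
      their arguments are identified in this way.\<close>
    have pinv: "perm_inv (perm_of (x \<otimes>\<^bsub>?Z\<^esub> y)) a = perm_inv (perm_of y) (perm_inv (perm_of x) a)"
      unfolding perm_of_mult[OF x y] using o_inv_distrib perm_of_props(1)[OF x] perm_of_props(1)[OF y]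
      by (metis comp_apply)
    have assoc: "x \<otimes>\<^bsub>?Z\<^esub> y \<otimes>\<^bsub>?Z\<^esub> z = x \<otimes>\<^bsub>?Z\<^esub> (y \<otimes>\<^bsub>?Z\<^esub> z)" using x y z by (rule E.G.m_assoc)
    note nz = l(1)[OF x] l(1)[OF y] l(1)[OF z] l(1)[OF closed(1)] l(1)[OF closed(2)] l(1)[OF E.G.m_closed[OF x closed(2)]]
    have "Omega Unitary D \<gamma>' a x y z = Omega Linear D \<gamma> a (to_linear x) (to_linear y) (to_linear z)"
      using nz x y z
      by (simp add: Omega_def Let_def \<gamma>'_def pinv perm E'.mult_\<chi> assoc closed)
    also have "\<dots> = Smat D a (\<beta> (to_linear x, to_linear y, to_linear z)) * Smat D (vac D) (vac D) /
           (Smat D (vac D) (\<beta> (to_linear x, to_linear y, to_linear z)) * Smat D (vac D) a)"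
      using x y z by (simp add: \<Omega> E.closed)
    finally show ?thesis using x y z by (simp add: transport_def)
  qed
  moreover have "transport ?Z to_linear \<beta> \<in> cocycles3 ?Z (one_form D) (sym_action D)"
    by (rule E'.transport_cocycle[OF _ \<beta>]) (simp add: sym_action_def perm)
  ultimately show ?thesis unfolding postnikov_cocycle_def Let_def by blast
qed

lemma conjugate_data_id: "conjugate_data D D id"
  by unfold_locales (auto simp: ring_automorphism_def intro!: eq_matI)

text \<open>From linear to unitary, the scalars \<gamma> have to be recomputed for unitary
  representatives. In the other direction conjugation by the identity suffices, because unitary
  representatives are linear ones.\<close>

lemma unitary_postnikov_equivalence:
  assumes "unitary_gauge D"
  shows "postnikov_equivalence Unitary D Linear D to_linear to_unitary"
proof -
  interpret id: conjugate_data D D id by (rule conjugate_data_id)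
  note equiv = group_equivalence_unitary_linear[OF assms]
  have "conjugate_sym id m \<in> y" if "m \<in> to_unitary y" for m y
  proof -
    have "map_mat id A = A" for A :: "complex mat" by (rule eq_matI) auto
    then have "conjugate_sym id m = m" by (cases m) simp
    then show ?thesis using that by (simp add: to_unitary_def)
  qed
  moreover have "adm_scalar Linear (id z)" if "adm_scalar Unitary z" for z
    using adm_scalar_nonzero[OF that] by simp
  ultimately show ?thesis
    unfolding postnikov_equivalence_def
    using equiv id.postnikov_cocycle_transport[OF equiv] postnikov_cocycle_unitary[OF assms] by blast
qed

end

section \<open>Galois conjugation\<close>

lemma data_entries_subset_K_field: "data_entries D \<subseteq> K_field D"
proof -
  have "data_entries D \<subseteq> data_field D"
    unfolding data_field_def by (blast intro: generate_field.incl)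
  then show ?thesis unfolding K_field_def normal_closure_Q_def by blast
qed

lemma K_field_closed:
  shows "1 \<in> K_field D"
    "x \<in> K_field D \<Longrightarrow> y \<in> K_field D \<Longrightarrow> x * y \<in> K_field D"
    "x \<in> K_field D \<Longrightarrow> y \<in> K_field D \<Longrightarrow> x - y \<in> K_field D"
proof -
  have *: "1 \<in> L" "\<forall>x\<in>L. \<forall>y\<in>L. x * y \<in> L \<and> x - y \<in> L" if "normal_field L" for L
  proof -
    have L: "subring L CC"
      using that subfieldE(1) unfolding normal_field_def by blast
    show "1 \<in> L" using subringE(3)[OF L] by (simp add: ring_of_type_algebra_def)
    \<comment> \<open>The additive inverse of \<open>CC\<close> is the abstract one of its additive
      group and is first identified with the usual minus.\<close>
    have "ring CC" by (rule ring_from_type_algebra)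
    then have "\<ominus>\<^bsub>CC\<^esub> x = - x" for x :: complex
      using abelian_group.minus_equality[of CC "- x" x] by (simp add: ring_def ring_of_type_algebra_def)
    then have "- x \<in> L" if "x \<in> L" for x using subringE(5)[OF L that] by simp
    then show "\<forall>x\<in>L. \<forall>y\<in>L. x * y \<in> L \<and> x - y \<in> L"
      using subringE(6,7)[OF L] by (force simp: ring_of_type_algebra_def simp flip: add_uminus_conv_diff)
  qed
  show "1 \<in> K_field D"
    "x \<in> K_field D \<Longrightarrow> y \<in> K_field D \<Longrightarrow> x * y \<in> K_field D"
    "x \<in> K_field D \<Longrightarrow> y \<in> K_field D \<Longrightarrow> x - y \<in> K_field D"
    unfolding K_field_def normal_closure_Q_def using * by blast+
qed

text \<open>\<open>galois_Q\<close> consists of bijections of K_C onto itself, so the graph of q has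
  equal domain and range, as the extension theorem requires. Injectivity of q gives the vanishing
  condition of \<open>ring_graph\<close>.\<close>

lemma galois_extends_to_automorphism:
  assumes "q \<in> galois_Q (K_field D)"
  obtains \<sigma> where "ring_automorphism \<sigma>" "\<And>x. x \<in> K_field D \<Longrightarrow> \<sigma> x = q x"
proof -
  let ?K = "K_field D"
  define \<Gamma> where "\<Gamma> = (\<lambda>x. (x, q x)) ` ?K"
  have q: "bij_betw q ?K ?K" "q 1 = 1" "\<And>x y. x \<in> ?K \<Longrightarrow> y \<in> ?K \<Longrightarrow> q (x + y) = q x + q y"
    "\<And>x y. x \<in> ?K \<Longrightarrow> y \<in> ?K \<Longrightarrow> q (x * y) = q x * q y"
    using assms by (auto simp: galois_Q_def ring_iso_def Ring.ring_hom_def ring_of_type_algebra_def)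
  note K = K_field_closed[where D = D]
  have diff: "q (x - y) = q x - q y" if "x \<in> ?K" "y \<in> ?K" for x y
    using q(3)[OF K(3)[OF that] that(2)] by simp
  have zero: "0 \<in> ?K" "q 0 = 0" using K(3)[OF K(1) K(1)] diff[OF K(1) K(1)] by simp_all
  have eq0: "q x = 0 \<longleftrightarrow> x = 0" if "x \<in> ?K" for x
    using q(1) that zero by (metis bij_betw_inv_into_left)
  have "ring_graph \<Gamma>"
    unfolding ring_graph_def
  proof (intro conjI)
    show "(1, 1) \<in> \<Gamma>" using K(1) q(2) unfolding \<Gamma>_def by force
    show "\<forall>(x, y)\<in>\<Gamma>. x = 0 \<longleftrightarrow> y = 0" using eq0 by (auto simp: \<Gamma>_def)
    show "\<forall>(x, y)\<in>\<Gamma>. \<forall>(x', y')\<in>\<Gamma>. (x - x', y - y') \<in> \<Gamma> \<and> (x * x', y * y') \<in> \<Gamma>"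
      using K(2,3) diff q(4) by (auto simp: \<Gamma>_def image_iff)
  qed
  moreover have "fst ` \<Gamma> = snd ` \<Gamma>"
    using q(1) by (simp add: \<Gamma>_def image_image bij_betw_def)
  ultimately obtain \<sigma> where "ring_automorphism \<sigma>" "\<And>x y. (x, y) \<in> \<Gamma> \<Longrightarrow> \<sigma> x = y"
    using ring_automorphism_extension by blast
  then show thesis using that by (simp add: \<Gamma>_def)
qed

lemma skeletal_data_of_mtc:
  assumes "modular_tensor_category D"
  shows "skeletal_data D"
  using assms unfolding modular_tensor_category_def braided_def by unfold_locales blast+

text \<open>All admissible entries of F and R lie in K_C, where \<sigma> and q agree. The triangle
  axiom is inherited because its entries are 0 and 1.\<close>

lemma conjugate_data_galois_conjugate:
  assumes mtc: "modular_tensor_category D" and \<sigma>: "ring_automorphism \<sigma>"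
    and q: "\<And>x. x \<in> K_field D \<Longrightarrow> \<sigma> x = q x"
  shows "conjugate_data D (galois_conjugate q D) \<sigma>"
proof -
  let ?D' = "galois_conjugate q D"
  interpret D: skeletal_data D by (rule skeletal_data_of_mtc[OF mtc])
  note S = ring_automorphismD[OF \<sigma>]
  have entries: "Fsym D a b c d x y \<in> K_field D" if "x \<in> left_trees D a b c d" "y \<in> right_trees D a b c d" for a b c d x y
    using that data_entries_subset_K_field[of D] unfolding data_entries_def by blast
  have entries': "Rsym D a b c $$ (\<mu>, \<nu>) \<in> K_field D" if "\<mu> < Nfus D b a c" "\<nu> < Nfus D a b c" for a b c \<mu> \<nu>
    using that data_entries_subset_K_field[of D] unfolding data_entries_def by blast
  have F: "Fsym ?D' a b c d x y = \<sigma> (Fsym D a b c d x y)"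
    if "x \<in> left_trees D a b c d" "y \<in> right_trees D a b c d" for a b c d x y
    using q[OF entries[OF that]] by (simp add: galois_conjugate_def)
  show ?thesis
  proof
    show eq: "vac ?D' = vac D" "Nfus ?D' = Nfus D" by (simp_all add: galois_conjugate_def)
    show "fusion_rules ?D'" using D.fusion unfolding fusion_rules_def eq .
    show "triangle ?D'"
      unfolding triangle_def
    proof (intro allI impI)
      fix a c d \<beta> \<nu> assume "\<beta> < Nfus ?D' a c d" "\<nu> < Nfus ?D' a c d"
      then have i: "\<beta> < Nfus D a c d" "\<nu> < Nfus D a c d" by (simp_all add: galois_conjugate_def)
      then have "Fsym ?D' a (vac D) c d (a, 0, \<beta>) (c, 0, \<nu>) = \<sigma> (Fsym D a (vac D) c d (a, 0, \<beta>) (c, 0, \<nu>))"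
        by (intro F) (simp_all add: left_trees_def right_trees_def D.Nfus_vac_left D.Nfus_vac_right)
      also have "Fsym D a (vac D) c d (a, 0, \<beta>) (c, 0, \<nu>) = (if \<beta> = \<nu> then 1 else 0)"
        using D.triangle i unfolding triangle_def by blast
      finally show "Fsym ?D' a (vac ?D') c d (a, 0, \<beta>) (c, 0, \<nu>) = (if \<beta> = \<nu> then 1 else 0)"
        by (simp add: galois_conjugate_def S)
    qed
    show "Rsym ?D' a b c \<in> carrier_mat (Nfus ?D' b a c) (Nfus ?D' a b c)" for a b c
      using D.Rsym_carrier by (simp add: galois_conjugate_def)
    show "ring_automorphism \<sigma>" by (rule \<sigma>)
    \<comment> \<open>\<open>galois_conjugate\<close> leaves the pivotal coefficients alone, and
      \<sigma> fixes them because they are 1 or -1.\<close>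
    show "piv ?D' a = \<sigma> (piv D a)" for a
    proof -
      have "piv D a \<in> {1, - 1}"
        using mtc unfolding modular_tensor_category_def spherical_def pivotal_def by blast
      then show ?thesis by (auto simp: galois_conjugate_def S)
    qed
    show "Fsym ?D' a b c d x y = \<sigma> (Fsym D a b c d x y)"
      if "x \<in> left_trees D a b c d" "y \<in> right_trees D a b c d" for a b c d x y
      using that by (rule F)
    show "Rsym ?D' a b c = map_mat \<sigma> (Rsym D a b c)" for a b c
      using D.Rsym_carrier[of a b c] entries'[of _ b a c]
      by (intro eq_matI) (auto simp: galois_conjugate_def q)
  qed
qed

text \<open>The gauge condition is imposed on C and on its conjugate separately, since \<sigma> need
  not send unitary matrices to unitary ones.\<close>

theorem corollary4p5:
  fixes D :: "'a::finite mtc_data"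
    and q :: "complex \<Rightarrow> complex"
  assumes "modular_tensor_category D"
    and "number_field (data_field D)"
    and "q \<in> galois_Q (K_field D)"
  shows "two_group_iso (two_group_symmetry Linear D)
           (two_group_symmetry Linear (galois_conjugate q D)) \<and>
         (unitary_gauge D \<and> unitary_gauge (galois_conjugate q D) \<longrightarrow>
           two_group_iso (two_group_symmetry Unitary D)
             (two_group_symmetry Unitary (galois_conjugate q D)))"
proof -
  let ?D' = "galois_conjugate q D"
  obtain \<sigma> where \<sigma>: "ring_automorphism \<sigma>" "\<And>x. x \<in> K_field D \<Longrightarrow> \<sigma> x = q x"
    using galois_extends_to_automorphism[OF assms(3)] by blast
  interpret conjugate_data D ?D' \<sigma>
    by (rule conjugate_data_galois_conjugate[OF assms(1) \<sigma>])
  have linear: "two_group_iso (two_group_symmetry Linear D) (two_group_symmetry Linear ?D')"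
    by (rule two_group_iso_of_postnikov_equivalence[OF linear_postnikov_equivalence])
  moreover have "two_group_iso (two_group_symmetry Unitary D) (two_group_symmetry Unitary ?D')"
    if "unitary_gauge D" "unitary_gauge ?D'"
  proof -
    have "two_group_iso (two_group_symmetry Unitary D) (two_group_symmetry Linear D)"
      by (rule two_group_iso_of_postnikov_equivalence[OF D.unitary_postnikov_equivalence[OF that(1)]])
    moreover have "two_group_iso (two_group_symmetry Linear ?D') (two_group_symmetry Unitary ?D')"
      by (rule two_group_iso_of_postnikov_equivalence[OF
            postnikov_equivalence_swap[OF D'.unitary_postnikov_equivalence[OF that(2)]]])
    ultimately show ?thesis using linear two_group_iso_trans by blast
  qed
  ultimately show ?thesis by blast
qed

end
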